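(* Let $b\ge 1$ and let $\nu$ be a symmetric probability law on $\mathbb{R}$ supported on $[-b,b]$ with $\int x^2\,\nu(dx)=1$. Assume that, for some $\zeta_*\in\mathcal{P}_2(\mathcal{P}_2(\mathbb{R}))$, $\mathcal{W}_2(\zeta_N^G,\zeta_* )\to0$ as $N\to\infty$, and let $\mu_*$ be a random probability measure with law $\zeta_*$. Put $S_*=\int x^2\,\mu_*(dx)$. Then the law of $S_N^J$ under $\nu$-disorder converges, as $N\to\infty$, in the Wasserstein-1 distance $W_1$ to the law of $S_*$. If, in addition, there are $c>0$ and $M<\infty$ such that $$\sup_{N\ge2}\mathbb{E}_G\left\langle e^{cN^{1/3}|R_{12}|}\right\rangle\le M,$$ then, for every finite $p\ge1$, as $N\to\infty$, $$W_p\bigl(\mathrm{Law}_\nu(S_N^J),\mathrm{Law}(S_* )\bigr)\longrightarrow0,\qquad \mathbb{E}_\nu[(S_N^J)^p]\longrightarrow\mathbb{E}[S_*^p]<\infty.$$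
   Context: For an integer $N\ge 2$ let $\Sigma_N=\{-1,1\}^N$. Given real couplings $J=(J_{ij})_{1\le i<j\le N}$, define for $\sigma\in\Sigma_N$ $$H_N^J(\sigma)=\frac1{\sqrt N}\sum_{1\le i<j\le N}J_{ij}\sigma_i\sigma_j,\qquad G_N^J(\sigma)=\frac{e^{H_N^J(\sigma)}}{\sum_{\tau\in\Sigma_N}e^{H_N^J(\tau)}}.$$ Angle brackets $\langle\cdot\rangle$ (or $\langle\cdot\rangle_J$) denote expectation over independent replicas $\sigma^1,\sigma^2,\ldots$ sampled from $G_N^J$, conditional on $J$. The overlap is $R_{12}=N^{-1}\sum_{i=1}^N\sigma_i^1\sigma_i^2$. $\mathbb{E}_G$ denotes expectation over $J$ when the $J_{ij}$, $i<j$, are independent standard Gaussians; $\mathbb{E}_\nu$ and $\mathrm{Law}_\nu$ denote expectation and law when the $J_{ij}$, $i<j$, are independent with common law $\nu$ ("$\nu$-disorder"). The random quenched overlap measure is $\mu_N^J=\langle\delta_{N^{1/3}R_{12}}\rangle$, i.e. the conditional law of $N^{1/3}R_{12}$ given $J$, and $\zeta_N^G$ is the law of the random measure $\mu_N^J$ under Gaussian disorder. The sample spin-glass susceptibility is $$\chi_{\mathrm{SG},N}^J=\frac1N\sum_{i,j=1}^N\langle\sigma_i\sigma_j\rangle_J^2=N\langle R_{12}^2\rangle_J,$$ and the rescaled susceptibility is $S_N^J=N^{-1/3}\chi_{\mathrm{SG},N}^J=\int x^2\,\mu_N^J(dx)$. $\mathcal{P}_2(\mathbb{R})$ is the set of probability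 measures on $\mathbb{R}$ with finite second moment, equipped with the usual Wasserstein-2 distance $W_2$. $\mathcal{P}_2(\mathcal{P}_2(\mathbb{R}))$ is the set of Borel probability measures $\zeta$ on $(\mathcal{P}_2(\mathbb{R}),W_2)$ with $\int W_2(\mu,\delta_0)^2\,\zeta(d\mu)<\infty$, equipped with $$\mathcal{W}_2(\zeta,\zeta')^2=\inf_{\pi\in\Pi(\zeta,\zeta')}\int W_2(\mu,\mu')^2\,\pi(d\mu,d\mu'),$$ where $\Pi(\zeta,\zeta')$ is the set of couplings of $\zeta$ and $\zeta'$. $W_p$ is the usual Wasserstein-$p$ distance on probability laws on $\mathbb{R}$. *)

theory Defs
  imports "HOL-Probability.Probability"
begin

section \<open>Wasserstein distances\<close>

definition couplings :: "'a measure \<Rightarrow> 'b measure \<Rightarrow> ('a \<times> 'b) measure set" where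
  "couplings M N = {\<pi>. prob_space \<pi> \<and> sets \<pi> = sets (M \<Otimes>\<^sub>M N) \<and>
                        distr \<pi> M fst = M \<and> distr \<pi> N snd = N}"

definition ennreal_root :: "real \<Rightarrow> ennreal \<Rightarrow> ennreal" where
  "ennreal_root p x = (if x = \<top> then \<top> else ennreal (enn2real x powr (1 / p)))"

text \<open>The value is \<open>\<top>\<close> when every coupling has infinite cost, so that convergence to \<open>0\<close> never
  holds by convention.\<close>

definition wasserstein ::
    "real \<Rightarrow> ('a \<Rightarrow> 'a \<Rightarrow> real) \<Rightarrow> 'a measure \<Rightarrow> 'a measure \<Rightarrow> ennreal" where
  "wasserstein p d M N =
     ennreal_root p (INF \<pi>\<in>couplings M N. \<integral>\<^sup>+ z. ennreal (d (fst z) (snd z) powr p) \<partial>\<pi>)"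

abbreviation wasserstein_real :: "real \<Rightarrow> real measure \<Rightarrow> real measure \<Rightarrow> ennreal" where
  "wasserstein_real p \<equiv> wasserstein p dist"

definition P2 :: "real measure set" where
  "P2 = {\<mu>. prob_space \<mu> \<and> sets \<mu> = sets borel \<and> (\<integral>\<^sup>+ x. ennreal (x\<^sup>2) \<partial>\<mu>) < \<infinity>}"

text \<open>Only used on \<open>P2\<close>, where the extended distance is finite (consider the product coupling), so
  that \<^const>\<open>enn2real\<close> loses nothing.\<close>

definition W2 :: "real measure \<Rightarrow> real measure \<Rightarrow> real" where
  "W2 \<mu> \<mu>' = enn2real (wasserstein_real 2 \<mu> \<mu>')"

definition borel_P2 :: "real measure measure" where
  "borel_P2 = sigma P2 {U. openin (Metric_space.mtopology P2 W2) U}"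

definition P2P2 :: "real measure measure set" where
  "P2P2 = {\<zeta>. prob_space \<zeta> \<and> sets \<zeta> = sets borel_P2 \<and>
              (\<integral>\<^sup>+ \<mu>. ennreal ((W2 \<mu> (return borel 0))\<^sup>2) \<partial>\<zeta>) < \<infinity>}"

definition WW2 :: "real measure measure \<Rightarrow> real measure measure \<Rightarrow> ennreal" where
  "WW2 \<zeta> \<zeta>' = wasserstein 2 W2 \<zeta> \<zeta>'"

section \<open>The Sherrington--Kirkpatrick model at the critical temperature\<close>

definition spins :: "nat \<Rightarrow> (nat \<Rightarrow> real) set" where
  "spins N = {1..N} \<rightarrow>\<^sub>E {-1, 1}"

definition edges :: "nat \<Rightarrow> (nat \<times> nat) set" where
  "edges N = {(i, j). 1 \<le> i \<and> i < j \<and> j \<le> N}"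

definition hamiltonian :: "nat \<Rightarrow> (nat \<times> nat \<Rightarrow> real) \<Rightarrow> (nat \<Rightarrow> real) \<Rightarrow> real" where
  "hamiltonian N J \<sigma> = 1 / sqrt (real N) * (\<Sum>(i, j)\<in>edges N. J (i, j) * \<sigma> i * \<sigma> j)"

definition gibbs_weight :: "nat \<Rightarrow> (nat \<times> nat \<Rightarrow> real) \<Rightarrow> (nat \<Rightarrow> real) \<Rightarrow> real" where
  "gibbs_weight N J \<sigma> = exp (hamiltonian N J \<sigma>) / (\<Sum>\<tau>\<in>spins N. exp (hamiltonian N J \<tau>))"

definition gibbs :: "nat \<Rightarrow> (nat \<times> nat \<Rightarrow> real) \<Rightarrow> (nat \<Rightarrow> real) measure" where
  "gibbs N J = point_measure (spins N) (\<lambda>\<sigma>. ennreal (gibbs_weight N J \<sigma>))"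

definition two_replicas ::
    "nat \<Rightarrow> (nat \<times> nat \<Rightarrow> real) \<Rightarrow> ((nat \<Rightarrow> real) \<times> (nat \<Rightarrow> real)) measure" where
  "two_replicas N J = gibbs N J \<Otimes>\<^sub>M gibbs N J"

definition overlap :: "nat \<Rightarrow> (nat \<Rightarrow> real) \<times> (nat \<Rightarrow> real) \<Rightarrow> real" where
  "overlap N = (\<lambda>(\<sigma>, \<tau>). (\<Sum>i = 1..N. \<sigma> i * \<tau> i) / real N)"

definition overlap_measure :: "nat \<Rightarrow> (nat \<times> nat \<Rightarrow> real) \<Rightarrow> real measure" where
  "overlap_measure N J =
     distr (two_replicas N J) borel (\<lambda>r. real N powr (1/3) * overlap N r)"

definition susceptibility :: "nat \<Rightarrow> (nat \<times> nat \<Rightarrow> real) \<Rightarrow> real" where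
  "susceptibility N J =
     1 / real N * (\<Sum>i = 1..N. \<Sum>j = 1..N. (\<integral>\<sigma>. \<sigma> i * \<sigma> j \<partial>gibbs N J)\<^sup>2)"

definition rescaled_susceptibility :: "nat \<Rightarrow> (nat \<times> nat \<Rightarrow> real) \<Rightarrow> real" where
  "rescaled_susceptibility N J = real N powr (-1/3) * susceptibility N J"

definition disorder :: "real measure \<Rightarrow> nat \<Rightarrow> (nat \<times> nat \<Rightarrow> real) measure" where
  "disorder \<nu> N = (\<Pi>\<^sub>M e\<in>edges N. \<nu>)"

definition std_gaussian :: "real measure" where
  "std_gaussian = density lborel std_normal_density"

definition zetaG :: "nat \<Rightarrow> real measure measure" where
  "zetaG N = distr (disorder std_gaussian N) borel_P2 (overlap_measure N)"

definition law_S :: "real measure \<Rightarrow> nat \<Rightarrow> real measure" where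
  "law_S \<nu> N = distr (disorder \<nu> N) borel (rescaled_susceptibility N)"

section \<open>Well-definedness\<close>

lemma finite_spins: "finite (spins N)"
  unfolding spins_def by (intro finite_PiE) auto

lemma spins_nonempty: "spins N \<noteq> {}"
  unfolding spins_def by (auto simp: PiE_eq_empty_iff)

lemma sum_gibbs_weight: "(\<Sum>\<sigma>\<in>spins N. gibbs_weight N J \<sigma>) = 1"
proof -
  have "(\<Sum>\<tau>\<in>spins N. exp (hamiltonian N J \<tau>)) > 0"
    by (intro sum_pos finite_spins spins_nonempty) auto
  then show ?thesis
    by (simp add: gibbs_weight_def sum_divide_distrib[symmetric])
qed

lemma gibbs_weight_nonneg: "gibbs_weight N J \<sigma> \<ge> 0"
  unfolding gibbs_weight_def by (intro divide_nonneg_nonneg sum_nonneg) auto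

lemma prob_space_gibbs: "prob_space (gibbs N J)"
proof
  have "emeasure (gibbs N J) (space (gibbs N J)) = (\<Sum>\<sigma>\<in>spins N. ennreal (gibbs_weight N J \<sigma>))"
    unfolding gibbs_def space_point_measure
    by (rule emeasure_point_measure_finite[OF finite_spins order_refl])
  then show "emeasure (gibbs N J) (space (gibbs N J)) = 1"
    by (simp add: sum_ennreal gibbs_weight_nonneg sum_gibbs_weight)
qed

lemma gibbs_measurable: "f \<in> borel_measurable (gibbs N J)" for f :: "_ \<Rightarrow> real"
  by (simp add: gibbs_def measurable_point_measure_eq1)

lemma gibbs_integrable: "integrable (gibbs N J) f" for f :: "_ \<Rightarrow> real"
  unfolding gibbs_def by (rule integrable_point_measure_finite[OF finite_spins])

lemma two_replicas_product:
  fixes f g :: "(nat \<Rightarrow> real) \<Rightarrow> real"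
  shows "integrable (two_replicas N J) (\<lambda>r. f (fst r) * g (snd r))" (is ?I)
    and "(\<integral>r. f (fst r) * g (snd r) \<partial>two_replicas N J) =
           (\<integral>\<sigma>. f \<sigma> \<partial>gibbs N J) * (\<integral>\<tau>. g \<tau> \<partial>gibbs N J)" (is ?E)
proof -
  interpret G: prob_space "gibbs N J" by (rule prob_space_gibbs)
  interpret GG: pair_prob_space "gibbs N J" "gibbs N J" ..
  note [measurable] = gibbs_measurable[of f N J] gibbs_measurable[of g N J]
  show I: ?I
    unfolding two_replicas_def
  proof (rule GG.Fubini_integrable)
    show "(\<lambda>r. f (fst r) * g (snd r)) \<in> borel_measurable (gibbs N J \<Otimes>\<^sub>M gibbs N J)"
      by measurable
  qed (simp_all add: gibbs_integrable)
  show ?E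
    using GG.integral_fst'[OF I[unfolded two_replicas_def]]
    by (simp add: two_replicas_def)
qed

text \<open>The other expressions for the susceptibility: \<open>\<chi> = N \<langle>R\<^sub>1\<^sub>2\<^sup>2\<rangle>\<close> and \<open>S = \<integral> x\<^sup>2 d\<mu>\<close>.\<close>

lemma susceptibility_eq_overlap:
  assumes "N \<ge> 1"
  shows "susceptibility N J = real N * (\<integral>r. (overlap N r)\<^sup>2 \<partial>two_replicas N J)"
proof -
  have sq: "(overlap N r)\<^sup>2 = (\<Sum>i = 1..N. \<Sum>j = 1..N.
      (fst r i * fst r j) * (snd r i * snd r j)) / (real N)\<^sup>2" for r
    by (cases r) (simp add: overlap_def power_divide power2_eq_square sum_product mult_ac)
  have "(\<integral>r. (overlap N r)\<^sup>2 \<partial>two_replicas N J) =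
      (\<Sum>i = 1..N. \<Sum>j = 1..N. (\<integral>\<sigma>. \<sigma> i * \<sigma> j \<partial>gibbs N J)\<^sup>2) / (real N)\<^sup>2"
    unfolding sq
    by (subst integral_divide_zero, subst Bochner_Integration.integral_sum,
        (intro Bochner_Integration.integrable_sum two_replicas_product(1)),
        subst Bochner_Integration.integral_sum, rule two_replicas_product(1))
       (simp add: two_replicas_product(2)[of N J "\<lambda>\<sigma>. \<sigma> _ * \<sigma> _" "\<lambda>\<sigma>. \<sigma> _ * \<sigma> _"]
          power2_eq_square)
  then show ?thesis
    using assms by (simp add: susceptibility_def power2_eq_square)
qed

lemma rescaled_susceptibility_eq:
  assumes "N \<ge> 1"
  shows "rescaled_susceptibility N J = (\<integral>x. x\<^sup>2 \<partial>overlap_measure N J)"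
proof -
  note [measurable] = gibbs_measurable
  have "overlap N \<in> borel_measurable (two_replicas N J)"
    unfolding overlap_def two_replicas_def split_beta by measurable
  then have "(\<integral>x. x\<^sup>2 \<partial>overlap_measure N J) =
      (\<integral>r. (real N powr (1/3) * overlap N r)\<^sup>2 \<partial>two_replicas N J)"
    unfolding overlap_measure_def by (subst integral_distr) auto
  also have "\<dots> = real N powr (2/3) * (\<integral>r. (overlap N r)\<^sup>2 \<partial>two_replicas N J)"
    by (simp add: power_mult_distrib power2_eq_square[of "real N powr _"] powr_add[symmetric])
  also have "real N powr (2/3) = real N powr (-1/3) * real N"
    using assms powr_add[of "real N" "-1/3" 1] by simp
  finally show ?thesis
    using assms by (simp add: rescaled_susceptibility_def susceptibility_eq_overlap)
qed

end

theory Submission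
  imports Defs "HOL-Real_Asymp.Real_Asymp"
begin

text \<open>
  The susceptibility \<open>S\<close> is the second moment of the overlap measure \<open>\<mu>\<close>, so \<open>sqrt S\<close> is the \<open>L\<^sup>2\<close> norm
  of the identity under \<open>\<mu>\<close>. By Minkowski's inequality the \<open>L\<^sup>2\<close> norm of any contraction \<open>\<phi>\<close> is
  \<open>1\<close>-Lipschitz in \<open>\<mu>\<close> for \<open>W2\<close> (\<open>L2_size_Lipschitz\<close>). A near-optimal coupling of the Gaussian law with its
  limit therefore couples the two susceptibilities, and also their tails \<open>\<integral> (\<bar>x\<bar> - K)\<^sub>+\<^sup>2 d\<mu>\<close>
  (\<open>gaussian_convergence\<close>). What remains is to replace Gaussian bonds by bonds of law \<open>\<nu>\<close>.

  The dependence of a two-replica average on one bond \<open>J\<^sub>e\<close> is explicit. Since \<open>X = \<sigma>\<^sub>i \<sigma>\<^sub>j\<close> is a sign,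
  \<open>exp (t X) = cosh t (1 + u X)\<close> with \<open>u = tanh t\<close>, \<open>t = J\<^sub>e / sqrt N\<close>. So the average is
  \<open>(a + u d\<^sub>1 + u\<^sup>2 d\<^sub>2) / (1 + u m)\<^sup>2\<close>, where \<open>a, d\<^sub>1, d\<^sub>2, m\<close> are averages at \<open>J\<^sub>e = 0\<close>. Odd powers
  of \<open>u\<close> integrate to zero by symmetry, the quadratic term depends on the law only through its
  variance up to \<open>O(N\<^sup>-\<^sup>2)\<close>, and hence exchanging the law of one bond costs \<open>O(N\<^sup>-\<^sup>2)\<close>
  (\<open>bond_expectation\<close>). There are about \<open>N\<^sup>2 / 2\<close> bonds, so this cost is exactly borderline.

  For a nonnegative observable the cost is \<open>O(N\<^sup>-\<^sup>2)\<close> relative to its own average, and all exchanges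
  together change its expectation by at most a constant factor (\<open>moment_transfer\<close>). This carries tails
  and exponential moments from Gaussian to \<open>\<nu>\<close>-disorder.

  For a power of the average \<open>\<langle>A\<rangle>\<close> of a bounded observable the cost is \<open>O(N\<^sup>-\<^sup>2)\<close> times the influence
  \<open>\<bar>m\<bar> + \<bar>d\<^sub>1\<bar> + \<bar>d\<^sub>2\<bar>\<close> of the bond (\<open>one_bond_power\<close>). By positive definiteness the influences of all bonds
  add up to at most a constant times \<open>N\<^sup>2 (\<eta> + \<langle>R\<^sub>1\<^sub>2\<^sup>2\<rangle> / \<eta>)\<close>, for any \<open>\<eta> > 0\<close> (\<open>sum_influence_le\<close>). As \<open>S\<close> is
  bounded in mean, the choice \<open>\<eta> = N\<^sup>-\<^sup>1\<^sup>/\<^sup>3\<close> makes this \<open>O(N\<^sup>5\<^sup>/\<^sup>3)\<close> in expectation. The bound holds for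
  each fixed disorder law, while the law changes along the exchange; taking at each step the
  bond of least cost loses only a factor \<open>log N\<close> (\<open>greedy_exchange\<close>). So powers, hence continuous
  functions, of \<open>\<langle>A\<rangle>\<close> have asymptotically equal expectations (\<open>continuous_universality\<close>).

  Truncating \<open>x\<^sup>2\<close> at a large level gives such an \<open>A\<close>, and the tails are uniformly small under both
  disorders. This gives weak convergence of \<open>S\<close> under \<open>\<nu>\<close>-disorder together with uniform integrability,
  and these imply Wasserstein convergence (\<open>weak_conv_imp_wasserstein\<close>). With an exponential moment of the
  overlap all moments of \<open>S\<close> are bounded, and the same argument applies to each \<open>p\<close>.
\<close>

section \<open>The metric space of laws with finite second moment\<close>

text \<open>Pointwise, \<open>(f + g)\<^sup>2 \<le> (1 + B / A) f\<^sup>2 + (1 + A / B) g\<^sup>2\<close>, and these weights are the optimal ones when \<open>A\<close>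
  and \<open>B\<close> are the two norms.\<close>

lemma minkowski_nn_integral:
  fixes f g :: "'a \<Rightarrow> real"
  assumes [measurable]: "f \<in> borel_measurable M" "g \<in> borel_measurable M"
    and A: "0 < A" and B: "0 < B"
    and f: "(\<integral>\<^sup>+ x. ennreal ((f x)\<^sup>2) \<partial>M) \<le> ennreal (A\<^sup>2)"
    and g: "(\<integral>\<^sup>+ x. ennreal ((g x)\<^sup>2) \<partial>M) \<le> ennreal (B\<^sup>2)"
  shows "(\<integral>\<^sup>+ x. ennreal ((f x + g x)\<^sup>2) \<partial>M) \<le> ennreal ((A + B)\<^sup>2)"
proof -
  have pt: "(f x + g x)\<^sup>2 \<le> (1 + B / A) * (f x)\<^sup>2 + (1 + A / B) * (g x)\<^sup>2" for x
  proof -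
    have "0 \<le> (B * f x - A * g x)\<^sup>2 / (A * B)"
      using A B by (intro divide_nonneg_nonneg) auto
    also have "\<dots> = (1 + B / A) * (f x)\<^sup>2 + (1 + A / B) * (g x)\<^sup>2 - (f x + g x)\<^sup>2"
      using A B by (simp add: field_simps power2_eq_square)
    finally show ?thesis by simp
  qed
  have "(\<integral>\<^sup>+ x. ennreal ((f x + g x)\<^sup>2) \<partial>M)
      \<le> (\<integral>\<^sup>+ x. ennreal (1 + B / A) * ennreal ((f x)\<^sup>2) + ennreal (1 + A / B) * ennreal ((g x)\<^sup>2) \<partial>M)"
    using A B
    by (intro nn_integral_mono)
       (use pt in \<open>simp add: ennreal_mult[symmetric] ennreal_plus[symmetric] del: ennreal_plus\<close>)
  also have "\<dots> = ennreal (1 + B / A) * (\<integral>\<^sup>+ x. ennreal ((f x)\<^sup>2) \<partial>M)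
      + ennreal (1 + A / B) * (\<integral>\<^sup>+ x. ennreal ((g x)\<^sup>2) \<partial>M)"
    by (simp add: nn_integral_add nn_integral_cmult)
  also have "\<dots> \<le> ennreal (1 + B / A) * ennreal (A\<^sup>2) + ennreal (1 + A / B) * ennreal (B\<^sup>2)"
    by (intro add_mono mult_left_mono f g) auto
  also have "\<dots> = ennreal ((A + B)\<^sup>2)"
    using A B by (simp add: ennreal_mult[symmetric] ennreal_plus[symmetric] del: ennreal_plus)
      (simp add: field_simps power2_eq_square)
  finally show ?thesis .
qed

lemma ennreal_root_le:
  assumes "0 \<le> r" "0 < p" "x \<le> ennreal (r powr p)"
  shows "ennreal_root p x \<le> ennreal r"
proof -
  have "x \<noteq> \<top>" using assms(3) by (auto simp: top_unique)
  moreover have "enn2real x powr (1 / p) \<le> r"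
  proof -
    have "enn2real x \<le> r powr p"
      using assms(3) by (simp add: enn2real_leI)
    then have "enn2real x powr (1 / p) \<le> (r powr p) powr (1 / p)"
      using assms by (intro powr_mono2) auto
    then show ?thesis using assms by (simp add: powr_powr)
  qed
  ultimately show ?thesis by (simp add: ennreal_root_def ennreal_leI)
qed

lemma wasserstein_le:
  assumes "\<pi> \<in> couplings M N" "0 \<le> r" "0 < p"
    and "(\<integral>\<^sup>+ z. ennreal (d (fst z) (snd z) powr p) \<partial>\<pi>) \<le> ennreal (r powr p)"
  shows "wasserstein p d M N \<le> ennreal r"
  unfolding wasserstein_def
  by (rule ennreal_root_le[OF assms(2,3)], rule INF_lower2[OF assms(1)], rule assms(4))

lemma wasserstein_less_coupling:
  assumes "wasserstein p d M N < ennreal r" "0 < p"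
  obtains \<pi> where "\<pi> \<in> couplings M N"
    "(\<integral>\<^sup>+ z. ennreal (d (fst z) (snd z) powr p) \<partial>\<pi>) < ennreal (r powr p)"
proof -
  define I where "I = (INF \<pi>\<in>couplings M N. \<integral>\<^sup>+ z. ennreal (d (fst z) (snd z) powr p) \<partial>\<pi>)"
  have lt: "ennreal_root p I < ennreal r"
    using assms(1) by (simp add: wasserstein_def I_def)
  then have top: "I \<noteq> \<top>" by (auto simp: ennreal_root_def)
  then have *: "enn2real I powr (1 / p) < r"
    using lt by (simp add: ennreal_root_def ennreal_less_iff)
  have "enn2real I < r powr p"
  proof -
    have "enn2real I = (enn2real I powr (1 / p)) powr p"
      using assms(2) by (simp add: powr_powr)
    also have "\<dots> < r powr p"
      using * assms(2) by (intro powr_less_mono2) auto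
    finally show ?thesis .
  qed
  then have "I < ennreal (r powr p)"
    using top by (metis ennreal_enn2real_if ennreal_less_iff enn2real_nonneg)
  then show thesis
    unfolding I_def INF_less_iff using that by blast
qed

lemma W2_le:
  assumes "\<pi> \<in> couplings \<mu> \<mu>'" "0 \<le> r"
    and "(\<integral>\<^sup>+ z. ennreal ((fst z - snd z)\<^sup>2) \<partial>\<pi>) \<le> ennreal (r\<^sup>2)"
  shows "W2 \<mu> \<mu>' \<le> r"
proof -
  have "wasserstein_real 2 \<mu> \<mu>' \<le> ennreal r"
    by (rule wasserstein_le[OF assms(1,2)]) (use assms in \<open>simp_all add: dist_real_def\<close>)
  then show ?thesis
    unfolding W2_def using assms(2) by (simp add: enn2real_leI)
qed

lemma P2_D:
  assumes "\<mu> \<in> P2"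
  shows "prob_space \<mu>" "sets \<mu> = sets borel" "space \<mu> = UNIV"
    "integrable \<mu> (\<lambda>x. x\<^sup>2)"
proof -
  show "prob_space \<mu>" and s: "sets \<mu> = sets borel" using assms by (auto simp: P2_def)
  show "space \<mu> = UNIV" using sets_eq_imp_space_eq[OF s] by simp
  have "(\<lambda>x::real. x\<^sup>2) \<in> borel_measurable \<mu>"
    by (subst measurable_cong_sets[OF s refl]) measurable
  then show "integrable \<mu> (\<lambda>x. x\<^sup>2)"
    using assms by (intro integrableI_nonneg) (auto simp: P2_def)
qed

lemma couplings_borel_D:
  assumes "\<pi> \<in> couplings \<mu> \<mu>'" and s: "sets \<mu> = sets borel" "sets \<mu>' = sets borel"
  shows "prob_space \<pi>" "sets \<pi> = sets (borel \<Otimes>\<^sub>M borel)"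
    "distr \<pi> borel fst = \<mu>" "distr \<pi> borel snd = \<mu>'"
proof -
  show "prob_space \<pi>" using assms by (simp add: couplings_def)
  show "sets \<pi> = sets (borel \<Otimes>\<^sub>M borel)"
    using assms sets_pair_measure_cong[OF s] by (simp add: couplings_def)
  show "distr \<pi> borel fst = \<mu>"
    using assms distr_cong[OF refl s(1), of \<pi> fst fst] by (simp add: couplings_def)
  show "distr \<pi> borel snd = \<mu>'"
    using assms distr_cong[OF refl s(2), of \<pi> snd snd] by (simp add: couplings_def)
qed

lemma couplings_borel_I:
  assumes "prob_space \<pi>" "sets \<pi> = sets (borel \<Otimes>\<^sub>M borel)"
    and s: "sets \<mu> = sets borel" "sets \<mu>' = sets borel"
    and "distr \<pi> borel fst = \<mu>" "distr \<pi> borel snd = \<mu>'"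
  shows "\<pi> \<in> couplings \<mu> \<mu>'"
  unfolding couplings_def
  using assms sets_pair_measure_cong[OF s] distr_cong[OF refl s(1), of \<pi> fst fst]
    distr_cong[OF refl s(2), of \<pi> snd snd] by simp

lemma nn_integral_coupling_fst:
  assumes "sets \<pi> = sets (borel \<Otimes>\<^sub>M borel)" "f \<in> borel_measurable borel"
  shows "(\<integral>\<^sup>+ z. f (fst z) \<partial>\<pi>) = (\<integral>\<^sup>+ x. f x \<partial>distr \<pi> borel fst)"
  using assms by (subst nn_integral_distr) (auto simp: measurable_cong_sets[OF assms(1) refl])

lemma nn_integral_coupling_snd:
  assumes "sets \<pi> = sets (borel \<Otimes>\<^sub>M borel)" "f \<in> borel_measurable borel"
  shows "(\<integral>\<^sup>+ z. f (snd z) \<partial>\<pi>) = (\<integral>\<^sup>+ x. f x \<partial>distr \<pi> borel snd)"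
  using assms by (subst nn_integral_distr) (auto simp: measurable_cong_sets[OF assms(1) refl])

lemma product_coupling:
  assumes "\<mu> \<in> P2" "\<mu>' \<in> P2"
  shows "\<mu> \<Otimes>\<^sub>M \<mu>' \<in> couplings \<mu> \<mu>'"
proof -
  interpret M: prob_space \<mu> by (rule P2_D[OF assms(1)])
  interpret N: prob_space \<mu>' by (rule P2_D[OF assms(2)])
  interpret pair_prob_space \<mu> \<mu>' ..
  have 1: "distr (\<mu> \<Otimes>\<^sub>M \<mu>') \<mu> fst = \<mu>"
    by (rule N.distr_pair_fst)
  have 2: "distr (\<mu> \<Otimes>\<^sub>M \<mu>') \<mu>' snd = \<mu>'"
  proof (rule measure_eqI)
    fix A assume A: "A \<in> sets (distr (\<mu> \<Otimes>\<^sub>M \<mu>') \<mu>' snd)"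
    have "snd -` A \<inter> space (\<mu> \<Otimes>\<^sub>M \<mu>') = space \<mu> \<times> A"
      using sets.sets_into_space[of A \<mu>'] A by (auto simp: space_pair_measure)
    then show "emeasure (distr (\<mu> \<Otimes>\<^sub>M \<mu>') \<mu>' snd) A = emeasure \<mu>' A"
      using A by (simp add: emeasure_distr N.emeasure_pair_measure_Times M.emeasure_space_1)
  qed simp
  show ?thesis
    using 1 2 P.prob_space_axioms by (simp add: couplings_def)
qed

lemma W2_finite:
  assumes "\<mu> \<in> P2" "\<mu>' \<in> P2"
  shows "wasserstein_real 2 \<mu> \<mu>' = ennreal (W2 \<mu> \<mu>')"
proof -
  note D = couplings_borel_D[OF product_coupling[OF assms] P2_D(2)[OF assms(1)] P2_D(2)[OF assms(2)]]
  let ?\<pi> = "\<mu> \<Otimes>\<^sub>M \<mu>'"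
  have [measurable]: "fst \<in> borel_measurable ?\<pi>" "snd \<in> borel_measurable ?\<pi>"
    by (auto simp: measurable_cong_sets[OF D(2) refl])
  have bound: "\<exists>A>0. x \<le> ennreal (A\<^sup>2)" if "x < \<top>" for x
  proof (intro exI conjI)
    show "0 < sqrt (enn2real x) + 1" using real_sqrt_ge_zero[OF enn2real_nonneg, of x] by linarith
    have "enn2real x \<le> (sqrt (enn2real x) + 1)\<^sup>2" by (simp add: power2_eq_square field_simps)
    then show "x \<le> ennreal ((sqrt (enn2real x) + 1)\<^sup>2)"
      using that by (metis ennreal_enn2real_if ennreal_leI less_irrefl)
  qed
  obtain A B where A: "0 < A" "(\<integral>\<^sup>+ x. ennreal (x\<^sup>2) \<partial>\<mu>) \<le> ennreal (A\<^sup>2)"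
    and B: "0 < B" "(\<integral>\<^sup>+ x. ennreal (x\<^sup>2) \<partial>\<mu>') \<le> ennreal (B\<^sup>2)"
    using assms bound[of "\<integral>\<^sup>+ x. ennreal (x\<^sup>2) \<partial>\<mu>"] bound[of "\<integral>\<^sup>+ x. ennreal (x\<^sup>2) \<partial>\<mu>'"]
    by (auto simp: P2_def)
  have "(\<integral>\<^sup>+ z. ennreal ((fst z + - snd z)\<^sup>2) \<partial>?\<pi>) \<le> ennreal ((A + B)\<^sup>2)"
    using A B nn_integral_coupling_fst[OF D(2), of "\<lambda>x. ennreal (x\<^sup>2)"]
      nn_integral_coupling_snd[OF D(2), of "\<lambda>x. ennreal (x\<^sup>2)"] D(3,4)
    by (intro minkowski_nn_integral) simp_all
  then have "wasserstein_real 2 \<mu> \<mu>' \<le> ennreal (A + B)"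
    using A B by (intro wasserstein_le[OF product_coupling[OF assms]]) (simp_all add: dist_real_def)
  then show ?thesis
    unfolding W2_def by (metis ennreal_enn2real_if ennreal_neq_top top_unique)
qed

lemma W2_coupling:
  assumes "\<mu> \<in> P2" "\<mu>' \<in> P2" "W2 \<mu> \<mu>' < r"
  obtains \<pi> where "\<pi> \<in> couplings \<mu> \<mu>'" "(\<integral>\<^sup>+ z. ennreal ((fst z - snd z)\<^sup>2) \<partial>\<pi>) < ennreal (r\<^sup>2)"
proof -
  have nn: "0 \<le> W2 \<mu> \<mu>'" by (simp add: W2_def)
  have "wasserstein_real 2 \<mu> \<mu>' < ennreal r"
    using assms nn by (simp add: W2_finite ennreal_less_iff)
  then obtain \<pi> where "\<pi> \<in> couplings \<mu> \<mu>'"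
    "(\<integral>\<^sup>+ z. ennreal (dist (fst z) (snd z) powr 2) \<partial>\<pi>) < ennreal (r powr 2)"
    by (rule wasserstein_less_coupling) auto
  then show thesis
    using that[of \<pi>] assms nn by (simp add: dist_real_def)
qed

text \<open>For a nonmeasurable \<open>f\<close> the integral is a supremum over simple functions below \<open>f\<close>, and each of them
  can be pulled back along \<open>T\<close>. This gives the symmetry of \<open>W2\<close> for arbitrary measures, which a metric space
  requires on the whole type and not only on its carrier.\<close>

lemma nn_integral_distr_le:
  assumes T: "T \<in> measurable M N"
  shows "(\<integral>\<^sup>+ x. f x \<partial>distr M N T) \<le> (\<integral>\<^sup>+ x. f (T x) \<partial>M)"
proof -
  have "integral\<^sup>S (distr M N T) g \<le> (\<integral>\<^sup>+ x. f (T x) \<partial>M)"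
    if g: "simple_function (distr M N T) g" "g \<le> f" for g
  proof -
    have [measurable]: "g \<in> borel_measurable N"
      using borel_measurable_simple_function[OF g(1)] by simp
    have "integral\<^sup>S (distr M N T) g = (\<integral>\<^sup>+ x. g (T x) \<partial>M)"
      using g T by (simp add: nn_integral_eq_simple_integral[symmetric] nn_integral_distr)
    also have "\<dots> \<le> (\<integral>\<^sup>+ x. f (T x) \<partial>M)"
      using g(2) by (intro nn_integral_mono) (auto simp: le_fun_def)
    finally show ?thesis .
  qed
  then show ?thesis
    unfolding nn_integral_def[of "distr M N T"] by (auto intro!: SUP_least)
qed

lemma wasserstein_sym_le:
  assumes "\<And>x y. d x y = d y x"
  shows "(INF \<pi>\<in>couplings M N. \<integral>\<^sup>+ z. ennreal (d (fst z) (snd z) powr p) \<partial>\<pi>)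
    \<le> (INF \<pi>\<in>couplings N M. \<integral>\<^sup>+ z. ennreal (d (fst z) (snd z) powr p) \<partial>\<pi>)"
proof (rule INF_mono)
  fix \<pi> assume \<pi>: "\<pi> \<in> couplings N M"
  have s: "sets \<pi> = sets (N \<Otimes>\<^sub>M M)" using \<pi> by (simp add: couplings_def)
  have sw: "prod.swap \<in> measurable \<pi> (M \<Otimes>\<^sub>M N)"
    unfolding measurable_cong_sets[OF s refl] prod.swap_def by measurable
  let ?\<rho> = "distr \<pi> (M \<Otimes>\<^sub>M N) prod.swap"
  have "?\<rho> \<in> couplings M N"
    using \<pi> sw prob_space.prob_space_distr[OF _ sw, unfolded couplings_def]
    by (auto simp: couplings_def distr_distr comp_def)
  moreover have "(\<integral>\<^sup>+ z. ennreal (d (fst z) (snd z) powr p) \<partial>?\<rho>)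
      \<le> (\<integral>\<^sup>+ z. ennreal (d (fst z) (snd z) powr p) \<partial>\<pi>)"
    using nn_integral_distr_le[OF sw, of "\<lambda>z. ennreal (d (fst z) (snd z) powr p)"]
    by (simp add: assms[of "fst _" "snd _"])
  ultimately show "\<exists>\<pi>'\<in>couplings M N. (\<integral>\<^sup>+ z. ennreal (d (fst z) (snd z) powr p) \<partial>\<pi>')
      \<le> (\<integral>\<^sup>+ z. ennreal (d (fst z) (snd z) powr p) \<partial>\<pi>)" by blast
qed

lemma W2_sym: "W2 M N = W2 N M"
  unfolding W2_def wasserstein_def
  by (intro arg_cong[of _ _ enn2real] arg_cong[of _ _ "ennreal_root 2"] antisym
      wasserstein_sym_le) (simp_all add: dist_commute)

text \<open>There are only countably many fibres.\<close>

lemma (in prob_space) AE_fibre_nonnull: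
  fixes c :: "'a \<Rightarrow> int"
  assumes [measurable]: "c \<in> measurable M (count_space UNIV)"
  shows "AE z in M. emeasure M {z' \<in> space M. c z' = c z} \<noteq> 0"
proof -
  have "AE z in M. \<forall>k. emeasure M {z' \<in> space M. c z' = k} = 0 \<longrightarrow> c z \<noteq> k"
    unfolding AE_all_countable
  proof
    fix k show "AE z in M. emeasure M {z' \<in> space M. c z' = k} = 0 \<longrightarrow> c z \<noteq> k"
      by (cases "emeasure M {z' \<in> space M. c z' = k} = 0")
         (auto intro!: AE_I'[of "{z' \<in> space M. c z' = k}"] simp: null_sets_def)
  qed
  then show ?thesis by eventually_elim auto
qed

text \<open>Two couplings sharing the middle marginal \<open>\<mu>\<close> are glued without disintegration. The line is cut into
  cells of length \<open>\<epsilon>\<close>; given the cell of the middle coordinate, the two couplings are taken independent. The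
  resulting measure has an explicit density with respect to the product, namely the indicator that the two
  middle coordinates share a cell, divided by the mass of that cell. The middle coordinates then agree only up
  to \<open>\<epsilon>\<close>, which the triangle inequality tolerates.\<close>

lemma gluing_up_to_eps:
  fixes \<pi> :: "('a \<times> real) measure" and \<rho> :: "(real \<times> 'b) measure" and \<mu> :: "real measure"
  assumes "prob_space \<pi>" "prob_space \<rho>"
    and s\<pi>: "snd \<in> borel_measurable \<pi>" and s\<rho>: "fst \<in> borel_measurable \<rho>"
    and \<pi>2: "distr \<pi> borel snd = \<mu>" and \<rho>1: "distr \<rho> borel fst = \<mu>" and "0 < \<epsilon>"
  obtains \<Gamma> where "prob_space \<Gamma>" "sets \<Gamma> = sets (\<pi> \<Otimes>\<^sub>M \<rho>)"
    "distr \<Gamma> \<pi> fst = \<pi>" "distr \<Gamma> \<rho> snd = \<rho>"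
    "AE w in \<Gamma>. \<bar>snd (fst w) - fst (snd w)\<bar> \<le> \<epsilon>"
proof -
  interpret P: prob_space \<pi> by fact
  interpret R: prob_space \<rho> by fact
  interpret PR: pair_prob_space \<pi> \<rho> ..
  note [measurable] = s\<pi> s\<rho>
  have \<mu>b: "sets \<mu> = sets borel" using \<pi>2 by auto
  define c where "c y = \<lfloor>y / \<epsilon>\<rfloor>" for y :: real
  have c[measurable]: "c \<in> measurable borel (count_space UNIV)"
    unfolding c_def by measurable
  define w where "w k = emeasure \<mu> {y. c y = k}" for k :: int
  have w\<pi>: "w k = emeasure \<pi> {z \<in> space \<pi>. c (snd z) = k}" for k
    unfolding w_def \<pi>2[symmetric] by (subst emeasure_distr) (auto intro!: arg_cong[of _ _ "emeasure \<pi>"])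
  have w\<rho>: "w k = emeasure \<rho> {z \<in> space \<rho>. c (fst z) = k}" for k
    unfolding w_def \<rho>1[symmetric] by (subst emeasure_distr) (auto intro!: arg_cong[of _ _ "emeasure \<rho>"])
  have wfin: "w k < \<top>" for k unfolding w\<pi> by (simp add: P.emeasure_eq_measure)
  have AE\<pi>: "AE z in \<pi>. w (c (snd z)) \<noteq> 0"
    using P.AE_fibre_nonnull[of "\<lambda>z. c (snd z)"] by (simp add: w\<pi>)
  have AE\<rho>: "AE z in \<rho>. w (c (fst z)) \<noteq> 0"
    using R.AE_fibre_nonnull[of "\<lambda>z. c (fst z)"] by (simp add: w\<rho>)
  define h where "h v = (if c (snd (fst v)) = c (fst (snd v)) then inverse (w (c (snd (fst v)))) else 0)"
    for v :: "('a \<times> real) \<times> (real \<times> 'b)"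
  have [measurable]: "h \<in> borel_measurable (\<pi> \<Otimes>\<^sub>M \<rho>)" unfolding h_def by measurable
  have h\<rho>: "(\<integral>\<^sup>+ b. h (a, b) \<partial>\<rho>) = 1" if "w (c (snd a)) \<noteq> 0" for a
  proof -
    have "(\<integral>\<^sup>+ b. h (a, b) \<partial>\<rho>) =
        (\<integral>\<^sup>+ b. inverse (w (c (snd a))) * indicator {z \<in> space \<rho>. c (fst z) = c (snd a)} b \<partial>\<rho>)"
      by (intro nn_integral_cong) (auto simp: h_def indicator_def)
    also have "\<dots> = inverse (w (c (snd a))) * w (c (snd a))"
      by (simp add: nn_integral_cmult_indicator w\<rho>)
    also have "\<dots> = 1" using that wfin
      by (metis ennreal_divide_self divide_ennreal_def mult.commute less_top)
    finally show ?thesis .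
  qed
  have h\<pi>: "(\<integral>\<^sup>+ a. h (a, b) \<partial>\<pi>) = 1" if "w (c (fst b)) \<noteq> 0" for b
  proof -
    have "(\<integral>\<^sup>+ a. h (a, b) \<partial>\<pi>) =
        (\<integral>\<^sup>+ a. inverse (w (c (fst b))) * indicator {z \<in> space \<pi>. c (snd z) = c (fst b)} a \<partial>\<pi>)"
      by (intro nn_integral_cong) (auto simp: h_def indicator_def)
    also have "\<dots> = inverse (w (c (fst b))) * w (c (fst b))"
      by (simp add: nn_integral_cmult_indicator w\<pi>)
    also have "\<dots> = 1" using that wfin
      by (metis ennreal_divide_self divide_ennreal_def mult.commute less_top)
    finally show ?thesis .
  qed
  define \<Gamma> where "\<Gamma> = density (\<pi> \<Otimes>\<^sub>M \<rho>) h"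
  have s\<Gamma>: "sets \<Gamma> = sets (\<pi> \<Otimes>\<^sub>M \<rho>)" by (simp add: \<Gamma>_def)
  have 1: "distr \<Gamma> \<pi> fst = \<pi>"
  proof (rule measure_eqI)
    fix A assume A: "A \<in> sets (distr \<Gamma> \<pi> fst)"
    then have [measurable]: "A \<in> sets \<pi>" by simp
    have "emeasure (distr \<Gamma> \<pi> fst) A = (\<integral>\<^sup>+ v. h v * indicator A (fst v) \<partial>(\<pi> \<Otimes>\<^sub>M \<rho>))"
      unfolding \<Gamma>_def by (subst emeasure_distr, simp, simp, subst emeasure_density)
        (auto intro!: nn_integral_cong simp: indicator_def)
    also have "\<dots> = (\<integral>\<^sup>+ a. (\<integral>\<^sup>+ b. h (a, b) * indicator A a \<partial>\<rho>) \<partial>\<pi>)"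
      by (subst R.nn_integral_fst[symmetric]) auto
    also have "\<dots> = (\<integral>\<^sup>+ a. indicator A a \<partial>\<pi>)"
      using AE\<pi> by (intro nn_integral_cong_AE, eventually_elim)
        (auto simp: indicator_def h\<rho>)
    finally show "emeasure (distr \<Gamma> \<pi> fst) A = emeasure \<pi> A" by simp
  qed simp
  have 2: "distr \<Gamma> \<rho> snd = \<rho>"
  proof (rule measure_eqI)
    fix A assume A: "A \<in> sets (distr \<Gamma> \<rho> snd)"
    then have [measurable]: "A \<in> sets \<rho>" by simp
    have "emeasure (distr \<Gamma> \<rho> snd) A = (\<integral>\<^sup>+ v. h v * indicator A (snd v) \<partial>(\<pi> \<Otimes>\<^sub>M \<rho>))"
      unfolding \<Gamma>_def by (subst emeasure_distr, simp, simp, subst emeasure_density)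
        (auto intro!: nn_integral_cong simp: indicator_def)
    also have "\<dots> = (\<integral>\<^sup>+ b. (\<integral>\<^sup>+ a. h (a, b) * indicator A b \<partial>\<pi>) \<partial>\<rho>)"
      by (subst PR.nn_integral_snd[symmetric]) auto
    also have "\<dots> = (\<integral>\<^sup>+ b. indicator A b \<partial>\<rho>)"
      using AE\<rho> by (intro nn_integral_cong_AE, eventually_elim)
        (auto simp: indicator_def h\<pi>)
    finally show "emeasure (distr \<Gamma> \<rho> snd) A = emeasure \<rho> A" by simp
  qed simp
  have f\<Gamma>: "fst \<in> measurable \<Gamma> \<pi>" unfolding measurable_cong_sets[OF s\<Gamma> refl] by simp
  have p\<Gamma>: "prob_space \<Gamma>"
    using P.prob_space_axioms prob_space_distrD[OF f\<Gamma>] by (simp add: 1)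
  have close: "\<bar>y - y'\<bar> \<le> \<epsilon>" if "c y = c y'" for y y'
  proof -
    have "\<bar>y / \<epsilon> - y' / \<epsilon>\<bar> \<le> 1" using that unfolding c_def by linarith
    then show ?thesis using \<open>0 < \<epsilon>\<close> by (simp add: diff_divide_distrib[symmetric] field_simps)
  qed
  have 3: "AE v in \<Gamma>. \<bar>snd (fst v) - fst (snd v)\<bar> \<le> \<epsilon>"
    unfolding \<Gamma>_def by (subst AE_density) (auto simp: h_def close split: if_splits)
  show thesis by (rule that[OF p\<Gamma> s\<Gamma> 1 2 3])
qed

lemma W2_triangle:
  assumes P: "\<mu>1 \<in> P2" "\<mu>2 \<in> P2" "\<mu>3 \<in> P2"
  shows "W2 \<mu>1 \<mu>3 \<le> W2 \<mu>1 \<mu>2 + W2 \<mu>2 \<mu>3"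
proof (rule field_le_epsilon)
  fix e :: real assume "0 < e"
  define \<delta> where "\<delta> = e / 3"
  have \<delta>: "0 < \<delta>" using \<open>0 < e\<close> by (simp add: \<delta>_def)
  define a where "a = W2 \<mu>1 \<mu>2 + \<delta>"
  define b where "b = W2 \<mu>2 \<mu>3 + \<delta>"
  have ab: "0 < a" "0 < b" using \<delta> by (simp_all add: a_def b_def W2_def add_nonneg_pos)
  obtain \<pi> where \<pi>: "\<pi> \<in> couplings \<mu>1 \<mu>2" "(\<integral>\<^sup>+ z. ennreal ((fst z - snd z)\<^sup>2) \<partial>\<pi>) < ennreal (a\<^sup>2)"
    using W2_coupling[OF P(1,2), of a] \<delta> by (auto simp: a_def)
  obtain \<rho> where \<rho>: "\<rho> \<in> couplings \<mu>2 \<mu>3" "(\<integral>\<^sup>+ z. ennreal ((fst z - snd z)\<^sup>2) \<partial>\<rho>) < ennreal (b\<^sup>2)"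
    using W2_coupling[OF P(2,3), of b] \<delta> by (auto simp: b_def)
  note D = couplings_borel_D[OF \<pi>(1) P2_D(2)[OF P(1)] P2_D(2)[OF P(2)]]
  note E = couplings_borel_D[OF \<rho>(1) P2_D(2)[OF P(2)] P2_D(2)[OF P(3)]]
  have m\<pi>[measurable]: "fst \<in> borel_measurable \<pi>" "snd \<in> borel_measurable \<pi>"
    by (auto simp: measurable_cong_sets[OF D(2) refl])
  have m\<rho>[measurable]: "fst \<in> borel_measurable \<rho>" "snd \<in> borel_measurable \<rho>"
    by (auto simp: measurable_cong_sets[OF E(2) refl])
  obtain \<Gamma> where \<Gamma>: "prob_space \<Gamma>" "sets \<Gamma> = sets (\<pi> \<Otimes>\<^sub>M \<rho>)"
    "distr \<Gamma> \<pi> fst = \<pi>" "distr \<Gamma> \<rho> snd = \<rho>"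
    "AE w in \<Gamma>. \<bar>snd (fst w) - fst (snd w)\<bar> \<le> \<delta>"
    using gluing_up_to_eps[OF D(1) E(1) m\<pi>(2) m\<rho>(1) D(4) E(3) \<delta>] by blast
  have mG[measurable]: "fst \<in> measurable \<Gamma> \<pi>" "snd \<in> measurable \<Gamma> \<rho>"
    by (simp_all add: measurable_cong_sets[OF \<Gamma>(2) refl])
  have [measurable]: "(\<lambda>w. fst (fst w)) \<in> borel_measurable \<Gamma>" "(\<lambda>w. snd (fst w)) \<in> borel_measurable \<Gamma>"
    "(\<lambda>w. fst (snd w)) \<in> borel_measurable \<Gamma>" "(\<lambda>w. snd (snd w)) \<in> borel_measurable \<Gamma>"
    using measurable_compose[OF mG(1) m\<pi>(1)] measurable_compose[OF mG(1) m\<pi>(2)]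
      measurable_compose[OF mG(2) m\<rho>(1)] measurable_compose[OF mG(2) m\<rho>(2)] by auto
  define T where "T w = (fst (fst w), snd (snd w))" for w :: "(real \<times> real) \<times> (real \<times> real)"
  have T[measurable]: "T \<in> measurable \<Gamma> (borel \<Otimes>\<^sub>M borel)" unfolding T_def by measurable
  have c: "distr \<Gamma> (borel \<Otimes>\<^sub>M borel) T \<in> couplings \<mu>1 \<mu>3"
  proof (rule couplings_borel_I)
    show "prob_space (distr \<Gamma> (borel \<Otimes>\<^sub>M borel) T)"
      by (rule prob_space.prob_space_distr[OF \<Gamma>(1) T])
    show "distr (distr \<Gamma> (borel \<Otimes>\<^sub>M borel) T) borel fst = \<mu>1"
      by (subst distr_distr, simp, rule T, subst D(3)[symmetric], subst \<Gamma>(3)[symmetric],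
          subst distr_distr) (auto simp: comp_def T_def)
    show "distr (distr \<Gamma> (borel \<Otimes>\<^sub>M borel) T) borel snd = \<mu>3"
      by (subst distr_distr, simp, rule T, subst E(4)[symmetric], subst \<Gamma>(4)[symmetric],
          subst distr_distr) (auto simp: comp_def T_def)
  qed (use P2_D(2)[OF P(1)] P2_D(2)[OF P(3)] in auto)
  have 1: "(\<integral>\<^sup>+ w. ennreal ((fst (fst w) - snd (fst w))\<^sup>2) \<partial>\<Gamma>) \<le> ennreal (a\<^sup>2)"
    using \<pi>(2) by (subst (asm) \<Gamma>(3)[symmetric], subst (asm) nn_integral_distr) auto
  have 2: "(\<integral>\<^sup>+ w. ennreal ((snd (fst w) - fst (snd w))\<^sup>2) \<partial>\<Gamma>) \<le> ennreal (\<delta>\<^sup>2)"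
  proof -
    have "(\<integral>\<^sup>+ w. ennreal ((snd (fst w) - fst (snd w))\<^sup>2) \<partial>\<Gamma>) \<le> (\<integral>\<^sup>+ w. ennreal (\<delta>\<^sup>2) \<partial>\<Gamma>)"
      using \<Gamma>(5) by (intro nn_integral_mono_AE, eventually_elim)
        (use \<delta> in \<open>auto intro!: ennreal_leI simp: abs_le_square_iff[symmetric]\<close>)
    then show ?thesis by (simp add: prob_space.emeasure_space_1[OF \<Gamma>(1)])
  qed
  have 3: "(\<integral>\<^sup>+ w. ennreal ((fst (snd w) - snd (snd w))\<^sup>2) \<partial>\<Gamma>) \<le> ennreal (b\<^sup>2)"
    using \<rho>(2) by (subst (asm) \<Gamma>(4)[symmetric], subst (asm) nn_integral_distr) auto
  have "(\<integral>\<^sup>+ w. ennreal (((fst (fst w) - snd (fst w)) + (snd (fst w) - fst (snd w))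
      + (fst (snd w) - snd (snd w)))\<^sup>2) \<partial>\<Gamma>) \<le> ennreal ((a + \<delta> + b)\<^sup>2)"
    using ab \<delta> 1 2 3 by (intro minkowski_nn_integral) auto
  then have "(\<integral>\<^sup>+ z. ennreal ((fst z - snd z)\<^sup>2) \<partial>distr \<Gamma> (borel \<Otimes>\<^sub>M borel) T) \<le> ennreal ((a + \<delta> + b)\<^sup>2)"
    by (subst nn_integral_distr) (auto simp: T_def)
  then have "W2 \<mu>1 \<mu>3 \<le> a + \<delta> + b"
    using ab \<delta> by (intro W2_le[OF c]) auto
  then show "W2 \<mu>1 \<mu>3 \<le> W2 \<mu>1 \<mu>2 + W2 \<mu>2 \<mu>3 + e"
    by (simp add: a_def b_def \<delta>_def)
qed

lemma norm_iexp_diff_le: "cmod (iexp a - iexp b) \<le> \<bar>a - b\<bar>"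
proof -
  have "iexp a - iexp b = iexp b * (iexp (a - b) - 1)"
    by (simp add: exp_add[symmetric] algebra_simps of_real_diff)
  then have "cmod (iexp a - iexp b) = cmod (iexp (a - b) - 1)"
    by (simp add: norm_mult)
  also have "\<dots> \<le> \<bar>a - b\<bar>" using iexp_approx1[of "a - b" 0] by simp
  finally show ?thesis .
qed

text \<open>Under a coupling of cost \<open>r\<^sup>2\<close> the characteristic functions differ by at most \<open>\<bar>t\<bar> r\<close>.\<close>

lemma W2_eq_0_imp_eq:
  assumes P: "\<mu> \<in> P2" "\<mu>' \<in> P2" and z: "W2 \<mu> \<mu>' = 0"
  shows "\<mu> = \<mu>'"
proof (rule Levy_uniqueness)
  show "real_distribution \<mu>" "real_distribution \<mu>'"
    using P2_D[OF P(1)] P2_D[OF P(2)]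
    by (auto simp: real_distribution_def real_distribution_axioms_def)
  show "char \<mu> = char \<mu>'"
  proof
    fix t
    have "cmod (char \<mu> t - char \<mu>' t) \<le> \<bar>t\<bar> * r" if r: "0 < r" for r
    proof -
      obtain \<pi> where \<pi>: "\<pi> \<in> couplings \<mu> \<mu>'" "(\<integral>\<^sup>+ z. ennreal ((fst z - snd z)\<^sup>2) \<partial>\<pi>) < ennreal (r\<^sup>2)"
        using W2_coupling[OF P, of r] z r by auto
      note D = couplings_borel_D[OF \<pi>(1) P2_D(2)[OF P(1)] P2_D(2)[OF P(2)]]
      interpret prob_space \<pi> by (rule D(1))
      have [measurable]: "fst \<in> borel_measurable \<pi>" "snd \<in> borel_measurable \<pi>"
        by (auto simp: measurable_cong_sets[OF D(2) refl])
      have i2: "integrable \<pi> (\<lambda>z. (fst z - snd z)\<^sup>2)"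
        using \<pi>(2) by (intro integrableI_nonneg) (auto intro: order_less_trans)
      have "ennreal (\<integral> z. (fst z - snd z)\<^sup>2 \<partial>\<pi>) < ennreal (r\<^sup>2)"
        using \<pi>(2) nn_integral_eq_integral[OF i2] by simp
      then have le: "(\<integral> z. (fst z - snd z)\<^sup>2 \<partial>\<pi>) \<le> r\<^sup>2"
        by (simp add: ennreal_less_iff)
      have j1: "integrable \<pi> (\<lambda>z. iexp (t * fst z))" "integrable \<pi> (\<lambda>z. iexp (t * snd z))"
        by (auto intro!: integrable_const_bound[where B = 1])
      have "char \<mu> t = (CLINT z|\<pi>. iexp (t * fst z))"
        unfolding char_def by (subst D(3)[symmetric], subst integral_distr) auto
      moreover have "char \<mu>' t = (CLINT z|\<pi>. iexp (t * snd z))"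
        unfolding char_def by (subst D(4)[symmetric], subst integral_distr) auto
      ultimately have "cmod (char \<mu> t - char \<mu>' t)
          = cmod (CLINT z|\<pi>. iexp (t * fst z) - iexp (t * snd z))"
        using j1 by simp
      also have "\<dots> \<le> (\<integral> z. \<bar>t\<bar> * ((r + (fst z - snd z)\<^sup>2 / r) / 2) \<partial>\<pi>)"
      proof (rule order_trans[OF integral_norm_bound integral_mono])
        fix z :: "real \<times> real"
        have "cmod (iexp (t * fst z) - iexp (t * snd z)) \<le> \<bar>t\<bar> * \<bar>fst z - snd z\<bar>"
          using norm_iexp_diff_le[of "t * fst z" "t * snd z"]
          by (simp add: abs_mult[symmetric] right_diff_distrib)
        also have "\<bar>fst z - snd z\<bar> \<le> (r + (fst z - snd z)\<^sup>2 / r) / 2"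
        proof -
          have "0 \<le> (\<bar>fst z - snd z\<bar> - r)\<^sup>2 / r" using r by simp
          also have "\<dots> = r + (fst z - snd z)\<^sup>2 / r - 2 * \<bar>fst z - snd z\<bar>"
            using r by (simp add: power2_eq_square field_simps)
          finally show ?thesis by simp
        qed
        finally show "cmod (iexp (t * fst z) - iexp (t * snd z))
            \<le> \<bar>t\<bar> * ((r + (fst z - snd z)\<^sup>2 / r) / 2)" by (simp add: mult_left_mono)
      qed (use j1 i2 in auto)
      also have "\<dots> = \<bar>t\<bar> * ((r + (\<integral> z. (fst z - snd z)\<^sup>2 \<partial>\<pi>) / r) / 2)"
        using i2 by (simp add: prob_space)
      also have "\<dots> \<le> \<bar>t\<bar> * ((r + r\<^sup>2 / r) / 2)"
        using le r by (intro mult_left_mono divide_right_mono add_left_mono) auto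
      also have "\<dots> = \<bar>t\<bar> * r" using r by (simp add: power2_eq_square)
      finally show ?thesis .
    qed
    then have "cmod (char \<mu> t - char \<mu>' t) \<le> 0 + e" if "0 < e" for e
    proof -
      have "cmod (char \<mu> t - char \<mu>' t) \<le> \<bar>t\<bar> * (e / (\<bar>t\<bar> + 1))"
        using that by (intro \<open>\<And>r. 0 < r \<Longrightarrow> _\<close>) auto
      also have "\<dots> \<le> e" using that by (simp add: field_simps)
      finally show ?thesis by simp
    qed
    then have "cmod (char \<mu> t - char \<mu>' t) \<le> 0" by (rule field_le_epsilon)
    then show "char \<mu> t = char \<mu>' t" by simp
  qed
qed

lemma W2_self: assumes "\<mu> \<in> P2" shows "W2 \<mu> \<mu> = 0"
proof -
  note D = P2_D[OF assms]
  have [measurable]: "(\<lambda>x. x) \<in> borel_measurable \<mu>" by (simp add: measurable_cong_sets[OF D(2) refl])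
  let ?\<pi> = "distr \<mu> (borel \<Otimes>\<^sub>M borel) (\<lambda>x. (x, x))"
  have "?\<pi> \<in> couplings \<mu> \<mu>"
    using D distr_id2[OF D(2)[symmetric]]
    by (intro couplings_borel_I) (auto simp: distr_distr comp_def intro!: prob_space.prob_space_distr)
  moreover have "(\<integral>\<^sup>+ z. ennreal ((fst z - snd z)\<^sup>2) \<partial>?\<pi>) \<le> ennreal (0\<^sup>2)"
    by (subst nn_integral_distr) auto
  ultimately have "W2 \<mu> \<mu> \<le> 0" by (intro W2_le) auto
  then show ?thesis by (simp add: W2_def antisym)
qed

lemma Metric_space_P2: "Metric_space P2 W2"
proof
  show "0 \<le> W2 \<mu> \<mu>'" for \<mu> \<mu>' by (simp add: W2_def)
  show "W2 \<mu> \<mu>' = 0 \<longleftrightarrow> \<mu> = \<mu>'" if "\<mu> \<in> P2" "\<mu>' \<in> P2" for \<mu> \<mu>'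
    using that W2_eq_0_imp_eq W2_self by blast
qed (use W2_sym W2_triangle in auto)

lemma space_borel_P2: "space borel_P2 = P2"
  unfolding borel_P2_def by (simp add: space_measure_of_conv)

lemma openin_P2:
  "openin (Metric_space.mtopology P2 W2) U \<longleftrightarrow>
    U \<subseteq> P2 \<and> (\<forall>\<mu>\<in>U. \<exists>r>0. \<forall>\<mu>'\<in>P2. W2 \<mu> \<mu>' < r \<longrightarrow> \<mu>' \<in> U)"
  unfolding Metric_space.openin_mtopology[OF Metric_space_P2] Metric_space.mball_def[OF Metric_space_P2]
  by blast

lemma openin_imp_sets_borel_P2:
  "openin (Metric_space.mtopology P2 W2) U \<Longrightarrow> U \<in> sets borel_P2"
  unfolding borel_P2_def by (subst sets_measure_of) (auto simp: openin_P2)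

definition L2_size :: "(real \<Rightarrow> real) \<Rightarrow> real measure \<Rightarrow> real" where
  "L2_size \<phi> \<mu> = sqrt (\<integral>x. (\<phi> x)\<^sup>2 \<partial>\<mu>)"

text \<open>The normalization at \<open>0\<close> makes \<open>L2_size \<phi>\<close> finite on \<open>P2\<close> and zero at the point mass at \<open>0\<close>.\<close>

definition contraction :: "(real \<Rightarrow> real) \<Rightarrow> bool" where
  "contraction \<phi> \<longleftrightarrow> \<phi> 0 = 0 \<and> (\<forall>x y. \<bar>\<phi> x - \<phi> y\<bar> \<le> \<bar>x - y\<bar>)"

lemma contraction_le: "contraction \<phi> \<Longrightarrow> \<bar>\<phi> x\<bar> \<le> \<bar>x\<bar>"
  unfolding contraction_def by (elim conjE allE[of _ x] allE[of _ 0]) simp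

lemma contraction_measurable: "contraction \<phi> \<Longrightarrow> \<phi> \<in> borel_measurable borel"
  by (intro borel_measurable_continuous_onI lipschitz_on_continuous_on[of 1 UNIV])
     (auto simp: contraction_def lipschitz_on_def dist_real_def)

lemma contraction_integrable:
  assumes "contraction \<phi>" "\<mu> \<in> P2"
  shows "integrable \<mu> (\<lambda>x. (\<phi> x)\<^sup>2)"
proof (rule Bochner_Integration.integrable_bound[OF P2_D(4)[OF assms(2)]])
  show "(\<lambda>x. (\<phi> x)\<^sup>2) \<in> borel_measurable \<mu>"
    using contraction_measurable[OF assms(1)]
    by (simp add: measurable_cong_sets[OF P2_D(2)[OF assms(2)] refl])
  show "AE x in \<mu>. norm ((\<phi> x)\<^sup>2) \<le> norm (x\<^sup>2)"
    using contraction_le[OF assms(1)] by (simp add: abs_le_square_iff)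
qed

lemma L2_size_nonneg: "0 \<le> L2_size \<phi> \<mu>"
  by (simp add: L2_size_def)

lemma L2_size_power2: "(L2_size \<phi> \<mu>)\<^sup>2 = (\<integral>x. (\<phi> x)\<^sup>2 \<partial>\<mu>)"
  by (simp add: L2_size_def)

text \<open>Minkowski's inequality under a coupling of almost minimal cost, with \<open>\<phi> x = \<phi> y + (\<phi> x - \<phi> y)\<close>.\<close>

lemma L2_size_diff_le:
  assumes c: "contraction \<phi>" and P: "\<mu> \<in> P2" "\<mu>' \<in> P2"
  shows "L2_size \<phi> \<mu> \<le> L2_size \<phi> \<mu>' + W2 \<mu> \<mu>'"
proof (rule field_le_epsilon)
  fix e :: real assume e: "0 < e"
  define A where "A = L2_size \<phi> \<mu>' + e / 2"
  define B where "B = W2 \<mu> \<mu>' + e / 2"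
  have AB: "0 < A" "0 < B" using e L2_size_nonneg[of \<phi> \<mu>']
    by (auto simp: A_def B_def W2_def intro: add_nonneg_pos)
  obtain \<pi> where \<pi>: "\<pi> \<in> couplings \<mu> \<mu>'" "(\<integral>\<^sup>+ z. ennreal ((fst z - snd z)\<^sup>2) \<partial>\<pi>) < ennreal (B\<^sup>2)"
    using W2_coupling[OF P, of B] e by (auto simp: B_def)
  note D = couplings_borel_D[OF \<pi>(1) P2_D(2)[OF P(1)] P2_D(2)[OF P(2)]]
  note [measurable] = contraction_measurable[OF c]
  have [measurable]: "fst \<in> borel_measurable \<pi>" "snd \<in> borel_measurable \<pi>"
    by (auto simp: measurable_cong_sets[OF D(2) refl])
  have sq: "(\<integral>\<^sup>+ x. ennreal ((\<phi> x)\<^sup>2) \<partial>\<kappa>) = ennreal ((L2_size \<phi> \<kappa>)\<^sup>2)" if "\<kappa> \<in> P2" for \<kappa>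
    using nn_integral_eq_integral[OF contraction_integrable[OF c that]] by (simp add: L2_size_power2)
  have "(\<integral>\<^sup>+ z. ennreal ((\<phi> (snd z) + (\<phi> (fst z) - \<phi> (snd z)))\<^sup>2) \<partial>\<pi>) \<le> ennreal ((A + B)\<^sup>2)"
  proof (rule minkowski_nn_integral[OF _ _ AB])
    have "(\<integral>\<^sup>+ z. ennreal ((\<phi> (snd z))\<^sup>2) \<partial>\<pi>) = ennreal ((L2_size \<phi> \<mu>')\<^sup>2)"
      using nn_integral_coupling_snd[OF D(2), of "\<lambda>x. ennreal ((\<phi> x)\<^sup>2)"] D(4) sq[OF P(2)] by simp
    also have "\<dots> \<le> ennreal (A\<^sup>2)"
      using e L2_size_nonneg[of \<phi> \<mu>'] by (intro ennreal_leI power_mono) (auto simp: A_def)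
    finally show "(\<integral>\<^sup>+ z. ennreal ((\<phi> (snd z))\<^sup>2) \<partial>\<pi>) \<le> ennreal (A\<^sup>2)" .
    have "(\<integral>\<^sup>+ z. ennreal ((\<phi> (fst z) - \<phi> (snd z))\<^sup>2) \<partial>\<pi>) \<le> (\<integral>\<^sup>+ z. ennreal ((fst z - snd z)\<^sup>2) \<partial>\<pi>)"
      using c by (intro nn_integral_mono ennreal_leI) (auto simp: abs_le_square_iff[symmetric] contraction_def)
    with \<pi>(2) show "(\<integral>\<^sup>+ z. ennreal ((\<phi> (fst z) - \<phi> (snd z))\<^sup>2) \<partial>\<pi>) \<le> ennreal (B\<^sup>2)" by simp
  qed auto
  moreover have "(\<integral>\<^sup>+ z. ennreal ((\<phi> (fst z))\<^sup>2) \<partial>\<pi>) = ennreal ((L2_size \<phi> \<mu>)\<^sup>2)"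
    using nn_integral_coupling_fst[OF D(2), of "\<lambda>x. ennreal ((\<phi> x)\<^sup>2)"] D(3) sq[OF P(1)] by simp
  ultimately have "(L2_size \<phi> \<mu>)\<^sup>2 \<le> (A + B)\<^sup>2" by simp
  then have "L2_size \<phi> \<mu> \<le> A + B" by (rule power2_le_imp_le) (use AB in simp)
  then show "L2_size \<phi> \<mu> \<le> L2_size \<phi> \<mu>' + W2 \<mu> \<mu>' + e" by (simp add: A_def B_def)
qed

lemma L2_size_Lipschitz:
  assumes "contraction \<phi>" "\<mu> \<in> P2" "\<mu>' \<in> P2"
  shows "\<bar>L2_size \<phi> \<mu> - L2_size \<phi> \<mu>'\<bar> \<le> W2 \<mu> \<mu>'"
  using L2_size_diff_le[OF assms] L2_size_diff_le[OF assms(1,3,2)] W2_sym[of \<mu>' \<mu>] by linarith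

lemma measurable_L2_size:
  assumes "contraction \<phi>"
  shows "L2_size \<phi> \<in> borel_measurable borel_P2"
proof (rule borel_measurableI)
  fix S :: "real set" assume S: "open S"
  have "openin (Metric_space.mtopology P2 W2) (L2_size \<phi> -` S \<inter> P2)"
    unfolding openin_P2
  proof (intro conjI ballI)
    fix \<mu> assume \<mu>: "\<mu> \<in> L2_size \<phi> -` S \<inter> P2"
    then obtain r where r: "0 < r" "\<And>y. dist y (L2_size \<phi> \<mu>) < r \<Longrightarrow> y \<in> S"
      using S by (auto simp: open_dist)
    have "\<mu>' \<in> L2_size \<phi> -` S \<inter> P2" if "\<mu>' \<in> P2" "W2 \<mu> \<mu>' < r" for \<mu>'
      using L2_size_Lipschitz[OF assms, of \<mu> \<mu>'] that \<mu> by (auto intro!: r(2) simp: dist_real_def)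
    then show "\<exists>r>0. \<forall>\<mu>'\<in>P2. W2 \<mu> \<mu>' < r \<longrightarrow> \<mu>' \<in> L2_size \<phi> -` S \<inter> P2" using r(1) by blast
  qed auto
  then show "L2_size \<phi> -` S \<inter> space borel_P2 \<in> sets borel_P2"
    unfolding space_borel_P2 by (rule openin_imp_sets_borel_P2)
qed

text \<open>A coupling of two laws of random measures is pushed forward to a coupling of the sizes of these
  measures. Only monotonicity of the integral is applied to the cost \<open>W2\<close>, as its joint measurability
  has not been established.\<close>

lemma L2_size_coupling:
  assumes c: "contraction \<phi>"
    and \<zeta>: "sets \<zeta> = sets borel_P2" "sets \<zeta>' = sets borel_P2"
    and "WW2 \<zeta> \<zeta>' < ennreal r"
  obtains \<rho> :: "(real \<times> real) measure" where
    "prob_space \<rho>" "sets \<rho> = sets (borel \<Otimes>\<^sub>M borel)"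
    "distr \<rho> borel fst = distr \<zeta> borel (L2_size \<phi>)"
    "distr \<rho> borel snd = distr \<zeta>' borel (L2_size \<phi>)"
    "(\<integral>\<^sup>+ z. ennreal ((fst z - snd z)\<^sup>2) \<partial>\<rho>) < ennreal (r\<^sup>2)"
proof -
  obtain \<pi> where \<pi>: "\<pi> \<in> couplings \<zeta> \<zeta>'"
    "(\<integral>\<^sup>+ z. ennreal (W2 (fst z) (snd z) powr 2) \<partial>\<pi>) < ennreal (r powr 2)"
    using assms(4) unfolding WW2_def by (rule wasserstein_less_coupling) auto
  have r: "0 < r" using assms(4) by (metis ennreal_eq_0_iff not_less not_less_zero)
  have W2nn: "0 \<le> W2 a b" for a b by (simp add: W2_def)
  have s: "sets \<pi> = sets (\<zeta> \<Otimes>\<^sub>M \<zeta>')" and p: "prob_space \<pi>"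
    and m: "distr \<pi> \<zeta> fst = \<zeta>" "distr \<pi> \<zeta>' snd = \<zeta>'" using \<pi>(1) by (auto simp: couplings_def)
  have sp: "space \<pi> = P2 \<times> P2"
    using sets_eq_imp_space_eq[OF s] sets_eq_imp_space_eq[OF \<zeta>(1)] sets_eq_imp_space_eq[OF \<zeta>(2)]
    by (simp add: space_pair_measure space_borel_P2)
  have f[measurable]: "fst \<in> measurable \<pi> \<zeta>" "snd \<in> measurable \<pi> \<zeta>'"
    by (simp_all add: measurable_cong_sets[OF s refl])
  have L[measurable]: "L2_size \<phi> \<in> borel_measurable \<zeta>" "L2_size \<phi> \<in> borel_measurable \<zeta>'"
    using measurable_L2_size[OF c]
    by (simp_all add: measurable_cong_sets[OF \<zeta>(1) refl] measurable_cong_sets[OF \<zeta>(2) refl])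
  define T where "T z = (L2_size \<phi> (fst z), L2_size \<phi> (snd z))" for z
  have T[measurable]: "T \<in> measurable \<pi> (borel \<Otimes>\<^sub>M borel)" unfolding T_def by measurable
  show thesis
  proof (rule that[of "distr \<pi> (borel \<Otimes>\<^sub>M borel) T"])
    show "prob_space (distr \<pi> (borel \<Otimes>\<^sub>M borel) T)" by (rule prob_space.prob_space_distr[OF p T])
    show "distr (distr \<pi> (borel \<Otimes>\<^sub>M borel) T) borel fst = distr \<zeta> borel (L2_size \<phi>)"
      by (subst distr_distr, simp, rule T, subst m(1)[symmetric], subst distr_distr)
         (auto simp: comp_def T_def)
    show "distr (distr \<pi> (borel \<Otimes>\<^sub>M borel) T) borel snd = distr \<zeta>' borel (L2_size \<phi>)"
      by (subst distr_distr, simp, rule T, subst m(2)[symmetric], subst distr_distr)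
         (auto simp: comp_def T_def)
    have "(\<integral>\<^sup>+ z. ennreal ((fst z - snd z)\<^sup>2) \<partial>distr \<pi> (borel \<Otimes>\<^sub>M borel) T)
        = (\<integral>\<^sup>+ z. ennreal ((L2_size \<phi> (fst z) - L2_size \<phi> (snd z))\<^sup>2) \<partial>\<pi>)"
      by (subst nn_integral_distr) (auto simp: T_def)
    also have "\<dots> \<le> (\<integral>\<^sup>+ z. ennreal (W2 (fst z) (snd z) powr 2) \<partial>\<pi>)"
      using W2nn L2_size_Lipschitz[OF c]
      by (intro nn_integral_mono ennreal_leI) (auto simp: sp abs_le_square_iff[symmetric])
    also have "\<dots> < ennreal (r\<^sup>2)" using \<pi>(2) r by simp
    finally show "(\<integral>\<^sup>+ z. ennreal ((fst z - snd z)\<^sup>2) \<partial>distr \<pi> (borel \<Otimes>\<^sub>M borel) T) < ennreal (r\<^sup>2)" .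
  qed simp
qed

section \<open>Taylor expansion with uniform constants\<close>

text \<open>On \<open>\<bar>u\<bar> \<le> 1/2\<close>, the function is a polynomial of degree less than \<open>n\<close> plus \<open>u\<^sup>n\<close> times a bounded function,
  and \<open>C\<close> bounds all coefficients and the last factor. The recursion splits off the constant term and
  divides by \<open>u\<close>, so that products are handled by induction.\<close>

fun jet :: "nat \<Rightarrow> real \<Rightarrow> (real \<Rightarrow> real) \<Rightarrow> bool" where
  "jet 0 C h = (\<forall>u. \<bar>u\<bar> \<le> 1/2 \<longrightarrow> \<bar>h u\<bar> \<le> C)"
| "jet (Suc n) C h = (\<exists>c g. \<bar>c\<bar> \<le> C \<and> jet n C g \<and> (\<forall>u. \<bar>u\<bar> \<le> 1/2 \<longrightarrow> h u = c + u * g u))"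

lemma jet_mono: "jet n C h \<Longrightarrow> C \<le> D \<Longrightarrow> jet n D h"
proof (induction n arbitrary: h)
  case 0
  then show ?case by force
next
  case (Suc n)
  obtain c g where "\<bar>c\<bar> \<le> C" "jet n C g" "\<And>u. \<bar>u\<bar> \<le> 1/2 \<Longrightarrow> h u = c + u * g u"
    using Suc.prems by auto
  then show ?case using Suc.IH[of g] Suc.prems(2) by (auto intro!: exI[of _ c] exI[of _ g])
qed

lemma jet_nonneg: "jet n C h \<Longrightarrow> 0 \<le> C"
proof (cases n)
  assume "jet n C h" "n = 0"
  then have "\<bar>h 0\<bar> \<le> C" by simp
  then show ?thesis by linarith
qed auto

lemma jet_cong: "(\<And>u. \<bar>u\<bar> \<le> 1/2 \<Longrightarrow> h u = k u) \<Longrightarrow> jet n C h \<longleftrightarrow> jet n C k"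
  by (cases n) auto

lemma jet_const: "\<bar>c\<bar> \<le> C \<Longrightarrow> jet n C (\<lambda>_. c)"
proof (induction n arbitrary: c)
  case (Suc n)
  have "jet n C (\<lambda>_. 0)" using Suc.IH[of 0] Suc.prems by simp
  then show ?case using Suc.prems by (auto intro!: exI[of _ c] exI[of _ "\<lambda>_. 0"])
qed simp

lemma jet_add: "jet n C h \<Longrightarrow> jet n D k \<Longrightarrow> jet n (C + D) (\<lambda>u. h u + k u)"
proof (induction n arbitrary: h k)
  case 0
  then show ?case by (auto intro: order_trans[OF abs_triangle_ineq] add_mono)
next
  case (Suc n)
  obtain c g where h: "\<bar>c\<bar> \<le> C" "jet n C g" "\<And>u. \<bar>u\<bar> \<le> 1/2 \<Longrightarrow> h u = c + u * g u"
    using Suc.prems(1) by auto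
  obtain d f where k: "\<bar>d\<bar> \<le> D" "jet n D f" "\<And>u. \<bar>u\<bar> \<le> 1/2 \<Longrightarrow> k u = d + u * f u"
    using Suc.prems(2) by auto
  have "jet n (C + D) (\<lambda>u. g u + f u)" by (rule Suc.IH[OF h(2) k(2)])
  then show ?case using h k
    by (auto intro!: exI[of _ "c + d"] exI[of _ "\<lambda>u. g u + f u"] simp: algebra_simps)
qed

lemma jet_Suc_I:
  assumes "\<bar>c\<bar> \<le> C" "jet n C g" "\<And>u. \<bar>u\<bar> \<le> 1/2 \<Longrightarrow> h u = c + u * g u"
  shows "jet (Suc n) C h"
  using assms by auto

lemma jet_cmult: "jet n C h \<Longrightarrow> jet n (\<bar>a\<bar> * C) (\<lambda>u. a * h u)"
proof (induction n arbitrary: h)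
  case 0
  then show ?case by (auto simp: abs_mult intro: mult_left_mono)
next
  case (Suc n)
  obtain c g where h: "\<bar>c\<bar> \<le> C" "jet n C g" "\<And>u. \<bar>u\<bar> \<le> 1/2 \<Longrightarrow> h u = c + u * g u"
    using Suc.prems by auto
  have "jet n (\<bar>a\<bar> * C) (\<lambda>u. a * g u)" by (rule Suc.IH[OF h(2)])
  then show ?case using h
    by (intro jet_Suc_I[of "a * c" _ _ "\<lambda>u. a * g u"]) (use mult_left_mono[OF h(1), of "\<bar>a\<bar>"] in \<open>auto simp: algebra_simps abs_mult\<close>)
qed

lemma jet_times_u: "jet n C g \<Longrightarrow> jet (Suc n) C (\<lambda>u. u * g u)"
  by (rule jet_Suc_I[of 0]) (auto dest: jet_nonneg)

lemma jet_weaken: "jet (Suc n) C h \<Longrightarrow> jet n (2 * C) h"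
proof (induction n arbitrary: h)
  case 0
  then obtain c g where h: "\<bar>c\<bar> \<le> C" "jet 0 C g" "\<And>u. \<bar>u\<bar> \<le> 1/2 \<Longrightarrow> h u = c + u * g u"
    by auto
  have "\<bar>h u\<bar> \<le> 2 * C" if u: "\<bar>u\<bar> \<le> 1/2" for u
  proof -
    have "\<bar>u * g u\<bar> \<le> 1 * C" unfolding abs_mult using h(2) u by (intro mult_mono) auto
    then show ?thesis using h(1) h(3)[OF u] by linarith
  qed
  then show ?case by simp
next
  case (Suc n)
  then obtain c g where h: "\<bar>c\<bar> \<le> C" "jet (Suc n) C g" "\<And>u. \<bar>u\<bar> \<le> 1/2 \<Longrightarrow> h u = c + u * g u"
    by (metis jet.simps(2))
  have "0 \<le> C" using h(1) by simp
  then show ?case using h Suc.IH[OF h(2)] by (intro jet_Suc_I[of c _ _ g]) auto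
qed

lemma jet_mult: "jet n C h \<Longrightarrow> jet n D k \<Longrightarrow> jet n (6 ^ n * C * D) (\<lambda>u. h u * k u)"
proof (induction n arbitrary: h k C D)
  case 0
  then show ?case by (auto simp: abs_mult intro!: mult_mono intro: order_trans[OF abs_ge_zero])
next
  case (Suc n)
  obtain c g where h: "\<bar>c\<bar> \<le> C" "jet n C g" "\<And>u. \<bar>u\<bar> \<le> 1/2 \<Longrightarrow> h u = c + u * g u"
    using Suc.prems(1) by auto
  obtain d f where k: "\<bar>d\<bar> \<le> D" "jet n D f" "\<And>u. \<bar>u\<bar> \<le> 1/2 \<Longrightarrow> k u = d + u * f u"
    using Suc.prems(2) by auto
  have C: "0 \<le> C" and D: "0 \<le> D" using h(1) k(1) by auto
  have p: "1 \<le> (6::real) ^ n" by simp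
  \<comment> \<open>The quotient of the product is \<open>c f + g k\<close>.\<close>
  have 1: "jet n (C * D) (\<lambda>u. c * f u)"
    using jet_cmult[OF k(2), of c] h(1) D by (elim jet_mono) (simp add: mult_right_mono)
  have 2: "jet n (6 ^ n * C * (2 * D)) (\<lambda>u. g u * k u)"
    by (rule Suc.IH[OF h(2) jet_weaken[OF Suc.prems(2)]])
  have CD: "0 \<le> C * D" "C * D \<le> 6 ^ n * (C * D)"
    using C D p mult_right_mono[OF p, of "C * D"] by auto
  have "jet n (6 ^ Suc n * C * D) (\<lambda>u. c * f u + g u * k u)"
    using jet_add[OF 1 2] by (elim jet_mono) (use CD in \<open>simp add: algebra_simps\<close>)
  moreover have "\<bar>c * d\<bar> \<le> 6 ^ Suc n * C * D"
  proof -
    have "\<bar>c * d\<bar> \<le> C * D" unfolding abs_mult using h(1) k(1) C by (intro mult_mono) auto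
    then show ?thesis using CD by (simp add: mult.assoc)
  qed
  ultimately show ?case
    using h(3) k(3) by (intro jet_Suc_I[of "c * d" _ _ "\<lambda>u. c * f u + g u * k u"]) (auto simp: algebra_simps)
qed

lemma jet_inverse_linear:
  assumes "\<bar>m\<bar> \<le> 1"
  shows "jet n 2 (\<lambda>u. 1 / (1 + u * m))"
proof (induction n)
  case 0
  show ?case
  proof (simp, intro allI impI)
    fix u :: real assume "\<bar>u\<bar> * 2 \<le> 1"
    then have "\<bar>u * m\<bar> \<le> 1/2 * 1" unfolding abs_mult using assms by (intro mult_mono) auto
    then have "1/2 \<le> \<bar>1 + u * m\<bar>" by linarith
    then show "1 / \<bar>1 + u * m\<bar> \<le> 2" by (simp add: divide_le_eq)
  qed
next
  case (Suc n)
  have "jet n 2 (\<lambda>u. - m * (1 / (1 + u * m)))"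
    using jet_cmult[OF Suc, of "- m"] assms by (elim jet_mono) simp
  moreover have "1 / (1 + u * m) = 1 + u * (- m * (1 / (1 + u * m)))" if "\<bar>u\<bar> \<le> 1/2" for u
  proof -
    have "\<bar>u * m\<bar> \<le> 1/2 * 1" unfolding abs_mult using assms that by (intro mult_mono) auto
    then have "1 + u * m \<noteq> 0" by linarith
    then show ?thesis by (simp add: field_simps)
  qed
  ultimately show ?case by (intro jet_Suc_I[of 1]) auto
qed

text \<open>A two-replica average as a function of \<open>u = tanh (J\<^sub>e / sqrt N)\<close>. The two factors \<open>1 + u m\<close> below come from the
  partition functions of the two replicas.\<close>

definition two_replica_ratio :: "real \<Rightarrow> real \<Rightarrow> real \<Rightarrow> real \<Rightarrow> real \<Rightarrow> real" where
  "two_replica_ratio m a d1 d2 u = (a + u * d1 + u\<^sup>2 * d2) / (1 + u * m)\<^sup>2"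

lemma jet_u_mult: "jet n C g \<Longrightarrow> jet n (2 * C) (\<lambda>u. u * g u)"
  by (intro jet_weaken jet_times_u)

lemma jet_ratio:
  assumes m: "\<bar>m\<bar> \<le> 1" and a: "\<bar>a\<bar> \<le> D" "\<bar>d1\<bar> \<le> D" "\<bar>d2\<bar> \<le> D"
  shows "jet n (28 * 36 ^ n * D) (two_replica_ratio m a d1 d2)"
proof -
  have 1: "jet n (7 * D) (\<lambda>u. a + (u * d1 + u * (u * d2)))"
    using jet_add[OF jet_const[OF a(1)] jet_add[OF jet_u_mult[OF jet_const[OF a(2)]]
          jet_u_mult[OF jet_u_mult[OF jet_const[OF a(3)]]]]] by (simp add: algebra_simps)
  note v = jet_inverse_linear[OF m, of n]
  have "jet n (6 ^ n * (6 ^ n * (7 * D) * 2) * 2)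
      (\<lambda>u. (a + (u * d1 + u * (u * d2))) * (1 / (1 + u * m)) * (1 / (1 + u * m)))"
    by (rule jet_mult[OF jet_mult[OF 1 v] v])
  moreover have q2: "6 ^ n * (6 ^ n * (7 * D) * 2) * 2 = 28 * 36 ^ n * D"
    using power_mult_distrib[of "6::real" 6 n] by simp
  moreover have q3: "(\<lambda>u. (a + (u * d1 + u * (u * d2))) * (1 / (1 + u * m)) * (1 / (1 + u * m)))
      = two_replica_ratio m a d1 d2"
    by (simp add: two_replica_ratio_def[abs_def] power2_eq_square mult.assoc add.assoc)
  ultimately show ?thesis unfolding q2 q3 by blast
qed

text \<open>The deviation from the value at \<open>u = 0\<close> is \<open>u\<close> times a function of the same form, whose coefficients are
  small as soon as \<open>m\<close>, \<open>d1\<close> and \<open>d2\<close> are small.\<close>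

lemma ratio_eq_add_ratio:
  assumes "\<bar>m\<bar> \<le> 1" "\<bar>u\<bar> < 1"
  shows "two_replica_ratio m a d1 d2 u
    = a + u * two_replica_ratio m (d1 - 2 * a * m) (d2 - a * m\<^sup>2) 0 u"
proof -
  have "\<bar>u * m\<bar> < 1" unfolding abs_mult using assms
    by (metis abs_ge_zero mult_left_le order_le_less_trans)
  then have "1 + u * m \<noteq> 0" by linarith
  then have n: "(1 + u * m)\<^sup>2 \<noteq> 0" by simp
  define X where "X = (d1 - 2 * a * m) + u * (d2 - a * m\<^sup>2)"
  have "a + u * d1 + u\<^sup>2 * d2 = a * (1 + u * m)\<^sup>2 + u * X"
    by (simp add: X_def power2_eq_square algebra_simps)
  then have "two_replica_ratio m a d1 d2 u = a + u * (X / (1 + u * m)\<^sup>2)"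
    using n by (simp add: two_replica_ratio_def add_divide_distrib)
  then show ?thesis by (simp add: two_replica_ratio_def X_def)
qed

lemma jet_power:
  assumes "jet n B S"
  shows "jet n ((6 ^ n * B) ^ k) (\<lambda>u. S u ^ k)"
proof (induction k)
  case 0 show ?case by (simp add: jet_const)
next
  case (Suc k) then show ?case using jet_mult[OF assms Suc] by (simp add: mult_ac)
qed

text \<open>The bound is linear in \<open>G\<close>: a power inherits the size of the deviation of \<open>S\<close> from its value at \<open>0\<close>.\<close>

lemma jet_power_deviation:
  assumes S: "jet n B S" and g: "jet n G g" and a: "\<bar>a\<bar> \<le> B" and B: "1 \<le> B"
    and eq: "\<And>u. \<bar>u\<bar> \<le> 1/2 \<Longrightarrow> S u = a + u * g u"
  shows "\<exists>f. jet n (real k * 6 ^ n * (6 ^ n * B) ^ k * G) f \<and>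
    (\<forall>u. \<bar>u\<bar> \<le> 1/2 \<longrightarrow> S u ^ k = a ^ k + u * f u)"
proof (induction k)
  case 0 show ?case by (intro exI[of _ "\<lambda>_. 0"]) (simp add: jet_const)
next
  case (Suc k)
  then obtain f where f: "jet n (real k * 6 ^ n * (6 ^ n * B) ^ k * G) f"
    "\<And>u. \<bar>u\<bar> \<le> 1/2 \<Longrightarrow> S u ^ k = a ^ k + u * f u" by auto
  let ?E = "6 ^ n * B"
  have G: "0 \<le> G" using jet_nonneg[OF g] .
  have p: "1 \<le> (6::real) ^ n" by simp
  have E: "B \<le> ?E" "1 \<le> ?E" using mult_mono[OF p B] mult_right_mono[OF p, of B] B by auto
  have aE: "\<bar>a\<bar> \<le> ?E" using a E(1) by linarith
  have 1: "jet n (?E * (real k * 6 ^ n * ?E ^ k * G)) (\<lambda>u. a * f u)"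
    using jet_cmult[OF f(1), of a] by (elim jet_mono) (use aE G B in \<open>intro mult_right_mono, auto\<close>)
  have 2: "jet n (6 ^ n * G * ?E ^ k) (\<lambda>u. g u * S u ^ k)"
    by (rule jet_mult[OF g jet_power[OF S]])
  have "?E ^ k \<le> ?E * ?E ^ k" using E(2) by simp
  then have "6 ^ n * G * ?E ^ k \<le> 6 ^ n * G * (?E * ?E ^ k)"
    using G by (intro mult_left_mono) auto
  then have "jet n (real (Suc k) * 6 ^ n * ?E ^ Suc k * G) (\<lambda>u. a * f u + g u * S u ^ k)"
    using jet_add[OF 1 2] by (elim jet_mono) (simp add: algebra_simps)
  moreover have "S u ^ Suc k = a ^ Suc k + u * (a * f u + g u * S u ^ k)" if "\<bar>u\<bar> \<le> 1/2" for u
  proof -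
    have "S u ^ Suc k = (a + u * g u) * S u ^ k" using eq[OF that] by simp
    also have "\<dots> = a * (a ^ k + u * f u) + u * (g u * S u ^ k)"
      using f(2)[OF that] by (simp add: algebra_simps)
    finally show ?thesis by (simp add: algebra_simps)
  qed
  ultimately show ?case by blast
qed

section \<open>The expectation over one random bond\<close>

lemma tanh_abs_le: "\<bar>tanh t\<bar> \<le> \<bar>t\<bar>" for t :: real
proof -
  have "tanh s \<le> s" if "0 \<le> s" for s :: real
  proof -
    have "0 - tanh 0 \<le> s - tanh s"
      by (rule DERIV_nonneg_imp_nondecreasing[OF that])
        (auto intro!: exI derivative_eq_intros simp: cosh_real_nonzero)
    then show ?thesis by simp
  qed
  from this[of "\<bar>t\<bar>"] show ?thesis by simp
qed

lemma tanh_power2_approx: "\<bar>(tanh t)\<^sup>2 - t\<^sup>2\<bar> \<le> 2 * t ^ 4" for t :: real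
proof -
  have "s - tanh s \<le> s ^ 3" if "0 \<le> s" for s :: real
  proof -
    have "0 ^ 3 - (0 - tanh 0) \<le> s ^ 3 - (s - tanh s)"
    proof (rule DERIV_nonneg_imp_nondecreasing[OF that])
      fix x :: real assume "0 \<le> x"
      have "(tanh x)\<^sup>2 \<le> x\<^sup>2" using tanh_abs_le[of x] by (simp add: abs_le_square_iff)
      then show "\<exists>y. ((\<lambda>s. s ^ 3 - (s - tanh s)) has_real_derivative y) (at x) \<and> 0 \<le> y"
        by (intro exI[of _ "3 * x\<^sup>2 - (tanh x)\<^sup>2"] conjI)
           (auto intro!: derivative_eq_intros simp: power2_eq_square, use zero_le_square[of x] in linarith)
    qed
    then show ?thesis by simp
  qed
  from this[of "\<bar>t\<bar>"] have 1: "\<bar>t\<bar> - \<bar>tanh t\<bar> \<le> \<bar>t\<bar> ^ 3" by simp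
  have "\<bar>(tanh t)\<^sup>2 - t\<^sup>2\<bar> = \<bar>t\<bar>\<^sup>2 - \<bar>tanh t\<bar>\<^sup>2"
    using tanh_abs_le[of t] by (simp add: abs_le_square_iff)
  also have "\<dots> = (\<bar>t\<bar> - \<bar>tanh t\<bar>) * (\<bar>t\<bar> + \<bar>tanh t\<bar>)" by (simp add: power2_eq_square algebra_simps)
  also have "\<dots> \<le> \<bar>t\<bar> ^ 3 * (2 * \<bar>t\<bar>)"
    using 1 tanh_abs_le[of t] by (intro mult_mono) auto
  also have "\<dots> = 2 * t ^ 4" by (simp add: power_abs[symmetric] eval_nat_numeral abs_mult)
  finally show ?thesis .
qed

lemma inverse_one_minus_tanh_le:
  "1 - \<bar>tanh t\<bar> \<ge> exp (- 2 * \<bar>t\<bar>)" for t :: real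
proof -
  have "1 - tanh \<bar>t\<bar> = 2 * exp (- 2 * \<bar>t\<bar>) / (1 + exp (- 2 * \<bar>t\<bar>))"
    by (simp add: tanh_real_altdef field_simps add_pos_pos[THEN less_imp_neq, symmetric] del: tanh_real_abs)
  also have "\<dots> \<ge> exp (- 2 * \<bar>t\<bar>)"
    by (simp add: field_simps add_pos_pos)
  finally show ?thesis by simp
qed

text \<open>The denominator may degenerate as \<open>u\<close> tends to \<open>1\<close> or \<open>-1\<close>, but it is at least \<open>(1 - \<bar>u\<bar>)\<^sup>2 \<ge> exp (- 4 \<bar>t\<bar>)\<close>.
  This is why exponential moments of the bonds enter.\<close>

lemma ratio_tanh_bound:
  assumes m: "\<bar>m\<bar> \<le> 1" and a: "\<bar>a\<bar> \<le> D" "\<bar>d1\<bar> \<le> D" "\<bar>d2\<bar> \<le> D"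
  shows "\<bar>two_replica_ratio m a d1 d2 (tanh t)\<bar> \<le> 3 * D * exp (4 * \<bar>t\<bar>)"
proof -
  define u where "u = tanh t"
  have u: "\<bar>u\<bar> \<le> 1" using tanh_real_bounds[of t] by (auto simp: u_def)
  have D: "0 \<le> D" using a by simp
  have um: "\<bar>u * m\<bar> \<le> \<bar>u\<bar>" unfolding abs_mult using m by (simp add: mult_left_le)
  have "exp (- 2 * \<bar>t\<bar>) \<le> 1 + u * m"
    using inverse_one_minus_tanh_le[of t] um by (simp add: u_def)
  then have den: "exp (- 4 * \<bar>t\<bar>) \<le> (1 + u * m)\<^sup>2"
    using power_mono[of "exp (- 2 * \<bar>t\<bar>)" "1 + u * m" 2] by (simp flip: exp_of_nat_mult)
  have "\<bar>u * d1\<bar> \<le> 1 * D" "\<bar>u\<^sup>2 * d2\<bar> \<le> 1 * D"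
    unfolding abs_mult using u a by (intro mult_mono; simp add: abs_square_le_1)+
  then have num: "\<bar>a + u * d1 + u\<^sup>2 * d2\<bar> \<le> 3 * D" using a by linarith
  have "\<bar>two_replica_ratio m a d1 d2 u\<bar> = \<bar>a + u * d1 + u\<^sup>2 * d2\<bar> / (1 + u * m)\<^sup>2"
    by (simp add: two_replica_ratio_def)
  also have "\<dots> \<le> 3 * D / exp (- 4 * \<bar>t\<bar>)"
    using num den D by (intro frac_le) auto
  finally show ?thesis by (simp add: u_def exp_minus field_simps)
qed

text \<open>The exponent \<open>5\<close> is the \<open>4\<close> from the degenerating denominators plus \<open>1\<close> to absorb a power of the bond.\<close>

locale bond_law = prob_space \<kappa> for \<kappa> :: "real measure" +
  assumes sets_bond: "sets \<kappa> = sets borel"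
    and symmetric: "distr \<kappa> borel uminus = \<kappa>"
    and variance_1: "(\<integral>x. x\<^sup>2 \<partial>\<kappa>) = 1"
    and exp_moment: "integrable \<kappa> (\<lambda>x. exp (5 * \<bar>x\<bar>))"
begin

lemma measurable_bond[measurable_cong]: "sets \<kappa> = sets borel" by (rule sets_bond)

lemma exp_moment_nonneg: "0 \<le> (\<integral>x. exp (5 * \<bar>x\<bar>) \<partial>\<kappa>)"
  by (intro Bochner_Integration.integral_nonneg) auto

lemma integrable_bound_exp:
  assumes [measurable]: "f \<in> borel_measurable borel" and "\<And>x. \<bar>f x\<bar> \<le> C * exp (5 * \<bar>x\<bar>)"
  shows "integrable \<kappa> f"
proof (rule Bochner_Integration.integrable_bound[of _ "\<lambda>x. C * exp (5 * \<bar>x\<bar>)"])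
  show "AE x in \<kappa>. norm (f x) \<le> norm (C * exp (5 * \<bar>x\<bar>))"
    using assms(2) by (auto intro: order_trans abs_ge_self)
qed (use exp_moment in auto)

lemma integral_odd:
  assumes [measurable]: "f \<in> borel_measurable borel" and odd: "\<And>x. f (- x) = - f x"
  shows "(\<integral>x. f x \<partial>\<kappa>) = (0::real)"
proof -
  have "(\<integral>x. f x \<partial>\<kappa>) = (\<integral>x. f (- x) \<partial>\<kappa>)"
    by (subst symmetric[symmetric], subst integral_distr) auto
  then show ?thesis by (simp add: odd)
qed

end

lemma power4_le_exp: "y ^ 4 \<le> 24 * exp \<bar>y\<bar>" for y :: real
proof -
  have "(\<lambda>n. \<bar>y\<bar> ^ n /\<^sub>R fact n) sums exp \<bar>y\<bar>" by (rule exp_converges)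
  then have "sum (\<lambda>n. \<bar>y\<bar> ^ n /\<^sub>R fact n) {4} \<le> exp \<bar>y\<bar>"
    by (intro sum_le_suminf[THEN order_trans] ) (auto simp: sums_iff)
  then show ?thesis by (simp add: fact_numeral power_abs[symmetric] divide_simps)
qed

text \<open>The even quadratic term is written with \<open>t\<^sup>2\<close>, whose expectation is known, in place of \<open>u\<^sup>2\<close>; the difference is
  of fourth order. Outside the range of the expansion \<open>\<bar>t\<bar> > 1/2\<close>, so that \<open>1 \<le> 16 t\<^sup>4\<close> and \<open>t\<^sup>2 \<le> 4 t\<^sup>4\<close> turn the crude
  bound into one of fourth order, with constant \<open>4 * 16 + 4 = 68\<close>.\<close>

lemma bond_remainder_bound:
  fixes c0 c1 c2 c3 r t u v D :: real
  assumes h4: "\<bar>c0\<bar> \<le> D" "\<bar>c1\<bar> \<le> D" "\<bar>c2\<bar> \<le> D" "\<bar>c3\<bar> \<le> D" "\<bar>u\<bar> \<le> 1/2 \<Longrightarrow> \<bar>r\<bar> \<le> D"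
    and eq: "\<bar>u\<bar> \<le> 1/2 \<Longrightarrow> v = c0 + u * (c1 + u * (c2 + u * (c3 + u * r)))"
    and bd: "\<bar>v\<bar> \<le> D * exp (4 * \<bar>t\<bar>)" and u: "u = tanh t"
  shows "\<bar>v - (c0 + c1 * u + c2 * t\<^sup>2 + c3 * u ^ 3)\<bar> \<le> 68 * D * t ^ 4 * exp (4 * \<bar>t\<bar>)"
proof -
  have D: "0 \<le> D" using h4(1) by linarith
  have e: "1 \<le> exp (4 * \<bar>t\<bar>)" by simp
  have ut: "\<bar>u\<bar> \<le> \<bar>t\<bar>" unfolding u by (rule tanh_abs_le)
  have t4: "0 \<le> t ^ 4" by simp
  show ?thesis
  proof (cases "\<bar>u\<bar> \<le> 1/2")
    case True
    have "v - (c0 + c1 * u + c2 * t\<^sup>2 + c3 * u ^ 3) = c2 * (u\<^sup>2 - t\<^sup>2) + u ^ 4 * r"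
      unfolding eq[OF True] by (simp add: power2_eq_square eval_nat_numeral algebra_simps)
    moreover have "\<bar>c2 * (u\<^sup>2 - t\<^sup>2)\<bar> \<le> D * (2 * t ^ 4)"
      unfolding abs_mult u using tanh_power2_approx[of t] h4(3) D by (intro mult_mono) auto
    moreover have "\<bar>u ^ 4 * r\<bar> \<le> D * t ^ 4"
      unfolding abs_mult power_abs mult.commute[of D] using ut h4(5)[OF True] power_mono[OF ut, of 4]
      by (intro mult_mono) auto
    ultimately have "\<bar>v - (c0 + c1 * u + c2 * t\<^sup>2 + c3 * u ^ 3)\<bar> \<le> 3 * (D * t ^ 4)"
      using abs_triangle_ineq[of "c2 * (u\<^sup>2 - t\<^sup>2)" "u ^ 4 * r"] by simp
    also have "\<dots> \<le> 68 * (D * t ^ 4)" using D t4 by (intro mult_right_mono) auto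
    also have "\<dots> \<le> 68 * (D * t ^ 4) * exp (4 * \<bar>t\<bar>)" using mult_left_mono[OF e, of "68 * (D * t ^ 4)"] D t4 by simp
    finally show ?thesis by (simp add: mult_ac)
  next
    case False
    then have th: "1/2 \<le> \<bar>t\<bar>" using ut by simp
    have u1: "\<bar>u\<bar> \<le> 1" unfolding u using tanh_real_bounds[of t] by auto
    have t2: "1/4 \<le> t\<^sup>2" using power_mono[OF th, of 2] by (simp add: power2_eq_square)
    have t24: "t\<^sup>2 \<le> 4 * t ^ 4" using mult_right_mono[OF t2, of "t\<^sup>2"] by (simp add: power2_eq_square eval_nat_numeral)
    have t44: "1 \<le> 16 * t ^ 4" using t2 t24 by simp
    have 1: "\<bar>c1 * u\<bar> \<le> D * 1" unfolding abs_mult using h4 u1 D by (intro mult_mono) auto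
    have 2: "\<bar>c3 * u ^ 3\<bar> \<le> D * 1" unfolding abs_mult using h4 u1 D
      by (intro mult_mono) (auto simp: power_abs power_le_one)
    have 3: "\<bar>c2 * t\<^sup>2\<bar> \<le> D * t\<^sup>2" unfolding abs_mult using h4 by (intro mult_mono) auto
    have "\<bar>v - (c0 + c1 * u + c2 * t\<^sup>2 + c3 * u ^ 3)\<bar> \<le> D * exp (4 * \<bar>t\<bar>) + (3 * D + D * t\<^sup>2)"
      using 1 2 3 h4(1) bd by linarith
    also have "\<dots> \<le> D * exp (4 * \<bar>t\<bar>) + (3 * D + D * t\<^sup>2) * exp (4 * \<bar>t\<bar>)"
      using mult_left_mono[OF e, of "3 * D + D * t\<^sup>2"] D by simp
    also have "\<dots> = D * (4 + t\<^sup>2) * exp (4 * \<bar>t\<bar>)" by (simp add: algebra_simps)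
    also have "\<dots> \<le> D * (68 * t ^ 4) * exp (4 * \<bar>t\<bar>)"
      using D t24 t44 by (intro mult_right_mono mult_left_mono) auto
    finally show ?thesis by (simp add: mult_ac)
  qed
qed

text \<open>The odd terms vanish by symmetry and the quadratic term is determined by the variance, so that the law of
  the bond enters only at order \<open>N\<^sup>-\<^sup>2\<close>. The coefficient \<open>c\<close> is the same for all laws and cancels when two laws
  are compared. The constant is \<open>1632 = 68 * 24\<close>, where \<open>24\<close> comes from \<open>y\<^sup>4 \<le> 24 exp \<bar>y\<bar>\<close>.\<close>

lemma bond_expectation:
  assumes h: "jet 4 D h" "h \<in> borel_measurable borel"
    and bd: "\<And>t. \<bar>h (tanh t)\<bar> \<le> D * exp (4 * \<bar>t\<bar>)"
  obtains c where "\<bar>c\<bar> \<le> D"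
    "\<And>\<kappa> N. bond_law \<kappa> \<Longrightarrow> 1 \<le> N \<Longrightarrow> \<bar>(\<integral>y. h (tanh (y / sqrt (real N))) \<partial>\<kappa>) - h 0 - c / real N\<bar>
      \<le> 1632 * (\<integral>y. exp (5 * \<bar>y\<bar>) \<partial>\<kappa>) * D / (real N)\<^sup>2"
proof -
  have "jet (Suc (Suc (Suc (Suc 0)))) D h" using h(1) by (simp add: eval_nat_numeral)
  then obtain c0 h1 where c0: "\<bar>c0\<bar> \<le> D" "jet (Suc (Suc (Suc 0))) D h1"
    "\<And>u. \<bar>u\<bar> \<le> 1/2 \<Longrightarrow> h u = c0 + u * h1 u" by (subst (asm) jet.simps(2)) blast
  then obtain c1 h2 where c1: "\<bar>c1\<bar> \<le> D" "jet (Suc (Suc 0)) D h2"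
    "\<And>u. \<bar>u\<bar> \<le> 1/2 \<Longrightarrow> h1 u = c1 + u * h2 u" by (subst (asm) jet.simps(2)) blast
  then obtain c2 h3 where c2: "\<bar>c2\<bar> \<le> D" "jet (Suc 0) D h3"
    "\<And>u. \<bar>u\<bar> \<le> 1/2 \<Longrightarrow> h2 u = c2 + u * h3 u" by (subst (asm) jet.simps(2)) blast
  then obtain c3 r where c3: "\<bar>c3\<bar> \<le> D" "jet 0 D r"
    "\<And>u. \<bar>u\<bar> \<le> 1/2 \<Longrightarrow> h3 u = c3 + u * r u" by (subst (asm) jet.simps(2)) blast
  have D: "0 \<le> D" using c0(1) by simp
  have h0: "h 0 = c0" using c0(3)[of 0] by simp
  define rem where "rem t = h (tanh t) - (c0 + c1 * tanh t + c2 * t\<^sup>2 + c3 * tanh t ^ 3)" for t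
  have rem: "\<bar>rem t\<bar> \<le> 68 * D * t ^ 4 * exp (4 * \<bar>t\<bar>)" for t
    unfolding rem_def
    by (rule bond_remainder_bound[OF c0(1) c1(1) c2(1) c3(1) _ _ bd refl, of _ "r (tanh t)"])
       (use c0(3) c1(3) c2(3) c3(2,3) in auto)
  note [measurable] = h(2)
  have [measurable]: "(tanh :: real \<Rightarrow> real) \<in> borel_measurable borel"
    by (intro borel_measurable_continuous_onI continuous_intros) (simp add: cosh_real_nonzero)
  have [measurable]: "rem \<in> borel_measurable borel" unfolding rem_def by measurable
  show thesis
  proof (rule that[OF c2(1)])
    fix \<kappa> :: "real measure" and N :: nat
    assume "bond_law \<kappa>" and N: "1 \<le> N"
    interpret bond_law \<kappa> by fact
    let ?s = "sqrt (real N)"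
    have s: "1 \<le> ?s" using N by simp
    have rb: "\<bar>rem (y / ?s)\<bar> \<le> 1632 * D / (real N)\<^sup>2 * exp (5 * \<bar>y\<bar>)" for y
    proof -
      have "\<bar>y / ?s\<bar> \<le> \<bar>y\<bar>" using s by (simp add: abs_divide divide_le_eq mult_le_cancel_left1)
      then have e: "exp (4 * \<bar>y / ?s\<bar>) \<le> exp (4 * \<bar>y\<bar>)" by simp
      have p: "(y / ?s) ^ 4 = y ^ 4 / (real N)\<^sup>2"
        by (simp add: power_divide eval_nat_numeral)
      have "\<bar>rem (y / ?s)\<bar> \<le> 68 * D * (y ^ 4 / (real N)\<^sup>2) * exp (4 * \<bar>y\<bar>)"
        using rem[of "y / ?s"] unfolding p
        by (rule order_trans) (use D e in \<open>intro mult_left_mono, auto\<close>)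
      also have "\<dots> = 68 * D / (real N)\<^sup>2 * exp (4 * \<bar>y\<bar>) * y ^ 4" by simp
      also have "\<dots> \<le> 68 * D / (real N)\<^sup>2 * exp (4 * \<bar>y\<bar>) * (24 * exp \<bar>y\<bar>)"
        using D power4_le_exp[of y] by (intro mult_left_mono) auto
      also have "\<dots> = 1632 * D / (real N)\<^sup>2 * exp (5 * \<bar>y\<bar>)"
        by (simp flip: exp_add)
      finally show ?thesis .
    qed
    have ir: "integrable \<kappa> (\<lambda>y. rem (y / ?s))" by (rule integrable_bound_exp[OF _ rb]) simp
    have tb: "\<bar>tanh x\<bar> \<le> 1" for x :: real using tanh_real_bounds[of x] by auto
    have it: "integrable \<kappa> (\<lambda>y. tanh (y / ?s))" "integrable \<kappa> (\<lambda>y. tanh (y / ?s) ^ 3)"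
      using tb by (auto intro!: integrable_const_bound[where B = 1] simp: power_abs power_le_one)
    have i2: "integrable \<kappa> (\<lambda>y. y\<^sup>2)" using variance_1 not_integrable_integral_eq by fastforce
    have o: "(\<integral>y. tanh (y / ?s) \<partial>\<kappa>) = 0" "(\<integral>y. tanh (y / ?s) ^ 3 \<partial>\<kappa>) = 0"
      by (rule integral_odd; simp)+
    have "(\<integral>y. h (tanh (y / ?s)) \<partial>\<kappa>)
        = (\<integral>y. rem (y / ?s) + (c0 + c1 * tanh (y / ?s) + c2 / real N * y\<^sup>2 + c3 * tanh (y / ?s) ^ 3) \<partial>\<kappa>)"
      by (intro Bochner_Integration.integral_cong) (auto simp: rem_def power_divide)
    also have "\<dots> = (\<integral>y. rem (y / ?s) \<partial>\<kappa>) + (c0 + c2 / real N)"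
      using ir it i2 by (simp add: o variance_1 prob_space)
    finally have "(\<integral>y. h (tanh (y / ?s)) \<partial>\<kappa>) - h 0 - c2 / real N = (\<integral>y. rem (y / ?s) \<partial>\<kappa>)"
      by (simp add: h0)
    also have "\<bar>\<dots>\<bar> \<le> (\<integral>y. 1632 * D / (real N)\<^sup>2 * exp (5 * \<bar>y\<bar>) \<partial>\<kappa>)"
      by (rule order_trans[OF integral_abs_bound integral_mono]) (use ir rb exp_moment in auto)
    finally show "\<bar>(\<integral>y. h (tanh (y / ?s)) \<partial>\<kappa>) - h 0 - c2 / real N\<bar>
        \<le> 1632 * (\<integral>y. exp (5 * \<bar>y\<bar>) \<partial>\<kappa>) * D / (real N)\<^sup>2"
      by (simp add: mult_ac)
  qed
qed

section \<open>Two-replica averages as finite sums\<close>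

definition replica_avg ::
    "nat \<Rightarrow> (nat \<times> nat \<Rightarrow> real) \<Rightarrow> ((nat \<Rightarrow> real) \<Rightarrow> (nat \<Rightarrow> real) \<Rightarrow> real) \<Rightarrow> real" where
  "replica_avg N J B = (\<Sum>\<sigma>\<in>spins N. \<Sum>\<tau>\<in>spins N. gibbs_weight N J \<sigma> * gibbs_weight N J \<tau> * B \<sigma> \<tau>)"

definition bond :: "nat \<times> nat \<Rightarrow> (nat \<Rightarrow> real) \<Rightarrow> real" where
  "bond e \<sigma> = \<sigma> (fst e) * \<sigma> (snd e)"

lemma replica_avg_mono:
  assumes "\<And>\<sigma> \<tau>. \<sigma> \<in> spins N \<Longrightarrow> \<tau> \<in> spins N \<Longrightarrow> A \<sigma> \<tau> \<le> B \<sigma> \<tau>"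
  shows "replica_avg N J A \<le> replica_avg N J B"
  unfolding replica_avg_def
  by (intro sum_mono mult_left_mono assms mult_nonneg_nonneg gibbs_weight_nonneg)

lemma replica_avg_cong:
  assumes "\<And>\<sigma> \<tau>. \<sigma> \<in> spins N \<Longrightarrow> \<tau> \<in> spins N \<Longrightarrow> A \<sigma> \<tau> = B \<sigma> \<tau>"
  shows "replica_avg N J A = replica_avg N J B"
  by (intro antisym replica_avg_mono) (simp_all add: assms)

lemma replica_avg_add: "replica_avg N J (\<lambda>\<sigma> \<tau>. A \<sigma> \<tau> + B \<sigma> \<tau>) = replica_avg N J A + replica_avg N J B"
  by (simp add: replica_avg_def sum.distrib distrib_left)

lemma replica_avg_diff: "replica_avg N J (\<lambda>\<sigma> \<tau>. A \<sigma> \<tau> - B \<sigma> \<tau>) = replica_avg N J A - replica_avg N J B"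
  by (simp add: replica_avg_def sum_subtractf right_diff_distrib)

lemma replica_avg_cmult: "replica_avg N J (\<lambda>\<sigma> \<tau>. c * A \<sigma> \<tau>) = c * replica_avg N J A"
  by (simp add: replica_avg_def sum_distrib_left mult_ac)

lemma replica_avg_fst: "replica_avg N J (\<lambda>\<sigma> \<tau>. f \<sigma>) = (\<Sum>\<sigma>\<in>spins N. gibbs_weight N J \<sigma> * f \<sigma>)"
proof -
  have "replica_avg N J (\<lambda>\<sigma> \<tau>. f \<sigma>)
      = (\<Sum>\<sigma>\<in>spins N. (gibbs_weight N J \<sigma> * f \<sigma>) * (\<Sum>\<tau>\<in>spins N. gibbs_weight N J \<tau>))"
    by (simp add: replica_avg_def sum_distrib_left mult_ac)
  then show ?thesis by (simp add: sum_gibbs_weight)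
qed

lemma replica_avg_const: "replica_avg N J (\<lambda>_ _. c) = c"
  using replica_avg_fst[of N J "\<lambda>_. c"] by (simp add: sum_distrib_right[symmetric] sum_gibbs_weight)

lemma replica_avg_nonneg:
  "(\<And>\<sigma> \<tau>. \<sigma> \<in> spins N \<Longrightarrow> \<tau> \<in> spins N \<Longrightarrow> 0 \<le> B \<sigma> \<tau>) \<Longrightarrow> 0 \<le> replica_avg N J B"
  using replica_avg_mono[of N "\<lambda>_ _. 0" B J] by (simp add: replica_avg_const)

lemma replica_avg_abs_le:
  assumes "\<And>\<sigma> \<tau>. \<sigma> \<in> spins N \<Longrightarrow> \<tau> \<in> spins N \<Longrightarrow> \<bar>A \<sigma> \<tau>\<bar> \<le> B \<sigma> \<tau>"
  shows "\<bar>replica_avg N J A\<bar> \<le> replica_avg N J B"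
proof -
  have "replica_avg N J A \<le> replica_avg N J B"
    by (rule replica_avg_mono) (use assms abs_le_D1 in blast)
  moreover have "replica_avg N J (\<lambda>\<sigma> \<tau>. (- 1) * A \<sigma> \<tau>) \<le> replica_avg N J B"
    by (rule replica_avg_mono) (use assms abs_le_D2 in force)
  ultimately show ?thesis unfolding replica_avg_cmult by simp
qed

lemma spins_abs: "\<sigma> \<in> spins N \<Longrightarrow> 1 \<le> i \<Longrightarrow> i \<le> N \<Longrightarrow> \<bar>\<sigma> i\<bar> = 1"
  by (auto simp: spins_def PiE_iff Ball_def dest!: spec[of _ i])

lemma bond_cases: "e \<in> edges N \<Longrightarrow> \<sigma> \<in> spins N \<Longrightarrow> bond e \<sigma> = 1 \<or> bond e \<sigma> = - 1"
  using spins_abs[of \<sigma> N "fst e"] spins_abs[of \<sigma> N "snd e"]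
  by (auto simp: edges_def bond_def abs_if split: if_splits)

lemma bond_abs: "e \<in> edges N \<Longrightarrow> \<sigma> \<in> spins N \<Longrightarrow> \<bar>bond e \<sigma>\<bar> = 1"
  using bond_cases[of e N \<sigma>] by auto

lemma finite_edges: "finite (edges N)"
  by (rule finite_subset[of _ "{1..N} \<times> {1..N}"]) (auto simp: edges_def)

lemma edges_subset: "edges N \<subseteq> {1..N} \<times> {1..N}"
  by (auto simp: edges_def)

lemma card_edges_le: "card (edges N) \<le> N\<^sup>2"
  using card_mono[OF _ edges_subset[of N]] by (simp add: power2_eq_square card_cartesian_product)

lemma overlap_abs_le_1:
  assumes "\<sigma> \<in> spins N" "\<tau> \<in> spins N"
  shows "\<bar>overlap N (\<sigma>, \<tau>)\<bar> \<le> 1"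
proof -
  have "\<bar>\<Sum>i = 1..N. \<sigma> i * \<tau> i\<bar> \<le> (\<Sum>i = 1..N. 1)"
    by (rule order_trans[OF sum_abs sum_mono]) (use assms spins_abs in \<open>auto simp: abs_mult\<close>)
  then show ?thesis by (auto simp: overlap_def divide_le_eq)
qed

lemma hamiltonian_update:
  assumes e: "e \<in> edges N"
  shows "hamiltonian N (J(e := y)) \<sigma> = hamiltonian N (J(e := 0)) \<sigma> + y / sqrt (real N) * bond e \<sigma>"
proof -
  have "(\<Sum>(i, j)\<in>edges N. (J(e := y)) (i, j) * \<sigma> i * \<sigma> j)
      = y * bond e \<sigma> + (\<Sum>(i, j)\<in>edges N. (J(e := 0)) (i, j) * \<sigma> i * \<sigma> j)"
    unfolding sum.remove[OF finite_edges e]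
    by (auto simp: case_prod_beta bond_def intro!: sum.cong)
  then show ?thesis by (simp add: hamiltonian_def distrib_left)
qed

text \<open>The bond variable is a sign, so that \<open>exp (t X) = cosh t (1 + X tanh t)\<close>; the factor \<open>cosh t\<close> cancels against the
  partition function.\<close>

lemma gibbs_weight_update:
  assumes e: "e \<in> edges N" and \<sigma>: "\<sigma> \<in> spins N"
  shows "gibbs_weight N (J(e := y)) \<sigma> = gibbs_weight N (J(e := 0)) \<sigma>
    * (1 + tanh (y / sqrt (real N)) * bond e \<sigma>)
    / (1 + tanh (y / sqrt (real N)) * replica_avg N (J(e := 0)) (\<lambda>\<sigma> \<tau>. bond e \<sigma>))"
proof -
  define t where "t = y / sqrt (real N)"
  define H where "H = hamiltonian N (J(e := 0))"
  define Z where "Z = (\<Sum>\<tau>\<in>spins N. exp (H \<tau>))"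
  have Z: "0 < Z" unfolding Z_def by (intro sum_pos finite_spins spins_nonempty) auto
  have ex: "exp (hamiltonian N (J(e := y)) \<tau>) = cosh t * (exp (H \<tau>) * (1 + tanh t * bond e \<tau>))"
    if "\<tau> \<in> spins N" for \<tau>
  proof -
    have "exp (t * bond e \<tau>) = cosh t * (1 + tanh t * bond e \<tau>)"
      using bond_cases[OF e that]
      by (auto simp: tanh_def distrib_left right_diff_distrib cosh_plus_sinh cosh_minus_sinh)
    then show ?thesis
      by (simp add: hamiltonian_update[OF e, of J y] exp_add t_def[symmetric] H_def)
  qed
  have "(\<Sum>\<tau>\<in>spins N. exp (hamiltonian N (J(e := y)) \<tau>))
      = cosh t * (\<Sum>\<tau>\<in>spins N. exp (H \<tau>) * (1 + tanh t * bond e \<tau>))"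
    by (simp add: ex sum_distrib_left)
  also have "(\<Sum>\<tau>\<in>spins N. exp (H \<tau>) * (1 + tanh t * bond e \<tau>))
      = Z * (1 + tanh t * replica_avg N (J(e := 0)) (\<lambda>\<sigma> \<tau>. bond e \<sigma>))"
  proof -
    have "replica_avg N (J(e := 0)) (\<lambda>\<sigma> \<tau>. bond e \<sigma>) = (\<Sum>\<tau>\<in>spins N. exp (H \<tau>) * bond e \<tau>) / Z"
      unfolding replica_avg_fst gibbs_weight_def by (simp add: sum_divide_distrib Z_def H_def)
    moreover have "(\<Sum>\<tau>\<in>spins N. exp (H \<tau>) * (1 + tanh t * bond e \<tau>))
        = Z + tanh t * (\<Sum>\<tau>\<in>spins N. exp (H \<tau>) * bond e \<tau>)"
      by (simp add: distrib_left sum.distrib sum_distrib_left mult_ac Z_def)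
    ultimately show ?thesis using Z by (simp add: field_simps)
  qed
  finally have tot: "(\<Sum>\<tau>\<in>spins N. exp (hamiltonian N (J(e := y)) \<tau>))
      = cosh t * (Z * (1 + tanh t * replica_avg N (J(e := 0)) (\<lambda>\<sigma> \<tau>. bond e \<sigma>)))" .
  have "gibbs_weight N (J(e := 0)) \<sigma> = exp (H \<sigma>) / Z"
    by (simp add: gibbs_weight_def H_def Z_def)
  then show ?thesis
    unfolding gibbs_weight_def[of N "J(e := y)"] ex[OF \<sigma>] tot t_def[symmetric] by simp
qed

lemma replica_avg_update:
  fixes J e N B
  defines "A \<equiv> replica_avg N (J(e := 0))"
  assumes e: "e \<in> edges N"
  shows "replica_avg N (J(e := y)) B = (A B + tanh (y / sqrt (real N)) * A (\<lambda>\<sigma> \<tau>. B \<sigma> \<tau> * (bond e \<sigma> + bond e \<tau>))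
      + (tanh (y / sqrt (real N)))\<^sup>2 * A (\<lambda>\<sigma> \<tau>. B \<sigma> \<tau> * (bond e \<sigma> * bond e \<tau>)))
    / (1 + tanh (y / sqrt (real N)) * A (\<lambda>\<sigma> \<tau>. bond e \<sigma>))\<^sup>2"
proof -
  define u where "u = tanh (y / sqrt (real N))"
  define m where "m = A (\<lambda>\<sigma> \<tau>. bond e \<sigma>)"
  let ?g = "gibbs_weight N (J(e := 0))"
  have w: "gibbs_weight N (J(e := y)) \<sigma> = ?g \<sigma> * (1 + u * bond e \<sigma>) / (1 + u * m)" if "\<sigma> \<in> spins N" for \<sigma>
    using gibbs_weight_update[OF e that, of J y] by (simp add: u_def m_def A_def)
  have "replica_avg N (J(e := y)) B = (\<Sum>\<sigma>\<in>spins N. \<Sum>\<tau>\<in>spins N.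
      (?g \<sigma> * ?g \<tau> * ((1 + u * bond e \<sigma>) * (1 + u * bond e \<tau>) * B \<sigma> \<tau>)) / (1 + u * m)\<^sup>2)"
    unfolding replica_avg_def by (intro sum.cong refl) (simp add: w power2_eq_square mult_ac)
  also have "\<dots> = replica_avg N (J(e := 0)) (\<lambda>\<sigma> \<tau>. (1 + u * bond e \<sigma>) * (1 + u * bond e \<tau>) * B \<sigma> \<tau>) / (1 + u * m)\<^sup>2"
    by (simp add: replica_avg_def sum_divide_distrib)
  also have "replica_avg N (J(e := 0)) (\<lambda>\<sigma> \<tau>. (1 + u * bond e \<sigma>) * (1 + u * bond e \<tau>) * B \<sigma> \<tau>)
      = replica_avg N (J(e := 0)) (\<lambda>\<sigma> \<tau>. B \<sigma> \<tau> + u * (B \<sigma> \<tau> * (bond e \<sigma> + bond e \<tau>))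
          + u\<^sup>2 * (B \<sigma> \<tau> * (bond e \<sigma> * bond e \<tau>)))"
    by (intro replica_avg_cong) (simp add: power2_eq_square algebra_simps)
  finally show ?thesis
    unfolding replica_avg_add replica_avg_cmult u_def m_def A_def .
qed

lemma nn_integral_two_replicas:
  assumes F: "F \<in> borel_measurable (two_replicas N J)" and nn: "\<And>r. 0 \<le> F r"
  shows "(\<integral>\<^sup>+ r. ennreal (F r) \<partial>two_replicas N J) = ennreal (replica_avg N J (\<lambda>\<sigma> \<tau>. F (\<sigma>, \<tau>)))"
proof -
  interpret G: prob_space "gibbs N J" by (rule prob_space_gibbs)
  note g = gibbs_weight_nonneg
  have fin: "(\<integral>\<^sup>+ \<sigma>. ennreal (f \<sigma>) \<partial>gibbs N J) = ennreal (\<Sum>\<sigma>\<in>spins N. gibbs_weight N J \<sigma> * f \<sigma>)"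
    if "\<And>\<sigma>. 0 \<le> f \<sigma>" for f
    unfolding gibbs_def nn_integral_point_measure_finite[OF finite_spins]
    using that by (simp add: ennreal_mult[symmetric] g sum_ennreal)
  have "(\<integral>\<^sup>+ r. ennreal (F r) \<partial>two_replicas N J) = (\<integral>\<^sup>+ \<sigma>. (\<integral>\<^sup>+ \<tau>. ennreal (F (\<sigma>, \<tau>)) \<partial>gibbs N J) \<partial>gibbs N J)"
    using F unfolding two_replicas_def by (subst G.nn_integral_fst[symmetric]) auto
  also have "\<dots> = ennreal (\<Sum>\<sigma>\<in>spins N. gibbs_weight N J \<sigma> * (\<Sum>\<tau>\<in>spins N. gibbs_weight N J \<tau> * F (\<sigma>, \<tau>)))"
    by (simp add: fin nn sum_nonneg g)
  finally show ?thesis by (simp add: replica_avg_def sum_distrib_left mult_ac)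
qed

lemma overlap_measurable: "overlap N \<in> borel_measurable (two_replicas N J)"
proof -
  note [measurable] = gibbs_measurable
  show ?thesis unfolding overlap_def two_replicas_def split_beta by measurable
qed

lemma integral_overlap_measure:
  assumes [measurable]: "f \<in> borel_measurable borel" and nn: "\<And>x. 0 \<le> f x"
  shows "(\<integral>x. f x \<partial>overlap_measure N J)
    = replica_avg N J (\<lambda>\<sigma> \<tau>. f (real N powr (1/3) * overlap N (\<sigma>, \<tau>)))"
proof -
  note [measurable] = overlap_measurable[of N J]
  have "(\<integral>x. f x \<partial>overlap_measure N J) = enn2real (\<integral>\<^sup>+ x. ennreal (f x) \<partial>overlap_measure N J)"
    by (rule integral_eq_nn_integral) (auto simp: overlap_measure_def nn)
  also have "(\<integral>\<^sup>+ x. ennreal (f x) \<partial>overlap_measure N J)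
      = (\<integral>\<^sup>+ r. ennreal (f (real N powr (1/3) * overlap N r)) \<partial>two_replicas N J)"
    unfolding overlap_measure_def by (subst nn_integral_distr) auto
  also have "\<dots> = ennreal (replica_avg N J (\<lambda>\<sigma> \<tau>. f (real N powr (1/3) * overlap N (\<sigma>, \<tau>))))"
    by (rule nn_integral_two_replicas) (auto simp: nn)
  finally show ?thesis by (simp add: replica_avg_nonneg nn)
qed

lemma sum_swap_pairs:
  fixes f :: "'a \<Rightarrow> 'a \<Rightarrow> 'b \<Rightarrow> 'b \<Rightarrow> real"
  shows "(\<Sum>i\<in>I. \<Sum>j\<in>I. \<Sum>y\<in>Y. \<Sum>z\<in>Y. f i j y z) = (\<Sum>y\<in>Y. \<Sum>z\<in>Y. \<Sum>i\<in>I. \<Sum>j\<in>I. f i j y z)"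
proof -
  have "(\<Sum>i\<in>I. \<Sum>j\<in>I. \<Sum>y\<in>Y. \<Sum>z\<in>Y. f i j y z) = (\<Sum>i\<in>I. \<Sum>y\<in>Y. \<Sum>j\<in>I. \<Sum>z\<in>Y. f i j y z)"
    by (intro sum.cong refl sum.swap)
  also have "\<dots> = (\<Sum>i\<in>I. \<Sum>y\<in>Y. \<Sum>z\<in>Y. \<Sum>j\<in>I. f i j y z)"
    by (intro sum.cong refl sum.swap)
  also have "\<dots> = (\<Sum>y\<in>Y. \<Sum>i\<in>I. \<Sum>z\<in>Y. \<Sum>j\<in>I. f i j y z)"
    by (rule sum.swap)
  also have "\<dots> = (\<Sum>y\<in>Y. \<Sum>z\<in>Y. \<Sum>i\<in>I. \<Sum>j\<in>I. f i j y z)"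
    by (intro sum.cong refl sum.swap)
  finally show ?thesis .
qed

lemma mult_power2_sum:
  fixes a :: "'a \<Rightarrow> real"
  shows "c * (\<Sum>i\<in>I. a i)\<^sup>2 = (\<Sum>i\<in>I. \<Sum>j\<in>I. c * (a i * a j))"
  unfolding power2_eq_square sum_product by (simp only: sum_distrib_left)

text \<open>Expanding the square and summing over \<open>i\<close> and \<open>j\<close> first gives a double sum over \<open>y\<close> and \<open>z\<close> of the weights
  times \<open>(\<Sum>i. v i y * v i z)\<^sup>2 \<ge> 0\<close>, in which the weights may be replaced by larger ones.\<close>

lemma square_sum_domination:
  fixes v :: "nat \<Rightarrow> 'a \<Rightarrow> real"
  assumes p: "\<And>y. y \<in> Y \<Longrightarrow> \<bar>p y\<bar> \<le> K * q y"
  shows "(\<Sum>i\<in>I. \<Sum>j\<in>I. (\<Sum>y\<in>Y. p y * (v i y * v j y))\<^sup>2)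
    \<le> K\<^sup>2 * (\<Sum>i\<in>I. \<Sum>j\<in>I. (\<Sum>y\<in>Y. q y * (v i y * v j y))\<^sup>2)"
proof -
  have ex: "(\<Sum>i\<in>I. \<Sum>j\<in>I. (\<Sum>y\<in>Y. r y * (v i y * v j y))\<^sup>2)
      = (\<Sum>y\<in>Y. \<Sum>z\<in>Y. r y * r z * (\<Sum>i\<in>I. v i y * v i z)\<^sup>2)" for r :: "'a \<Rightarrow> real"
  proof -
    have "(\<Sum>y\<in>Y. r y * (v i y * v j y))\<^sup>2
        = (\<Sum>y\<in>Y. \<Sum>z\<in>Y. r y * r z * ((v i y * v i z) * (v j y * v j z)))" for i j
      unfolding power2_eq_square sum_product by (intro sum.cong refl) (simp add: mult_ac)
    then have "(\<Sum>i\<in>I. \<Sum>j\<in>I. (\<Sum>y\<in>Y. r y * (v i y * v j y))\<^sup>2)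
        = (\<Sum>y\<in>Y. \<Sum>z\<in>Y. \<Sum>i\<in>I. \<Sum>j\<in>I. r y * r z * ((v i y * v i z) * (v j y * v j z)))"
      by (simp only: sum_swap_pairs[of _ I Y])
    then show ?thesis by (simp only: mult_power2_sum)
  qed
  have "(\<Sum>y\<in>Y. \<Sum>z\<in>Y. p y * p z * (\<Sum>i\<in>I. v i y * v i z)\<^sup>2)
      \<le> (\<Sum>y\<in>Y. \<Sum>z\<in>Y. (K * q y) * (K * q z) * (\<Sum>i\<in>I. v i y * v i z)\<^sup>2)"
  proof (intro sum_mono mult_right_mono)
    fix y z assume yz: "y \<in> Y" "z \<in> Y"
    have "p y * p z \<le> \<bar>p y\<bar> * \<bar>p z\<bar>" by (simp flip: abs_mult)
    also have "\<dots> \<le> (K * q y) * (K * q z)"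
      using p[OF yz(1)] p[OF yz(2)] by (intro mult_mono) auto
    finally show "p y * p z \<le> (K * q y) * (K * q z)" .
  qed simp
  also have "\<dots> = K\<^sup>2 * (\<Sum>y\<in>Y. \<Sum>z\<in>Y. q y * q z * (\<Sum>i\<in>I. v i y * v i z)\<^sup>2)"
    by (simp add: sum_distrib_left power2_eq_square mult_ac)
  finally show ?thesis unfolding ex .
qed

definition bond_mean :: "nat \<Rightarrow> (nat \<times> nat \<Rightarrow> real) \<Rightarrow> nat \<times> nat \<Rightarrow> real" where
  "bond_mean N J e = (\<Sum>\<sigma>\<in>spins N. gibbs_weight N J \<sigma> * bond e \<sigma>)"

lemma sum_bond_mean_power2:
  "(\<Sum>i = 1..N. \<Sum>j = 1..N. (bond_mean N J (i, j))\<^sup>2)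
    = (real N)\<^sup>2 * replica_avg N J (\<lambda>\<sigma> \<tau>. (overlap N (\<sigma>, \<tau>))\<^sup>2)"
proof (cases "N = 0")
  case False
  let ?g = "gibbs_weight N J"
  have "(bond_mean N J (i, j))\<^sup>2
      = (\<Sum>\<sigma>\<in>spins N. \<Sum>\<tau>\<in>spins N. ?g \<sigma> * ?g \<tau> * ((\<sigma> i * \<tau> i) * (\<sigma> j * \<tau> j)))" for i j
    unfolding bond_mean_def bond_def power2_eq_square sum_product
    by (intro sum.cong refl) (simp add: mult_ac)
  then have "(\<Sum>i = 1..N. \<Sum>j = 1..N. (bond_mean N J (i, j))\<^sup>2) = (\<Sum>\<sigma>\<in>spins N. \<Sum>\<tau>\<in>spins N.
      \<Sum>i = 1..N. \<Sum>j = 1..N. ?g \<sigma> * ?g \<tau> * ((\<sigma> i * \<tau> i) * (\<sigma> j * \<tau> j)))"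
    by (simp only: sum_swap_pairs[of _ "{1..N}" "spins N"])
  also have "\<dots> = replica_avg N J (\<lambda>\<sigma> \<tau>. (\<Sum>i = 1..N. \<sigma> i * \<tau> i)\<^sup>2)"
    by (simp only: replica_avg_def mult_power2_sum)
  also have "\<dots> = replica_avg N J (\<lambda>\<sigma> \<tau>. (real N)\<^sup>2 * (overlap N (\<sigma>, \<tau>))\<^sup>2)"
    using False by (intro replica_avg_cong) (simp add: overlap_def power_divide)
  finally show ?thesis unfolding replica_avg_cmult .
qed simp

section \<open>Exchanging the law of the bonds\<close>

lemma bond_mean_eq: "bond_mean N J e = replica_avg N J (\<lambda>\<sigma> \<tau>. bond e \<sigma>)"
  by (simp add: bond_mean_def replica_avg_fst)

text \<open>The coefficients of \<open>u\<close> and \<open>u\<^sup>2\<close> in the numerator of the average of \<open>B\<close> as a function of bond \<open>e\<close>.\<close>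

definition bond_avg1 where
  "bond_avg1 N J e B = replica_avg N J (\<lambda>\<sigma> \<tau>. B \<sigma> \<tau> * (bond e \<sigma> + bond e \<tau>))"

definition bond_avg2 where
  "bond_avg2 N J e B = replica_avg N J (\<lambda>\<sigma> \<tau>. B \<sigma> \<tau> * (bond e \<sigma> * bond e \<tau>))"

lemma replica_avg_update_ratio:
  assumes e: "e \<in> edges N"
  shows "replica_avg N (J(e := y)) B = two_replica_ratio (bond_mean N (J(e := 0)) e)
    (replica_avg N (J(e := 0)) B) (bond_avg1 N (J(e := 0)) e B) (bond_avg2 N (J(e := 0)) e B)
    (tanh (y / sqrt (real N)))"
  unfolding replica_avg_update[OF e, of J y B] two_replica_ratio_def bond_avg1_def bond_avg2_def bond_mean_eq ..

lemma bond_mean_abs_le: "e \<in> edges N \<Longrightarrow> \<bar>bond_mean N J e\<bar> \<le> 1"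
  using replica_avg_abs_le[of N "\<lambda>\<sigma> \<tau>. bond e \<sigma>" "\<lambda>_ _. 1" J]
  by (simp add: bond_mean_eq replica_avg_const bond_abs)

lemma bond_avg1_abs_le:
  assumes "e \<in> edges N" "\<And>\<sigma> \<tau>. \<sigma> \<in> spins N \<Longrightarrow> \<tau> \<in> spins N \<Longrightarrow> \<bar>B \<sigma> \<tau>\<bar> \<le> D \<sigma> \<tau>"
  shows "\<bar>bond_avg1 N J e B\<bar> \<le> 2 * replica_avg N J D"
  unfolding bond_avg1_def replica_avg_cmult[symmetric]
proof (rule replica_avg_abs_le)
  fix \<sigma> \<tau> assume st: "\<sigma> \<in> spins N" "\<tau> \<in> spins N"
  have "\<bar>bond e \<sigma> + bond e \<tau>\<bar> \<le> 2" using bond_abs[OF assms(1) st(1)] bond_abs[OF assms(1) st(2)] by linarith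
  then have "\<bar>B \<sigma> \<tau> * (bond e \<sigma> + bond e \<tau>)\<bar> \<le> D \<sigma> \<tau> * 2"
    unfolding abs_mult using assms(2)[OF st] by (intro mult_mono) auto
  then show "\<bar>B \<sigma> \<tau> * (bond e \<sigma> + bond e \<tau>)\<bar> \<le> 2 * D \<sigma> \<tau>" by simp
qed

lemma bond_avg2_abs_le:
  assumes "e \<in> edges N" "\<And>\<sigma> \<tau>. \<sigma> \<in> spins N \<Longrightarrow> \<tau> \<in> spins N \<Longrightarrow> \<bar>B \<sigma> \<tau>\<bar> \<le> D \<sigma> \<tau>"
  shows "\<bar>bond_avg2 N J e B\<bar> \<le> replica_avg N J D"
  unfolding bond_avg2_def
  by (rule replica_avg_abs_le) (use assms bond_abs[OF assms(1)] in \<open>simp add: abs_mult\<close>)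

lemma measurable_gibbs_weight:
  assumes M: "\<And>e. sets (M e) = sets (borel :: real measure)"
  shows "(\<lambda>J. gibbs_weight N J \<sigma>) \<in> borel_measurable (PiM (edges N) M)"
proof -
  have c: "(\<lambda>J. J p) \<in> borel_measurable (PiM (edges N) M)" if "p \<in> edges N" for p
    using measurable_component_singleton[OF that, of M] by (simp add: measurable_cong_sets[OF refl M])
  have [measurable]: "(\<lambda>J. hamiltonian N J \<tau>) \<in> borel_measurable (PiM (edges N) M)" for \<tau>
    unfolding hamiltonian_def case_prod_beta
    by (intro borel_measurable_times borel_measurable_const borel_measurable_sum) (auto intro: c)
  show ?thesis unfolding gibbs_weight_def by measurable
qed

lemma measurable_replica_avg:
  assumes M: "\<And>e. sets (M e) = sets (borel :: real measure)"
  shows "(\<lambda>J. replica_avg N J B) \<in> borel_measurable (PiM (edges N) M)"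
proof -
  note [measurable] = measurable_gibbs_weight[OF M]
  show ?thesis unfolding replica_avg_def by measurable
qed

lemma replica_avg_bounded: "\<exists>C. \<forall>J. \<bar>replica_avg N J B\<bar> \<le> C"
proof (intro exI allI)
  fix J
  have "\<bar>B \<sigma> \<tau>\<bar> \<le> (\<Sum>\<sigma>\<in>spins N. \<Sum>\<tau>\<in>spins N. \<bar>B \<sigma> \<tau>\<bar>)" if "\<sigma> \<in> spins N" "\<tau> \<in> spins N" for \<sigma> \<tau>
  proof -
    have "\<bar>B \<sigma> \<tau>\<bar> \<le> (\<Sum>\<tau>\<in>spins N. \<bar>B \<sigma> \<tau>\<bar>)"
      using that finite_spins by (intro member_le_sum) auto
    also have "\<dots> \<le> (\<Sum>\<sigma>\<in>spins N. \<Sum>\<tau>\<in>spins N. \<bar>B \<sigma> \<tau>\<bar>)"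
      using that finite_spins by (intro member_le_sum[of \<sigma> _ "\<lambda>\<sigma>. \<Sum>\<tau>\<in>spins N. \<bar>B \<sigma> \<tau>\<bar>"]) (auto intro: sum_nonneg)
    finally show ?thesis .
  qed
  then show "\<bar>replica_avg N J B\<bar> \<le> (\<Sum>\<sigma>\<in>spins N. \<Sum>\<tau>\<in>spins N. \<bar>B \<sigma> \<tau>\<bar>)"
    using replica_avg_abs_le[of N B "\<lambda>_ _. \<Sum>\<sigma>\<in>spins N. \<Sum>\<tau>\<in>spins N. \<bar>B \<sigma> \<tau>\<bar>" J]
    by (simp add: replica_avg_const)
qed

locale two_bond_laws = G: bond_law \<gamma> + V: bond_law \<nu> for \<gamma> \<nu> :: "real measure"
begin

text \<open>In the course of the exchange, \<open>T\<close> is the set of bonds that already have law \<open>\<nu>\<close>.\<close>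

definition mixed :: "(nat \<times> nat) set \<Rightarrow> nat \<times> nat \<Rightarrow> real measure" where
  "mixed T e = (if e \<in> T then \<nu> else \<gamma>)"

definition hybrid :: "nat \<Rightarrow> (nat \<times> nat) set \<Rightarrow> (nat \<times> nat \<Rightarrow> real) measure" where
  "hybrid N T = PiM (edges N) (mixed T)"

definition exp_moments :: real where
  "exp_moments = (\<integral>x. exp (5 * \<bar>x\<bar>) \<partial>\<gamma>) + (\<integral>x. exp (5 * \<bar>x\<bar>) \<partial>\<nu>)"

lemma exp_moments_nonneg: "0 \<le> exp_moments"
  unfolding exp_moments_def using G.exp_moment_nonneg V.exp_moment_nonneg by simp

lemma exp_moment_le: "(\<integral>x. exp (5 * \<bar>x\<bar>) \<partial>mixed T e) \<le> exp_moments"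
  unfolding exp_moments_def mixed_def using G.exp_moment_nonneg V.exp_moment_nonneg by simp

lemma bond_law_mixed: "bond_law (mixed T e)"
  unfolding mixed_def using G.bond_law_axioms V.bond_law_axioms by simp

lemma prob_space_mixed: "prob_space (mixed T e)"
  using bond_law_mixed bond_law.axioms(1) by blast

lemma sets_mixed: "sets (mixed T e) = sets borel"
  using bond_law_mixed bond_law.sets_bond by blast

lemma prob_space_hybrid: "prob_space (hybrid N T)"
  unfolding hybrid_def by (intro prob_space_PiM prob_space_mixed)

lemma hybrid_empty: "hybrid N {} = disorder \<gamma> N"
  by (simp add: hybrid_def disorder_def mixed_def[abs_def])

lemma hybrid_edges: "hybrid N (edges N) = disorder \<nu> N"
  unfolding hybrid_def disorder_def by (rule PiM_cong) (auto simp: mixed_def)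

lemma hybrid_measurable_replica_avg[measurable]:
  "(\<lambda>J. replica_avg N J B) \<in> borel_measurable (hybrid N T)"
  unfolding hybrid_def by (rule measurable_replica_avg) (rule sets_mixed)

lemma hybrid_split:
  fixes f :: "(nat \<times> nat \<Rightarrow> real) \<Rightarrow> real"
  assumes f: "f \<in> borel_measurable (hybrid N T)" and bd: "\<And>J. \<bar>f J\<bar> \<le> C" and e: "e \<in> edges N"
  shows "integrable (PiM (edges N - {e}) (mixed T)) (\<lambda>x. \<integral>y. f (x(e := y)) \<partial>mixed T e)"
    and "(\<integral>J. f J \<partial>hybrid N T) = (\<integral>x. (\<integral>y. f (x(e := y)) \<partial>mixed T e) \<partial>PiM (edges N - {e}) (mixed T))"
proof -
  interpret H: prob_space "hybrid N T" by (rule prob_space_hybrid)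
  interpret R: prob_space "PiM (edges N - {e}) (mixed T)" by (intro prob_space_PiM prob_space_mixed)
  interpret E: prob_space "mixed T e" by (rule prob_space_mixed)
  interpret P: product_prob_space "mixed T" "edges N" by (intro product_prob_spaceI prob_space_mixed)
  have ins: "insert e (edges N - {e}) = edges N" using e by blast
  have i: "integrable (PiM (insert e (edges N - {e})) (mixed T)) f"
    unfolding ins hybrid_def[symmetric] by (rule H.integrable_const_bound[of _ C]) (use bd f in auto)
  show "(\<integral>J. f J \<partial>hybrid N T) = (\<integral>x. (\<integral>y. f (x(e := y)) \<partial>mixed T e) \<partial>PiM (edges N - {e}) (mixed T))"
    using P.product_integral_insert[OF _ _ i] finite_edges by (simp add: ins hybrid_def insert_absorb[OF e])
  have "(\<lambda>(x, y). f (x(e := y))) \<in> borel_measurable (PiM (edges N - {e}) (mixed T) \<Otimes>\<^sub>M mixed T e)"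
    using measurable_compose[OF measurable_add_dim[of e "edges N - {e}" "mixed T"], of f borel] f
    by (simp add: ins hybrid_def case_prod_beta' insert_absorb[OF e])
  then have m: "(\<lambda>x. \<integral>y. f (x(e := y)) \<partial>mixed T e) \<in> borel_measurable (PiM (edges N - {e}) (mixed T))"
    by (rule E.borel_measurable_lebesgue_integral)
  have "0 \<le> C" using bd[of undefined] by linarith
  have "\<bar>\<integral>y. f (x(e := y)) \<partial>mixed T e\<bar> \<le> C" for x
  proof (cases "integrable (mixed T e) (\<lambda>y. f (x(e := y)))")
    case True
    have "\<bar>\<integral>y. f (x(e := y)) \<partial>mixed T e\<bar> \<le> (\<integral>y. C \<partial>mixed T e)"
      by (rule order_trans[OF integral_abs_bound integral_mono]) (use True bd in auto)
    then show ?thesis by (simp add: E.prob_space)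
  next
    case False
    then show ?thesis using \<open>0 \<le> C\<close> by (simp add: not_integrable_integral_eq)
  qed
  then show "integrable (PiM (edges N - {e}) (mixed T)) (\<lambda>x. \<integral>y. f (x(e := y)) \<partial>mixed T e)"
    using m by (intro R.integrable_const_bound[of _ C]) auto
qed

lemma hybrid_integrable:
  assumes f: "f \<in> borel_measurable (hybrid N T)" and bd: "\<And>J. \<bar>f J :: real\<bar> \<le> C"
  shows "integrable (hybrid N T) f"
proof -
  interpret H: prob_space "hybrid N T" by (rule prob_space_hybrid)
  show ?thesis by (rule H.integrable_const_bound[of _ C]) (use bd f in auto)
qed

lemma hybrid_integrable_replica_avg: "integrable (hybrid N T) (\<lambda>J. replica_avg N J B)"
  using replica_avg_bounded[of N B] by (auto intro: hybrid_integrable)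

lemma PiM_mixed_insert: "PiM (edges N - {e}) (mixed (insert e T)) = PiM (edges N - {e}) (mixed T)"
  by (rule PiM_cong) (auto simp: mixed_def)

lemma hybrid_measurable_cong: "f \<in> borel_measurable (hybrid N T) \<longleftrightarrow> f \<in> borel_measurable (hybrid N T')"
  by (rule arg_cong2[of _ _ _ _ "\<lambda>A B. A \<in> B", OF refl], rule measurable_cong_sets)
     (auto simp: hybrid_def sets_mixed intro!: sets_PiM_cong)

lemma bond_exchange:
  assumes h: "jet 4 D h" "h \<in> borel_measurable borel"
    and bd: "\<And>t. \<bar>h (tanh t)\<bar> \<le> D * exp (4 * \<bar>t\<bar>)" and N: "1 \<le> N"
  shows "\<bar>(\<integral>y. h (tanh (y / sqrt (real N))) \<partial>\<nu>) - (\<integral>y. h (tanh (y / sqrt (real N))) \<partial>\<gamma>)\<bar>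
      \<le> 1632 * exp_moments * D / (real N)\<^sup>2"
    and "\<bar>(\<integral>y. h (tanh (y / sqrt (real N))) \<partial>\<gamma>) - h 0\<bar> \<le> D / real N + 1632 * exp_moments * D / (real N)\<^sup>2"
proof -
  let ?E = "\<lambda>\<kappa>. \<integral>y. h (tanh (y / sqrt (real N))) \<partial>\<kappa>"
  let ?q = "\<lambda>\<kappa>. \<integral>y. exp (5 * \<bar>y\<bar>) \<partial>\<kappa>"
  from bond_expectation[OF h bd] obtain c where c: "\<bar>c\<bar> \<le> D"
    "\<And>\<kappa> N. bond_law \<kappa> \<Longrightarrow> 1 \<le> N \<Longrightarrow> \<bar>(\<integral>y. h (tanh (y / sqrt (real N))) \<partial>\<kappa>) - h 0 - c / real N\<bar>
      \<le> 1632 * (\<integral>y. exp (5 * \<bar>y\<bar>) \<partial>\<kappa>) * D / (real N)\<^sup>2" by blast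
  note g = c(2)[OF G.bond_law_axioms N] and v = c(2)[OF V.bond_law_axioms N]
  have exp_moments: "1632 * exp_moments * D / (real N)\<^sup>2 = 1632 * ?q \<nu> * D / (real N)\<^sup>2 + 1632 * ?q \<gamma> * D / (real N)\<^sup>2"
    unfolding exp_moments_def by (simp only: distrib_left distrib_right add_divide_distrib add.commute)
  show "\<bar>?E \<nu> - ?E \<gamma>\<bar> \<le> 1632 * exp_moments * D / (real N)\<^sup>2" unfolding exp_moments using g v by linarith
  have "\<bar>c / real N\<bar> \<le> D / real N" using c(1) by (simp add: abs_divide divide_right_mono)
  moreover have "0 \<le> 1632 * ?q \<nu> * D / (real N)\<^sup>2"
    using c(1) V.exp_moment_nonneg by (intro divide_nonneg_nonneg mult_nonneg_nonneg) auto
  ultimately show "\<bar>?E \<gamma> - h 0\<bar> \<le> D / real N + 1632 * exp_moments * D / (real N)\<^sup>2"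
    unfolding exp_moments using g by linarith
qed

text \<open>The constant of \<open>jet_ratio\<close> for \<open>n = 4\<close>, doubled because \<open>bond_avg1\<close> contains two bond variables.\<close>

definition ratio_bound :: real where "ratio_bound = 28 * 36 ^ 4 * 2"

text \<open>For a nonnegative observable all coefficients are at most a multiple of its average \<open>a\<close>, and \<open>a\<close> is at most
  twice the Gaussian expectation when \<open>N\<close> is large. The error is thus relative.\<close>

lemma one_bond_nonneg:
  assumes e: "e \<in> edges N" and N: "1 \<le> N" and large: "2 * (ratio_bound + 1632 * exp_moments * ratio_bound) \<le> real N"
    and B: "\<And>\<sigma> \<tau>. 0 \<le> B \<sigma> \<tau>"
  shows "(\<integral>y. replica_avg N (J(e := y)) B \<partial>\<nu>)
    \<le> (1 + 2 * 1632 * exp_moments * ratio_bound / (real N)\<^sup>2) * (\<integral>y. replica_avg N (J(e := y)) B \<partial>\<gamma>)"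
proof -
  define a where "a = replica_avg N (J(e := 0)) B"
  define h where "h = two_replica_ratio (bond_mean N (J(e := 0)) e) a
     (bond_avg1 N (J(e := 0)) e B) (bond_avg2 N (J(e := 0)) e B)"
  have a: "0 \<le> a" unfolding a_def by (rule replica_avg_nonneg) (rule B)
  have d: "\<bar>a\<bar> \<le> 2 * a" "\<bar>bond_avg1 N (J(e := 0)) e B\<bar> \<le> 2 * a" "\<bar>bond_avg2 N (J(e := 0)) e B\<bar> \<le> 2 * a"
    using bond_avg1_abs_le[OF e, of B B "J(e := 0)"] bond_avg2_abs_le[OF e, of B B "J(e := 0)"] B a
    by (simp_all add: a_def)
  note m = bond_mean_abs_le[OF e, of "J(e := 0)"]
  have j: "jet 4 (ratio_bound * a) h"
    using jet_ratio[OF m d, of 4] by (simp add: h_def ratio_bound_def mult_ac)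
  have hm: "h \<in> borel_measurable borel" unfolding h_def two_replica_ratio_def[abs_def] by measurable
  have "3 * (2 * a) \<le> ratio_bound * a" using a by (simp add: ratio_bound_def mult_right_mono)
  then have bd: "\<bar>h (tanh t)\<bar> \<le> ratio_bound * a * exp (4 * \<bar>t\<bar>)" for t
    using ratio_tanh_bound[OF m d, of t] unfolding h_def
    by (elim order_trans) (intro mult_right_mono, auto)
  have h0: "h 0 = a" by (simp add: h_def two_replica_ratio_def)
  have eq: "replica_avg N (J(e := y)) B = h (tanh (y / sqrt (real N)))" for y
    unfolding replica_avg_update_ratio[OF e, of J y B] h_def a_def ..
  define R where "R = 1632 * exp_moments * (ratio_bound * a) / (real N)\<^sup>2"
  define g where "g = (\<integral>y. replica_avg N (J(e := y)) B \<partial>\<gamma>)"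
  define v where "v = (\<integral>y. replica_avg N (J(e := y)) B \<partial>\<nu>)"
  have K1a: "0 \<le> ratio_bound * a" using a by (simp add: ratio_bound_def)
  have vg: "\<bar>v - g\<bar> \<le> R" and "\<bar>g - a\<bar> \<le> ratio_bound * a / real N + R"
    unfolding v_def g_def eq R_def using bond_exchange[OF j hm bd N, unfolded h0] .
  moreover have "R \<le> 1632 * exp_moments * (ratio_bound * a) / real N"
    unfolding R_def using N exp_moments_nonneg K1a
    by (intro divide_left_mono) (auto simp: power2_eq_square)
  moreover have "ratio_bound * a / real N + 1632 * exp_moments * (ratio_bound * a) / real N \<le> a / 2"
  proof -
    have "ratio_bound * a / real N + 1632 * exp_moments * (ratio_bound * a) / real N = a * (ratio_bound + 1632 * exp_moments * ratio_bound) / real N"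
      by (simp add: algebra_simps add_divide_distrib)
    also have "\<dots> \<le> a * (real N / 2) / real N"
      using large a by (intro divide_right_mono mult_left_mono) auto
    finally show ?thesis using N by simp
  qed
  ultimately have "a / 2 \<le> g" by linarith
  then have "R \<le> 2 * 1632 * exp_moments * ratio_bound / (real N)\<^sup>2 * g"
  proof -
    have "R = 2 * 1632 * exp_moments * ratio_bound / (real N)\<^sup>2 * (a / 2)" by (simp add: R_def)
    also have "\<dots> \<le> 2 * 1632 * exp_moments * ratio_bound / (real N)\<^sup>2 * g"
      using \<open>a / 2 \<le> g\<close> exp_moments_nonneg by (intro mult_left_mono) (auto simp: ratio_bound_def)
    finally show ?thesis .
  qed
  then have "v \<le> g + 2 * 1632 * exp_moments * ratio_bound / (real N)\<^sup>2 * g" using vg by linarith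
  then show ?thesis by (simp add: g_def[symmetric] v_def[symmetric] algebra_simps)
qed

lemma hybrid_insert_nonneg:
  assumes e: "e \<in> edges N" "e \<notin> T" and N: "1 \<le> N" and large: "2 * (ratio_bound + 1632 * exp_moments * ratio_bound) \<le> real N"
    and B: "\<And>\<sigma> \<tau>. 0 \<le> B \<sigma> \<tau>"
  shows "(\<integral>J. replica_avg N J B \<partial>hybrid N (insert e T))
    \<le> (1 + 2 * 1632 * exp_moments * ratio_bound / (real N)\<^sup>2) * (\<integral>J. replica_avg N J B \<partial>hybrid N T)"
proof -
  obtain C where C: "\<And>J. \<bar>replica_avg N J B\<bar> \<le> C" using replica_avg_bounded by blast
  note s1 = hybrid_split[OF hybrid_measurable_replica_avg C e(1), of T]
  note s2 = hybrid_split[OF hybrid_measurable_replica_avg C e(1), of "insert e T"]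
  have m: "mixed T e = \<gamma>" "mixed (insert e T) e = \<nu>" using e by (auto simp: mixed_def)
  have "(\<integral>x. (\<integral>y. replica_avg N (x(e := y)) B \<partial>\<nu>) \<partial>PiM (edges N - {e}) (mixed T))
      \<le> (\<integral>x. (1 + 2 * 1632 * exp_moments * ratio_bound / (real N)\<^sup>2)
        * (\<integral>y. replica_avg N (x(e := y)) B \<partial>\<gamma>) \<partial>PiM (edges N - {e}) (mixed T))"
    using s1(1) s2(1) unfolding m PiM_mixed_insert
    by (intro integral_mono one_bond_nonneg[OF e(1) N large B] integrable_mult_right)
  then show ?thesis
    unfolding s1(2) s2(2) m PiM_mixed_insert integral_mult_right_zero .
qed

text \<open>At most \<open>N\<^sup>2\<close> exchanges, each costing a factor \<open>1 + K / N\<^sup>2\<close>, cost at most the factor \<open>exp K\<close>.\<close>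

lemma moment_transfer:
  "\<exists>C N0. 1 \<le> N0 \<and> 1 \<le> C \<and> (\<forall>N\<ge>N0. \<forall>T\<subseteq>edges N. \<forall>B. (\<forall>\<sigma> \<tau>. 0 \<le> B \<sigma> \<tau>) \<longrightarrow>
    (\<integral>J. replica_avg N J B \<partial>hybrid N T) \<le> C * (\<integral>J. replica_avg N J B \<partial>disorder \<gamma> N))"
proof -
  define K where "K = 2 * 1632 * exp_moments * ratio_bound"
  have K: "0 \<le> K" using exp_moments_nonneg by (simp add: K_def ratio_bound_def)
  obtain N0 :: nat where N0: "2 * (ratio_bound + 1632 * exp_moments * ratio_bound) \<le> real N0" using real_arch_simple by blast
  have "(\<integral>J. replica_avg N J B \<partial>hybrid N T) \<le> exp K * (\<integral>J. replica_avg N J B \<partial>disorder \<gamma> N)"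
    if N: "max 1 N0 \<le> N" and T: "T \<subseteq> edges N" and B: "\<And>\<sigma> \<tau>. 0 \<le> B \<sigma> \<tau>" for N T B
  proof -
    have large: "2 * (ratio_bound + 1632 * exp_moments * ratio_bound) \<le> real N" and N1: "1 \<le> N" using N N0 by auto
    have g: "0 \<le> (\<integral>J. replica_avg N J B \<partial>disorder \<gamma> N)"
      by (intro Bochner_Integration.integral_nonneg replica_avg_nonneg B)
    have "finite T" using T finite_edges finite_subset by blast
    then have "(\<integral>J. replica_avg N J B \<partial>hybrid N T)
        \<le> (1 + K / (real N)\<^sup>2) ^ card T * (\<integral>J. replica_avg N J B \<partial>disorder \<gamma> N)" using T
    proof (induction T)
      case empty
      then show ?case by (simp add: hybrid_empty)
    next
      case (insert e T)
      have "(\<integral>J. replica_avg N J B \<partial>hybrid N (insert e T))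
          \<le> (1 + K / (real N)\<^sup>2) * (\<integral>J. replica_avg N J B \<partial>hybrid N T)"
        unfolding K_def using insert by (intro hybrid_insert_nonneg N1 large B) auto
      also have "\<dots> \<le> (1 + K / (real N)\<^sup>2)
          * ((1 + K / (real N)\<^sup>2) ^ card T * (\<integral>J. replica_avg N J B \<partial>disorder \<gamma> N))"
        using insert K by (intro mult_left_mono) auto
      finally show ?case using insert by (simp add: mult_ac)
    qed
    also have "(1 + K / (real N)\<^sup>2) ^ card T \<le> exp K"
    proof -
      have "card T \<le> N\<^sup>2" using card_mono[OF finite_edges T] card_edges_le[of N] by simp
      then have "(1 + K / (real N)\<^sup>2) ^ card T \<le> (1 + K / (real N)\<^sup>2) ^ (N\<^sup>2)"
        using K by (intro power_increasing) auto
      also have "\<dots> \<le> exp (K / (real N)\<^sup>2) ^ (N\<^sup>2)"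
        using K by (intro power_mono) (auto simp: exp_ge_add_one_self)
      also have "\<dots> = exp K" using N1 by (simp flip: exp_of_nat_mult)
      finally show ?thesis .
    qed
    finally show ?thesis using g by (simp add: mult_right_mono)
  qed
  then show ?thesis using K by (intro exI[of _ "exp K"] exI[of _ "max 1 N0"]) auto
qed

end

section \<open>Bounded observables and the greedy order of exchange\<close>

lemma abs_power_diff_le:
  fixes x a L :: real
  assumes "0 \<le> x" "x \<le> L" "0 \<le> a" "a \<le> L" "1 \<le> L"
  shows "\<bar>x ^ k - a ^ k\<bar> \<le> real k * L ^ k * \<bar>x - a\<bar>"
proof (induction k)
  case (Suc k)
  have "x ^ Suc k - a ^ Suc k = x * (x ^ k - a ^ k) + a ^ k * (x - a)" by (simp add: algebra_simps)
  also have "\<bar>\<dots>\<bar> \<le> x * \<bar>x ^ k - a ^ k\<bar> + a ^ k * \<bar>x - a\<bar>"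
    using assms by (intro order_trans[OF abs_triangle_ineq]) (simp add: abs_mult)
  also have "\<dots> \<le> L * (real k * L ^ k * \<bar>x - a\<bar>) + L * L ^ k * \<bar>x - a\<bar>"
  proof (intro add_mono mult_mono Suc.IH mult_right_mono)
    have "a ^ k \<le> L ^ k" using assms by (intro power_mono) auto
    also have "\<dots> \<le> L * L ^ k" using assms by simp
    finally show "a ^ k \<le> L * L ^ k" .
  qed (use assms in auto)
  finally show ?case by (simp add: algebra_simps)
qed simp

text \<open>The costs are controlled only through their sum over \<open>e\<close> at a fixed \<open>T\<close>, whereas \<open>T\<close> grows along the
  exchange. If \<open>n\<close> elements are left then the cheapest of them costs at most \<open>S / n\<close>; always taking
  the cheapest one gives a harmonic sum.\<close>

lemma greedy_exchange:
  fixes \<Phi> :: "'a set \<Rightarrow> real"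
  assumes E: "finite E"
    and step: "\<And>T e. T \<subseteq> E \<Longrightarrow> e \<in> E - T \<Longrightarrow> \<bar>\<Phi> (insert e T) - \<Phi> T\<bar> \<le> g T e"
    and tot: "\<And>T. T \<subseteq> E \<Longrightarrow> (\<Sum>e\<in>E - T. g T e) \<le> S"
    and T: "T \<subseteq> E"
  shows "\<bar>\<Phi> E - \<Phi> T\<bar> \<le> S * harm (card (E - T))"
  using T
proof (induction "card (E - T)" arbitrary: T)
  case 0
  then have "T = E" using E by auto
  then show ?case by (simp add: harm_def)
next
  case (Suc n)
  have fin: "finite (E - T)" using E by blast
  have ne: "E - T \<noteq> {}" using Suc.hyps(2) by (metis card.empty nat.distinct(1))
  obtain e where e: "e \<in> E - T" "g T e \<le> S / real (Suc n)"
  proof -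
    have "\<exists>e\<in>E - T. g T e \<le> S / real (Suc n)"
    proof (rule ccontr)
      assume "\<not> ?thesis"
      then have "(\<Sum>e\<in>E - T. S / real (Suc n)) < (\<Sum>e\<in>E - T. g T e)"
        using fin ne by (intro sum_strict_mono) (auto simp: not_le simp del: of_nat_Suc)
      moreover have "(\<Sum>e\<in>E - T. S / real (Suc n)) = S" using Suc.hyps(2) by simp
      ultimately show False using tot[OF Suc.prems] by linarith
    qed
    then show thesis using that by blast
  qed
  have c: "n = card (E - insert e T)"
    using Suc.hyps(2) e(1) fin by (metis Diff_insert card_Diff_singleton diff_Suc_1)
  have "\<bar>\<Phi> E - \<Phi> (insert e T)\<bar> \<le> S * harm n"
    using Suc.hyps(1)[OF c] e(1) Suc.prems c by auto
  moreover have "\<bar>\<Phi> (insert e T) - \<Phi> T\<bar> \<le> S / real (Suc n)"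
    using step[OF Suc.prems e(1)] e(2) by linarith
  ultimately have "\<bar>\<Phi> E - \<Phi> T\<bar> \<le> S * harm n + S / real (Suc n)" by linarith
  then show ?case unfolding Suc.hyps(2)[symmetric] harm_Suc by (simp add: algebra_simps divide_inverse)
qed

definition influence where
  "influence N J e A = \<bar>bond_mean N J e\<bar> + \<bar>bond_avg1 N J e A\<bar> + \<bar>bond_avg2 N J e A\<bar>"

lemma sum_edges_abs_le:
  assumes "0 < \<eta>"
  shows "(\<Sum>e\<in>edges N. \<bar>z e\<bar>) \<le> (\<eta> * (real N)\<^sup>2 + (\<Sum>i = 1..N. \<Sum>j = 1..N. (z (i, j))\<^sup>2) / \<eta>) / (2::real)"
proof -
  have pt: "\<bar>x\<bar> \<le> (\<eta> + x\<^sup>2 / \<eta>) / 2" for x :: real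
  proof -
    have "0 \<le> (\<bar>x\<bar> - \<eta>)\<^sup>2 / \<eta>" using assms by simp
    also have "\<dots> = \<eta> + x\<^sup>2 / \<eta> - 2 * \<bar>x\<bar>" using assms by (simp add: power2_eq_square field_simps)
    finally show ?thesis by simp
  qed
  have "(\<Sum>e\<in>edges N. \<bar>z e\<bar>) \<le> (\<Sum>e\<in>{1..N} \<times> {1..N}. \<bar>z e\<bar>)"
    by (rule sum_mono2[OF _ edges_subset]) auto
  also have "\<dots> \<le> (\<Sum>e\<in>{1..N} \<times> {1..N}. (\<eta> + (z e)\<^sup>2 / \<eta>) / 2)"
    by (intro sum_mono pt)
  also have "\<dots> = (\<eta> * (real N)\<^sup>2 + (\<Sum>e\<in>{1..N} \<times> {1..N}. (z e)\<^sup>2) / \<eta>) / 2"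
    by (simp add: sum_divide_distrib[symmetric] sum.distrib power2_eq_square)
  also have "(\<Sum>e\<in>{1..N} \<times> {1..N}. (z e)\<^sup>2) = (\<Sum>i = 1..N. \<Sum>j = 1..N. (z (i, j))\<^sup>2)"
    by (simp add: sum.cartesian_product case_prod_beta')
  finally show ?thesis .
qed

text \<open>The influence is a sum of four families of averages of \<open>\<sigma>\<^sub>i \<sigma>\<^sub>j\<close>, or of \<open>\<sigma>\<^sub>i \<tau>\<^sub>i \<sigma>\<^sub>j \<tau>\<^sub>j\<close>, against weights
  dominated by \<open>L\<close> times the Gibbs weights. For each family the sum of squares is thus at most \<open>L\<^sup>2\<close> times the
  sum of \<open>\<langle>\<sigma>\<^sub>i \<sigma>\<^sub>j\<rangle>\<^sup>2\<close> or of \<open>\<langle>\<sigma>\<^sub>i \<sigma>\<^sub>j\<rangle>\<^sup>4\<close>, and both are at most \<open>N\<^sup>2 \<langle>R\<^sub>1\<^sub>2\<^sup>2\<rangle>\<close>. The parameter \<open>\<eta>\<close> balances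
  the arithmetic-geometric inequality that passes from squares to absolute values.\<close>

lemma sum_influence_le:
  assumes A: "\<And>\<sigma> \<tau>. 0 \<le> A \<sigma> \<tau>" "\<And>\<sigma> \<tau>. A \<sigma> \<tau> \<le> L" and L: "1 \<le> L" and \<eta>: "0 < \<eta>"
  shows "(\<Sum>e\<in>edges N. influence N J e A)
    \<le> 2 * (real N)\<^sup>2 * (\<eta> + L\<^sup>2 * replica_avg N J (\<lambda>\<sigma> \<tau>. (overlap N (\<sigma>, \<tau>))\<^sup>2) / \<eta>)"
proof -
  let ?g = "gibbs_weight N J"
  define r where "r = replica_avg N J (\<lambda>\<sigma> \<tau>. (overlap N (\<sigma>, \<tau>))\<^sup>2)"
  note g = gibbs_weight_nonneg[of N J]
  have r: "0 \<le> r" unfolding r_def by (intro replica_avg_nonneg) auto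
  have L2: "1 \<le> L\<^sup>2" using L by simp
  have bm: "(\<Sum>i = 1..N. \<Sum>j = 1..N. (bond_mean N J (i, j))\<^sup>2) = (real N)\<^sup>2 * r"
    unfolding r_def by (rule sum_bond_mean_power2)
  have one: "(\<Sum>i = 1..N. \<Sum>j = 1..N. (\<Sum>\<sigma>\<in>spins N. p \<sigma> * (\<sigma> i * \<sigma> j))\<^sup>2) \<le> L\<^sup>2 * ((real N)\<^sup>2 * r)"
    if "\<And>\<sigma>. \<sigma> \<in> spins N \<Longrightarrow> \<bar>p \<sigma>\<bar> \<le> L * ?g \<sigma>" for p
    using square_sum_domination[where Y = "spins N" and p = p and K = L and q = ?g and I = "{1..N}"
      and v = "\<lambda>i \<sigma>. \<sigma> i"] that
    unfolding bm[symmetric] by (simp add: bond_mean_def bond_def)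
  have p1: "\<bar>?g \<sigma> * (\<Sum>\<tau>\<in>spins N. ?g \<tau> * A' \<sigma> \<tau>)\<bar> \<le> L * ?g \<sigma>"
    if "\<And>\<sigma> \<tau>. 0 \<le> A' \<sigma> \<tau>" "\<And>\<sigma> \<tau>. A' \<sigma> \<tau> \<le> L" for \<sigma> A'
  proof -
    have "(\<Sum>\<tau>\<in>spins N. ?g \<tau> * A' \<sigma> \<tau>) \<le> (\<Sum>\<tau>\<in>spins N. ?g \<tau> * L)"
      by (intro sum_mono mult_left_mono that g)
    then have sL: "(\<Sum>\<tau>\<in>spins N. ?g \<tau> * A' \<sigma> \<tau>) \<le> L"
      by (simp add: sum_distrib_right[symmetric] sum_gibbs_weight)
    moreover have "0 \<le> (\<Sum>\<tau>\<in>spins N. ?g \<tau> * A' \<sigma> \<tau>)" by (intro sum_nonneg mult_nonneg_nonneg g that)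
    ultimately show ?thesis
      using g[of \<sigma>] mult_left_mono[OF sL g[of \<sigma>]] by (simp add: abs_mult mult.commute[of L])
  qed
  define z1 where "z1 e = (\<Sum>\<sigma>\<in>spins N. (?g \<sigma> * (\<Sum>\<tau>\<in>spins N. ?g \<tau> * A \<sigma> \<tau>)) * (\<sigma> (fst e) * \<sigma> (snd e)))" for e
  define z2 where "z2 e = (\<Sum>\<tau>\<in>spins N. (?g \<tau> * (\<Sum>\<sigma>\<in>spins N. ?g \<sigma> * A \<sigma> \<tau>)) * (\<tau> (fst e) * \<tau> (snd e)))" for e
  \<comment> \<open>One term for the spins of each replica, with the other replica averaged out.\<close>
  have b1: "bond_avg1 N J e A = z1 e + z2 e" for e
  proof -
    have "bond_avg1 N J e A = (\<Sum>\<sigma>\<in>spins N. \<Sum>\<tau>\<in>spins N. ?g \<sigma> * ?g \<tau> * A \<sigma> \<tau> * bond e \<sigma>)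
        + (\<Sum>\<sigma>\<in>spins N. \<Sum>\<tau>\<in>spins N. ?g \<sigma> * ?g \<tau> * A \<sigma> \<tau> * bond e \<tau>)"
      unfolding bond_avg1_def replica_avg_def
      by (simp add: sum.distrib[symmetric] distrib_left mult.assoc)
    also have "(\<Sum>\<sigma>\<in>spins N. \<Sum>\<tau>\<in>spins N. ?g \<sigma> * ?g \<tau> * A \<sigma> \<tau> * bond e \<sigma>) = z1 e"
      unfolding z1_def bond_def sum_distrib_left sum_distrib_right by (intro sum.cong refl) simp
    also have "(\<Sum>\<sigma>\<in>spins N. \<Sum>\<tau>\<in>spins N. ?g \<sigma> * ?g \<tau> * A \<sigma> \<tau> * bond e \<tau>) = z2 e"
      unfolding z2_def bond_def sum_distrib_left sum_distrib_right
      by (subst sum.swap, intro sum.cong refl) simp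
    finally show ?thesis .
  qed
  have s1: "(\<Sum>i = 1..N. \<Sum>j = 1..N. (z1 (i, j))\<^sup>2) \<le> L\<^sup>2 * ((real N)\<^sup>2 * r)"
    unfolding z1_def using one[OF p1[of A]] A by simp
  have s2: "(\<Sum>i = 1..N. \<Sum>j = 1..N. (z2 (i, j))\<^sup>2) \<le> L\<^sup>2 * ((real N)\<^sup>2 * r)"
    unfolding z2_def using one[OF p1[of "\<lambda>\<sigma> \<tau>. A \<tau> \<sigma>"]] A by simp
  have s3: "(\<Sum>i = 1..N. \<Sum>j = 1..N. (bond_avg2 N J (i, j) A)\<^sup>2) \<le> L\<^sup>2 * ((real N)\<^sup>2 * r)"
  proof -
    have e: "(\<Sum>y\<in>spins N \<times> spins N. (?g (fst y) * ?g (snd y) * B (fst y) (snd y))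
          * ((fst y i * snd y i) * (fst y j * snd y j)))
        = replica_avg N J (\<lambda>\<sigma> \<tau>. B \<sigma> \<tau> * (bond (i, j) \<sigma> * bond (i, j) \<tau>))" for B i j
      by (simp add: replica_avg_def sum.cartesian_product case_prod_beta' bond_def mult_ac)
    have q: "replica_avg N J (\<lambda>\<sigma> \<tau>. 1 * (bond (i, j) \<sigma> * bond (i, j) \<tau>)) = (bond_mean N J (i, j))\<^sup>2" for i j
      by (simp add: replica_avg_def bond_mean_def power2_eq_square sum_product mult_ac)
    have "(\<Sum>i = 1..N. \<Sum>j = 1..N. (bond_avg2 N J (i, j) A)\<^sup>2)
        \<le> L\<^sup>2 * (\<Sum>i = 1..N. \<Sum>j = 1..N. ((bond_mean N J (i, j))\<^sup>2)\<^sup>2)"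
      unfolding bond_avg2_def q[symmetric] e[symmetric]
      by (rule square_sum_domination) (use A g in \<open>auto simp: abs_mult mult.commute[of L] intro!: mult_left_mono\<close>)
    also have "\<dots> \<le> L\<^sup>2 * (\<Sum>i = 1..N. \<Sum>j = 1..N. (bond_mean N J (i, j))\<^sup>2)"
    proof (intro mult_left_mono sum_mono)
      fix i j assume ij: "i \<in> {1..N}" "j \<in> {1..N}"
      have "\<bar>bond_mean N J (i, j)\<bar> \<le> (\<Sum>\<sigma>\<in>spins N. ?g \<sigma>)"
        unfolding bond_mean_def
        by (rule order_trans[OF sum_abs sum_mono])
           (use ij g spins_abs in \<open>auto simp: abs_mult bond_def\<close>)
      then have "(bond_mean N J (i, j))\<^sup>2 \<le> 1" by (simp add: sum_gibbs_weight abs_square_le_1)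
      then show "((bond_mean N J (i, j))\<^sup>2)\<^sup>2 \<le> (bond_mean N J (i, j))\<^sup>2"
        using mult_left_le[of "(bond_mean N J (i, j))\<^sup>2" "(bond_mean N J (i, j))\<^sup>2"]
        unfolding power2_eq_square[of "(bond_mean N J (i, j))\<^sup>2"] by simp
    qed auto
    finally show ?thesis unfolding bm .
  qed
  define X where "X = (\<eta> * (real N)\<^sup>2 + L\<^sup>2 * ((real N)\<^sup>2 * r) / \<eta>) / 2"
  have AG: "(\<Sum>e\<in>edges N. \<bar>z e\<bar>) \<le> X"
    if "(\<Sum>i = 1..N. \<Sum>j = 1..N. (z (i, j))\<^sup>2) \<le> L\<^sup>2 * ((real N)\<^sup>2 * r)" for z
    unfolding X_def
    by (rule order_trans[OF sum_edges_abs_le[OF \<eta>]])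
       (use that \<eta> in \<open>intro divide_right_mono add_left_mono, auto\<close>)
  have s0: "(\<Sum>i = 1..N. \<Sum>j = 1..N. (bond_mean N J (i, j))\<^sup>2) \<le> L\<^sup>2 * ((real N)\<^sup>2 * r)"
    unfolding bm using mult_right_mono[OF L2, of "(real N)\<^sup>2 * r"] r by simp
  have "(\<Sum>e\<in>edges N. influence N J e A)
      \<le> (\<Sum>e\<in>edges N. \<bar>bond_mean N J e\<bar> + (\<bar>z1 e\<bar> + \<bar>z2 e\<bar>) + \<bar>bond_avg2 N J e A\<bar>)"
    by (intro sum_mono) (simp add: influence_def b1 abs_triangle_ineq)
  also have "\<dots> = (\<Sum>e\<in>edges N. \<bar>bond_mean N J e\<bar>) + ((\<Sum>e\<in>edges N. \<bar>z1 e\<bar>) + (\<Sum>e\<in>edges N. \<bar>z2 e\<bar>))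
      + (\<Sum>e\<in>edges N. \<bar>bond_avg2 N J e A\<bar>)"
    by (simp add: sum.distrib)
  also have "\<dots> \<le> X + (X + X) + X"
    by (intro add_mono AG s0 s1 s2 s3)
  also have "\<dots> = 2 * (real N)\<^sup>2 * (\<eta> + L\<^sup>2 * r / \<eta>)"
    by (simp add: X_def field_simps)
  finally show ?thesis unfolding r_def .
qed

context two_bond_laws
begin

lemma measurable_replica_avg_update:
  assumes "e \<in> edges N"
  shows "(\<lambda>y. replica_avg N (J(e := y)) B) \<in> borel_measurable borel"
proof -
  have [measurable]: "(tanh :: real \<Rightarrow> real) \<in> borel_measurable borel"
    by (intro borel_measurable_continuous_onI continuous_intros) (simp add: cosh_real_nonzero)
  show ?thesis
    by (subst replica_avg_update_ratio[OF assms, abs_def]) (unfold two_replica_ratio_def, measurable)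
qed

text \<open>The constant of \<open>jet_power_deviation\<close> for \<open>n = 4\<close> and a deviation \<open>2 L\<close>, plus one for values of \<open>u\<close> outside the range
  of the expansion.\<close>

definition power_bound :: "nat \<Rightarrow> real \<Rightarrow> real" where
  "power_bound k L = 2 * (real k * 6 ^ 4 * (6 ^ 4 * (28 * 36 ^ 4 * (2 * L))) ^ k * (28 * 36 ^ 4 * (2 * L)))
    + 6 * real k * L ^ k * L"

lemma power_bound_nonneg: "1 \<le> L \<Longrightarrow> 0 \<le> power_bound k L"
  unfolding power_bound_def by (intro add_nonneg_nonneg mult_nonneg_nonneg zero_le_power) auto

text \<open>The average stays in \<open>[0, L]\<close>, and its deviation from the value \<open>a\<close> at \<open>J\<^sub>e = 0\<close> has coefficients proportional to the
  influence. Subtracting the constant \<open>a\<^sup>k\<close> leaves a function to which \<open>bond_exchange\<close> applies with a bound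
  proportional to the influence.\<close>

lemma one_bond_power:
  assumes e: "e \<in> edges N" and N: "1 \<le> N"
    and A: "\<And>\<sigma> \<tau>. 0 \<le> A \<sigma> \<tau>" "\<And>\<sigma> \<tau>. A \<sigma> \<tau> \<le> L" and L: "1 \<le> L"
  shows "\<bar>(\<integral>y. (replica_avg N (J(e := y)) A) ^ k \<partial>\<nu>) - (\<integral>y. (replica_avg N (J(e := y)) A) ^ k \<partial>\<gamma>)\<bar>
    \<le> 1632 * exp_moments * power_bound k L / (real N)\<^sup>2 * influence N (J(e := 0)) e A"
proof -
  define \<epsilon> where "\<epsilon> = influence N (J(e := 0)) e A"
  define a where "a = replica_avg N (J(e := 0)) A"
  define m where "m = bond_mean N (J(e := 0)) e"
  define d1 where "d1 = bond_avg1 N (J(e := 0)) e A"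
  define d2 where "d2 = bond_avg2 N (J(e := 0)) e A"
  define S where "S = two_replica_ratio m a d1 d2"
  define R where "R = two_replica_ratio m (d1 - 2 * a * m) (d2 - a * m\<^sup>2) 0"
  define h where "h u = S u ^ k - a ^ k" for u
  have avg: "0 \<le> replica_avg N J' A" "replica_avg N J' A \<le> L" for J'
    using replica_avg_mono[of N A "\<lambda>_ _. L" J'] A
    by (auto simp: replica_avg_const intro: replica_avg_nonneg)
  have a: "0 \<le> a" "a \<le> L" unfolding a_def by (rule avg)+
  have m: "\<bar>m\<bar> \<le> 1" unfolding m_def by (rule bond_mean_abs_le[OF e])
  have d: "\<bar>d1\<bar> \<le> 2 * L" "\<bar>d2\<bar> \<le> 2 * L"
    using bond_avg1_abs_le[OF e, of A "\<lambda>_ _. L" "J(e := 0)"] bond_avg2_abs_le[OF e, of A "\<lambda>_ _. L" "J(e := 0)"] A L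
    by (simp_all add: d1_def d2_def replica_avg_const)
  have \<epsilon>: "\<epsilon> = \<bar>m\<bar> + \<bar>d1\<bar> + \<bar>d2\<bar>"
    by (simp add: \<epsilon>_def influence_def m_def d1_def d2_def)
  have \<epsilon>0: "0 \<le> \<epsilon>" by (simp add: \<epsilon>)
  have am: "\<bar>a * m\<bar> \<le> L * \<bar>m\<bar>" unfolding abs_mult using a by (intro mult_right_mono) auto
  have L\<epsilon>: "L * \<epsilon> = L * \<bar>m\<bar> + L * \<bar>d1\<bar> + L * \<bar>d2\<bar>" by (simp add: \<epsilon> distrib_left)
  have Ld: "\<bar>d1\<bar> \<le> L * \<bar>d1\<bar>" "\<bar>d2\<bar> \<le> L * \<bar>d2\<bar>" "0 \<le> L * \<bar>m\<bar>"
    using L by (simp_all add: mult_le_cancel_right1)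
  have r1: "\<bar>d1 - 2 * a * m\<bar> \<le> 2 * L * \<epsilon>" using am Ld L\<epsilon> by linarith
  have r2: "\<bar>d2 - a * m\<^sup>2\<bar> \<le> 2 * L * \<epsilon>"
  proof -
    have "\<bar>a * m\<^sup>2\<bar> \<le> L * \<bar>m\<bar> * 1"
      using mult_mono[OF am m] a by (simp add: power2_eq_square abs_mult mult_ac)
    then show ?thesis using Ld L\<epsilon> by linarith
  qed
  have jS: "jet 4 (28 * 36 ^ 4 * (2 * L)) S"
    unfolding S_def using jet_ratio[OF m _ d, of a 4] a by simp
  have jR: "jet 4 (28 * 36 ^ 4 * (2 * L * \<epsilon>)) R"
    unfolding R_def using jet_ratio[OF m r1 r2, of 0 4] \<epsilon>0 L by simp
  have SR: "S u = a + u * R u" if "\<bar>u\<bar> < 1" for u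
    unfolding S_def R_def by (rule ratio_eq_add_ratio[OF m that])
  obtain f where f: "jet 4 (real k * 6 ^ 4 * (6 ^ 4 * (28 * 36 ^ 4 * (2 * L))) ^ k * (28 * 36 ^ 4 * (2 * L * \<epsilon>))) f"
    "\<And>u. \<bar>u\<bar> \<le> 1/2 \<Longrightarrow> S u ^ k = a ^ k + u * f u"
    using jet_power_deviation[OF jS jR, of a k] SR a L by (auto simp: abs_if)
  have jh: "jet 4 (power_bound k L * \<epsilon>) h"
  proof -
    have "jet 4 (power_bound k L * \<epsilon>) (\<lambda>u. u * f u)"
      by (rule jet_mono[OF jet_u_mult[OF f(1)]]) (use L \<epsilon>0 in \<open>simp add: power_bound_def algebra_simps\<close>)
    then show ?thesis
      by (subst jet_cong[of h "\<lambda>u. u * f u"]) (use f(2) in \<open>auto simp: h_def\<close>)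
  qed
  have eq: "replica_avg N (J(e := y)) A = S (tanh (y / sqrt (real N)))" for y
    unfolding replica_avg_update_ratio[OF e, of J y A] S_def m_def a_def d1_def d2_def ..
  have bd: "\<bar>h (tanh t)\<bar> \<le> power_bound k L * \<epsilon> * exp (4 * \<bar>t\<bar>)" for t
  proof -
    have u: "\<bar>tanh t\<bar> < 1" using tanh_real_bounds[of t] by auto
    have "S (tanh t) = replica_avg N (J(e := t * sqrt (real N))) A" using N by (simp add: eq)
    then have "0 \<le> S (tanh t)" "S (tanh t) \<le> L" using avg by simp_all
    then have "\<bar>h (tanh t)\<bar> \<le> real k * L ^ k * \<bar>S (tanh t) - a\<bar>"
      unfolding h_def using a L by (intro abs_power_diff_le) auto
    also have "\<bar>S (tanh t) - a\<bar> = \<bar>tanh t\<bar> * \<bar>R (tanh t)\<bar>"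
      unfolding SR[OF u] by (simp add: abs_mult)
    also have "\<dots> \<le> 1 * (3 * (2 * L * \<epsilon>) * exp (4 * \<bar>t\<bar>))"
      unfolding R_def using u \<epsilon>0 L by (intro mult_mono ratio_tanh_bound[OF m r1 r2]) auto
    finally have "\<bar>h (tanh t)\<bar> \<le> real k * L ^ k * (3 * (2 * L * \<epsilon>) * exp (4 * \<bar>t\<bar>))"
      using L by (simp add: mult_left_mono)
    also have "\<dots> = (6 * real k * L ^ k * L) * \<epsilon> * exp (4 * \<bar>t\<bar>)" by simp
    also have "\<dots> \<le> power_bound k L * \<epsilon> * exp (4 * \<bar>t\<bar>)"
      unfolding power_bound_def using \<epsilon>0 L by (intro mult_right_mono) auto
    finally show ?thesis .
  qed
  have hm: "h \<in> borel_measurable borel"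
    unfolding h_def[abs_def] S_def two_replica_ratio_def[abs_def] by measurable
  have ih: "(\<integral>y. h (tanh (y / sqrt (real N))) \<partial>\<kappa>) = (\<integral>y. (replica_avg N (J(e := y)) A) ^ k \<partial>\<kappa>) - a ^ k"
    if "bond_law \<kappa>" for \<kappa>
  proof -
    interpret K: bond_law \<kappa> by fact
    note [measurable] = measurable_replica_avg_update[OF e]
    have "integrable \<kappa> (\<lambda>y. (replica_avg N (J(e := y)) A) ^ k)"
      by (rule K.integrable_const_bound[of _ "L ^ k"]) (use avg in \<open>auto intro: power_mono\<close>)
    then show ?thesis by (simp add: h_def eq[symmetric] K.prob_space)
  qed
  show ?thesis
    using bond_exchange(1)[OF jh hm bd N] unfolding ih[OF G.bond_law_axioms] ih[OF V.bond_law_axioms]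
    by (simp add: \<epsilon>_def)
qed

text \<open>The deviation from \<open>J\<^sub>e = 0\<close> is \<open>u\<close> times a ratio with coefficients at most \<open>4 b\<close>, and \<open>12 = 3 * 4\<close>.\<close>

lemma replica_avg_update_diff:
  assumes e: "e \<in> edges N" and N: "1 \<le> N"
    and B: "\<And>\<sigma> \<tau>. \<sigma> \<in> spins N \<Longrightarrow> \<tau> \<in> spins N \<Longrightarrow> \<bar>B \<sigma> \<tau>\<bar> \<le> b"
  shows "\<bar>replica_avg N (J(e := y)) B - replica_avg N (J(e := 0)) B\<bar>
    \<le> 12 * b / sqrt (real N) * exp (5 * \<bar>y\<bar>)"
proof -
  define a where "a = replica_avg N (J(e := 0)) B"
  define m where "m = bond_mean N (J(e := 0)) e"
  define d1 where "d1 = bond_avg1 N (J(e := 0)) e B"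
  define d2 where "d2 = bond_avg2 N (J(e := 0)) e B"
  define t where "t = y / sqrt (real N)"
  have a: "\<bar>a\<bar> \<le> b" unfolding a_def
    using replica_avg_abs_le[of N B "\<lambda>_ _. b", OF B] by (simp add: replica_avg_const)
  have b: "0 \<le> b" using a by linarith
  have m: "\<bar>m\<bar> \<le> 1" unfolding m_def by (rule bond_mean_abs_le[OF e])
  have d: "\<bar>d1\<bar> \<le> 2 * b" "\<bar>d2\<bar> \<le> b"
    using bond_avg1_abs_le[OF e, of B "\<lambda>_ _. b" "J(e := 0)"] bond_avg2_abs_le[OF e, of B "\<lambda>_ _. b" "J(e := 0)"] B
    by (simp_all add: d1_def d2_def replica_avg_const)
  have am: "\<bar>a * m\<bar> \<le> b * 1" unfolding abs_mult using a m b by (intro mult_mono) auto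
  have am2: "\<bar>a * m\<^sup>2\<bar> \<le> b * 1" unfolding abs_mult using a m b
    by (intro mult_mono) (auto simp: abs_square_le_1)
  have r: "\<bar>d1 - 2 * a * m\<bar> \<le> 4 * b" "\<bar>d2 - a * m\<^sup>2\<bar> \<le> 4 * b" using d am am2 b by linarith+
  have u: "\<bar>tanh t\<bar> < 1" using tanh_real_bounds[of t] by auto
  have "replica_avg N (J(e := y)) B - a = tanh t * two_replica_ratio m (d1 - 2 * a * m) (d2 - a * m\<^sup>2) 0 (tanh t)"
    unfolding replica_avg_update_ratio[OF e, of J y B] t_def[symmetric] a_def[symmetric] m_def[symmetric]
      d1_def[symmetric] d2_def[symmetric] ratio_eq_add_ratio[OF m u, of a d1 d2] by simp
  also have "\<bar>\<dots>\<bar> \<le> \<bar>t\<bar> * (3 * (4 * b) * exp (4 * \<bar>t\<bar>))"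
    unfolding abs_mult using tanh_abs_le[of t] b
    by (intro mult_mono ratio_tanh_bound[OF m r]) auto
  also have "\<dots> \<le> (\<bar>y\<bar> / sqrt (real N)) * (3 * (4 * b) * exp (4 * \<bar>y\<bar>))"
  proof (intro mult_mono)
    have "\<bar>t\<bar> \<le> \<bar>y\<bar>" using N by (simp add: t_def abs_divide divide_le_eq mult_le_cancel_left1)
    then show "exp (4 * \<bar>t\<bar>) \<le> exp (4 * \<bar>y\<bar>)" by simp
  qed (use b in \<open>auto simp: t_def\<close>)
  also have "\<dots> = 12 * b / sqrt (real N) * exp (4 * \<bar>y\<bar>) * \<bar>y\<bar>" by simp
  also have "\<dots> \<le> 12 * b / sqrt (real N) * exp (4 * \<bar>y\<bar>) * exp \<bar>y\<bar>"
  proof (intro mult_left_mono)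
    show "\<bar>y\<bar> \<le> exp \<bar>y\<bar>" using exp_ge_add_one_self[of "\<bar>y\<bar>"] by linarith
  qed (use b in auto)
  also have "\<dots> = 12 * b / sqrt (real N) * exp (5 * \<bar>y\<bar>)" by (simp flip: exp_add)
  finally show ?thesis by (simp add: a_def)
qed

text \<open>The exchange of a bond involves its influence at \<open>J\<^sub>e = 0\<close>, while sums over bonds are controlled at the actual
  disorder. The difference is of order \<open>N\<^sup>-\<^sup>1\<^sup>/\<^sup>2\<close>.\<close>

lemma influence_update:
  assumes e: "e \<in> edges N" and N: "1 \<le> N"
    and A: "\<And>\<sigma> \<tau>. 0 \<le> A \<sigma> \<tau>" "\<And>\<sigma> \<tau>. A \<sigma> \<tau> \<le> L" and L: "1 \<le> L"
  shows "influence N (J(e := 0)) e A \<le> influence N (J(e := y)) e A + 48 * L / sqrt (real N) * exp (5 * \<bar>y\<bar>)"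
proof -
  define E where "E = 12 * L / sqrt (real N) * exp (5 * \<bar>y\<bar>)"
  have x: "\<bar>bond e \<sigma>\<bar> \<le> 1" if "\<sigma> \<in> spins N" for \<sigma> using bond_abs[OF e that] by simp
  have "\<bar>bond_mean N (J(e := y)) e - bond_mean N (J(e := 0)) e\<bar> \<le> 12 * 1 / sqrt (real N) * exp (5 * \<bar>y\<bar>)"
    unfolding bond_mean_eq by (rule replica_avg_update_diff[OF e N]) (rule x)
  also have "\<dots> \<le> E" unfolding E_def using L by (intro mult_right_mono divide_right_mono) auto
  finally have 1: "\<bar>bond_mean N (J(e := y)) e - bond_mean N (J(e := 0)) e\<bar> \<le> E" .
  have "\<bar>bond_avg1 N (J(e := y)) e A - bond_avg1 N (J(e := 0)) e A\<bar> \<le> 12 * (L * 2) / sqrt (real N) * exp (5 * \<bar>y\<bar>)"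
    unfolding bond_avg1_def
  proof (rule replica_avg_update_diff[OF e N])
    fix \<sigma> \<tau> assume st: "\<sigma> \<in> spins N" "\<tau> \<in> spins N"
    have "\<bar>bond e \<sigma> + bond e \<tau>\<bar> \<le> 2" using x[OF st(1)] x[OF st(2)] by linarith
    then show "\<bar>A \<sigma> \<tau> * (bond e \<sigma> + bond e \<tau>)\<bar> \<le> L * 2"
      unfolding abs_mult using A L by (intro mult_mono) auto
  qed
  then have 2: "\<bar>bond_avg1 N (J(e := y)) e A - bond_avg1 N (J(e := 0)) e A\<bar> \<le> 2 * E" by (simp add: E_def)
  have "\<bar>bond_avg2 N (J(e := y)) e A - bond_avg2 N (J(e := 0)) e A\<bar> \<le> 12 * (L * 1) / sqrt (real N) * exp (5 * \<bar>y\<bar>)"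
    unfolding bond_avg2_def
  proof (rule replica_avg_update_diff[OF e N])
    fix \<sigma> \<tau> assume st: "\<sigma> \<in> spins N" "\<tau> \<in> spins N"
    have "\<bar>bond e \<sigma> * bond e \<tau>\<bar> \<le> 1" using bond_abs[OF e st(1)] bond_abs[OF e st(2)] by (simp add: abs_mult)
    then show "\<bar>A \<sigma> \<tau> * (bond e \<sigma> * bond e \<tau>)\<bar> \<le> L * 1"
      unfolding abs_mult[of "A \<sigma> \<tau>"] using A L by (intro mult_mono) auto
  qed
  then have 3: "\<bar>bond_avg2 N (J(e := y)) e A - bond_avg2 N (J(e := 0)) e A\<bar> \<le> E" by (simp add: E_def)
  have "influence N (J(e := 0)) e A \<le> influence N (J(e := y)) e A + 4 * E"
    unfolding influence_def using 1 2 3 by linarith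
  then show ?thesis by (simp add: E_def)
qed

lemma measurable_influence[measurable]: "(\<lambda>J. influence N J e A) \<in> borel_measurable (hybrid N T)"
  unfolding influence_def bond_mean_eq bond_avg1_def bond_avg2_def by measurable

lemma influence_bounded: "\<exists>C. \<forall>J. \<bar>influence N J e A\<bar> \<le> C"
proof -
  obtain C1 where C1: "\<And>J. \<bar>bond_mean N J e\<bar> \<le> C1"
    unfolding bond_mean_eq using replica_avg_bounded by blast
  obtain C2 where C2: "\<And>J. \<bar>bond_avg1 N J e A\<bar> \<le> C2"
    unfolding bond_avg1_def using replica_avg_bounded by blast
  obtain C3 where C3: "\<And>J. \<bar>bond_avg2 N J e A\<bar> \<le> C3"
    unfolding bond_avg2_def using replica_avg_bounded by blast
  have "\<bar>influence N J e A\<bar> \<le> C1 + C2 + C3" for J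
    unfolding influence_def using C1[of J] C2[of J] C3[of J] by linarith
  then show ?thesis by blast
qed

lemma hybrid_insert_power:
  assumes e: "e \<in> edges N" "e \<notin> T" and N: "1 \<le> N"
    and A: "\<And>\<sigma> \<tau>. 0 \<le> A \<sigma> \<tau>" "\<And>\<sigma> \<tau>. A \<sigma> \<tau> \<le> L" and L: "1 \<le> L"
  shows "\<bar>(\<integral>J. (replica_avg N J A) ^ k \<partial>hybrid N (insert e T)) - (\<integral>J. (replica_avg N J A) ^ k \<partial>hybrid N T)\<bar>
    \<le> 1632 * exp_moments * power_bound k L / (real N)\<^sup>2 * ((\<integral>J. influence N J e A \<partial>hybrid N T) + 48 * L * exp_moments / sqrt (real N))"
proof -
  define K where "K = 1632 * exp_moments * power_bound k L / (real N)\<^sup>2"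
  have K: "0 \<le> K" unfolding K_def using exp_moments_nonneg power_bound_nonneg[OF L] by simp
  have avg: "0 \<le> replica_avg N J' A" "replica_avg N J' A \<le> L" for J'
    using replica_avg_mono[of N A "\<lambda>_ _. L" J'] A
    by (auto simp: replica_avg_const intro: replica_avg_nonneg)
  have b: "\<bar>(replica_avg N J' A) ^ k\<bar> \<le> L ^ k" for J' using avg[of J'] by (auto intro: power_mono)
  obtain C where C: "\<And>J. \<bar>influence N J e A\<bar> \<le> C" using influence_bounded by blast
  have m: "mixed T e = \<gamma>" "mixed (insert e T) e = \<nu>" using e by (auto simp: mixed_def)
  have pw: "(\<lambda>J. (replica_avg N J A) ^ k) \<in> borel_measurable (hybrid N T')" for T' by measurable
  let ?P = "PiM (edges N - {e}) (mixed T)"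
  interpret P: prob_space ?P by (intro prob_space_PiM prob_space_mixed)
  note s1 = hybrid_split[OF pw b e(1), of T, unfolded m]
  note s2 = hybrid_split[OF pw b e(1), of "insert e T", unfolded m PiM_mixed_insert]
  note s3 = hybrid_split[OF measurable_influence C e(1), of T, unfolded m]
  have pt: "influence N (x(e := 0)) e A \<le> (\<integral>y. influence N (x(e := y)) e A \<partial>\<gamma>) + 48 * L * exp_moments / sqrt (real N)" for x
  proof -
    note [measurable] = measurable_replica_avg_update[OF e(1)]
    have mi: "(\<lambda>y. influence N (x(e := y)) e A) \<in> borel_measurable borel"
      unfolding influence_def bond_mean_eq bond_avg1_def bond_avg2_def by measurable
    have ii: "integrable \<gamma> (\<lambda>y. influence N (x(e := y)) e A)"
      by (rule G.integrable_const_bound[of _ C]) (use C mi in auto)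
    have "influence N (x(e := 0)) e A = (\<integral>y. influence N (x(e := 0)) e A \<partial>\<gamma>)" by (simp add: G.prob_space)
    also have "\<dots> \<le> (\<integral>y. influence N (x(e := y)) e A + 48 * L / sqrt (real N) * exp (5 * \<bar>y\<bar>) \<partial>\<gamma>)"
      using ii G.exp_moment by (intro integral_mono influence_update[OF e(1) N A L]) auto
    also have "\<dots> = (\<integral>y. influence N (x(e := y)) e A \<partial>\<gamma>) + 48 * L / sqrt (real N) * (\<integral>y. exp (5 * \<bar>y\<bar>) \<partial>\<gamma>)"
      using ii G.exp_moment by simp
    also have "\<dots> \<le> (\<integral>y. influence N (x(e := y)) e A \<partial>\<gamma>) + 48 * L / sqrt (real N) * exp_moments"
      using exp_moment_le[of T e] L unfolding m by (intro add_left_mono mult_left_mono) auto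
    finally show ?thesis by simp
  qed
  have "\<bar>(\<integral>J. (replica_avg N J A) ^ k \<partial>hybrid N (insert e T)) - (\<integral>J. (replica_avg N J A) ^ k \<partial>hybrid N T)\<bar>
      = \<bar>\<integral>x. (\<integral>y. (replica_avg N (x(e := y)) A) ^ k \<partial>\<nu>) - (\<integral>y. (replica_avg N (x(e := y)) A) ^ k \<partial>\<gamma>) \<partial>?P\<bar>"
    unfolding s1(2) s2(2) using s1(1) s2(1) by simp
  also have "\<dots> \<le> (\<integral>x. K * ((\<integral>y. influence N (x(e := y)) e A \<partial>\<gamma>) + 48 * L * exp_moments / sqrt (real N)) \<partial>?P)"
  proof (rule order_trans[OF integral_abs_bound integral_mono])
    fix x
    show "\<bar>(\<integral>y. (replica_avg N (x(e := y)) A) ^ k \<partial>\<nu>) - (\<integral>y. (replica_avg N (x(e := y)) A) ^ k \<partial>\<gamma>)\<bar>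
        \<le> K * ((\<integral>y. influence N (x(e := y)) e A \<partial>\<gamma>) + 48 * L * exp_moments / sqrt (real N))"
    proof (rule order_trans)
      show "\<bar>(\<integral>y. (replica_avg N (x(e := y)) A) ^ k \<partial>\<nu>) - (\<integral>y. (replica_avg N (x(e := y)) A) ^ k \<partial>\<gamma>)\<bar>
          \<le> K * influence N (x(e := 0)) e A"
        unfolding K_def by (rule one_bond_power[OF e(1) N A L])
    qed (rule mult_left_mono[OF pt K])
  qed (use s1(1) s2(1) s3(1) in auto)
  also have "\<dots> = K * ((\<integral>J. influence N J e A \<partial>hybrid N T) + 48 * L * exp_moments / sqrt (real N))"
    unfolding s3(2) using s3(1) by (simp add: P.prob_space)
  finally show ?thesis unfolding K_def .
qed

end

lemma harm_le_1_plus_ln: "1 \<le> n \<Longrightarrow> harm n \<le> 1 + ln (real n)"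
proof -
  assume "1 \<le> n"
  then obtain m where m: "n = Suc m" by (cases n) auto
  have "harm (Suc m) - ln (real (Suc m)) \<le> harm (Suc 0) - ln (real (Suc 0))"
    using decseq_harm_diff_ln by (rule decseqD) simp
  then show ?thesis unfolding m by (simp add: harm_def)
qed

context two_bond_laws
begin

lemma power_universality_bound:
  assumes N: "1 \<le> N" and C: "0 \<le> C"
    and tr: "\<And>T. T \<subseteq> edges N \<Longrightarrow> (\<integral>J. replica_avg N J (\<lambda>\<sigma> \<tau>. (overlap N (\<sigma>, \<tau>))\<^sup>2) \<partial>hybrid N T) \<le> C"
    and A: "\<And>\<sigma> \<tau>. 0 \<le> A \<sigma> \<tau>" "\<And>\<sigma> \<tau>. A \<sigma> \<tau> \<le> L" and L: "1 \<le> L" and \<eta>: "0 < \<eta>"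
  shows "\<bar>(\<integral>J. (replica_avg N J A) ^ k \<partial>disorder \<nu> N) - (\<integral>J. (replica_avg N J A) ^ k \<partial>disorder \<gamma> N)\<bar>
    \<le> 1632 * exp_moments * power_bound k L * (2 * (\<eta> + L\<^sup>2 * C / \<eta>) + 48 * L * exp_moments / sqrt (real N)) * (1 + ln (real (N\<^sup>2)))"
proof -
  define K where "K = 1632 * exp_moments * power_bound k L / (real N)\<^sup>2"
  have K: "0 \<le> K" unfolding K_def using exp_moments_nonneg power_bound_nonneg[OF L] by simp
  define w where "w = 48 * L * exp_moments / sqrt (real N)"
  have w: "0 \<le> w" unfolding w_def using L exp_moments_nonneg by simp
  define S where "S = K * ((real N)\<^sup>2 * (2 * (\<eta> + L\<^sup>2 * C / \<eta>) + w))"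
  have S: "0 \<le> S" unfolding S_def using K w \<eta> C by (intro mult_nonneg_nonneg add_nonneg_nonneg) auto
  define r where "r J = replica_avg N J (\<lambda>\<sigma> \<tau>. (overlap N (\<sigma>, \<tau>))\<^sup>2)" for J
  have ii: "integrable (hybrid N T) (\<lambda>J. influence N J e A)" for T e
    using influence_bounded[of N e A] measurable_influence by (auto intro: hybrid_integrable)
  have ir: "integrable (hybrid N T) r" for T
    unfolding r_def[abs_def] by (rule hybrid_integrable_replica_avg)
  have tot: "(\<Sum>e\<in>edges N - T. K * ((\<integral>J. influence N J e A \<partial>hybrid N T) + w)) \<le> S" if T: "T \<subseteq> edges N" for T
  proof -
    interpret H: prob_space "hybrid N T" by (rule prob_space_hybrid)
    have nn: "0 \<le> (\<integral>J. influence N J e A \<partial>hybrid N T)" for e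
      by (intro Bochner_Integration.integral_nonneg) (simp add: influence_def)
    have "(\<Sum>e\<in>edges N - T. K * ((\<integral>J. influence N J e A \<partial>hybrid N T) + w))
        \<le> (\<Sum>e\<in>edges N. K * ((\<integral>J. influence N J e A \<partial>hybrid N T) + w))"
      using K w nn by (intro sum_mono2 finite_edges) auto
    also have "\<dots> = K * ((\<integral>J. (\<Sum>e\<in>edges N. influence N J e A) \<partial>hybrid N T) + real (card (edges N)) * w)"
      using ii by (simp add: sum_distrib_left[symmetric] sum.distrib)
    also have "\<dots> \<le> K * ((\<integral>J. 2 * (real N)\<^sup>2 * (\<eta> + L\<^sup>2 * r J / \<eta>) \<partial>hybrid N T) + (real N)\<^sup>2 * w)"
    proof (intro mult_left_mono add_mono integral_mono K)
      show "(\<Sum>e\<in>edges N. influence N J e A) \<le> 2 * (real N)\<^sup>2 * (\<eta> + L\<^sup>2 * r J / \<eta>)" for J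
        unfolding r_def by (rule sum_influence_le[OF A L \<eta>])
      show "real (card (edges N)) * w \<le> (real N)\<^sup>2 * w"
        using card_edges_le[of N] w by (intro mult_right_mono) (simp_all flip: of_nat_power)
    qed (use ii ir in auto)
    also have "(\<integral>J. 2 * (real N)\<^sup>2 * (\<eta> + L\<^sup>2 * r J / \<eta>) \<partial>hybrid N T)
        = 2 * (real N)\<^sup>2 * (\<eta> + L\<^sup>2 * (\<integral>J. r J \<partial>hybrid N T) / \<eta>)"
      using ir by (simp add: H.prob_space)
    also have "K * (2 * (real N)\<^sup>2 * (\<eta> + L\<^sup>2 * (\<integral>J. r J \<partial>hybrid N T) / \<eta>) + (real N)\<^sup>2 * w)
        \<le> K * (2 * (real N)\<^sup>2 * (\<eta> + L\<^sup>2 * C / \<eta>) + (real N)\<^sup>2 * w)"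
      using K \<eta> tr[OF T] unfolding r_def
      by (intro mult_left_mono add_right_mono add_left_mono divide_right_mono) auto
    also have "\<dots> = S" by (simp add: S_def algebra_simps)
    finally show ?thesis .
  qed
  have "\<bar>(\<integral>J. (replica_avg N J A) ^ k \<partial>hybrid N (edges N)) - (\<integral>J. (replica_avg N J A) ^ k \<partial>hybrid N {})\<bar>
      \<le> S * harm (card (edges N - {}))"
  proof (rule greedy_exchange[OF finite_edges _ tot])
    fix T e assume "T \<subseteq> edges N" "e \<in> edges N - T"
    then show "\<bar>(\<integral>J. (replica_avg N J A) ^ k \<partial>hybrid N (insert e T)) - (\<integral>J. (replica_avg N J A) ^ k \<partial>hybrid N T)\<bar>
        \<le> K * ((\<integral>J. influence N J e A \<partial>hybrid N T) + w)"
      unfolding K_def w_def by (intro hybrid_insert_power[OF _ _ N A L]) auto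
  qed auto
  also have "\<dots> \<le> S * (1 + ln (real (N\<^sup>2)))"
  proof (rule mult_left_mono[OF _ S])
    have "harm (card (edges N - {})) \<le> (harm (N\<^sup>2) :: real)"
      using card_edges_le[of N] by (intro harm_mono) simp
    also have "\<dots> \<le> 1 + ln (real (N\<^sup>2))" using N by (intro harm_le_1_plus_ln) simp
    finally show "harm (card (edges N - {})) \<le> 1 + ln (real (N\<^sup>2))" .
  qed
  also have "S = 1632 * exp_moments * power_bound k L * (2 * (\<eta> + L\<^sup>2 * C / \<eta>) + w)"
    using N by (simp add: S_def K_def)
  finally show ?thesis unfolding hybrid_edges hybrid_empty w_def .
qed

text \<open>The choice \<open>\<eta> = N\<^sup>-\<^sup>1\<^sup>/\<^sup>3\<close> balances \<open>\<eta>\<close> against \<open>\<langle>R\<^sub>1\<^sub>2\<^sup>2\<rangle> / \<eta>\<close>, as \<open>\<langle>R\<^sub>1\<^sub>2\<^sup>2\<rangle>\<close> has order \<open>N\<^sup>-\<^sup>2\<^sup>/\<^sup>3\<close>. The total error is of order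
  \<open>N\<^sup>-\<^sup>1\<^sup>/\<^sup>3 log N\<close>.\<close>

lemma power_universality:
  fixes A :: "nat \<Rightarrow> (nat \<Rightarrow> real) \<Rightarrow> (nat \<Rightarrow> real) \<Rightarrow> real"
  assumes A: "\<And>N \<sigma> \<tau>. 0 \<le> A N \<sigma> \<tau>" "\<And>N \<sigma> \<tau>. A N \<sigma> \<tau> \<le> L" and L: "1 \<le> L"
    and s: "eventually (\<lambda>N. (\<integral>J. replica_avg N J (\<lambda>\<sigma> \<tau>. (real N powr (1/3) * overlap N (\<sigma>, \<tau>))\<^sup>2) \<partial>disorder \<gamma> N) \<le> s) sequentially"
  shows "(\<lambda>N. (\<integral>J. (replica_avg N J (A N)) ^ k \<partial>disorder \<nu> N) - (\<integral>J. (replica_avg N J (A N)) ^ k \<partial>disorder \<gamma> N)) \<longlonglongrightarrow> 0"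
proof -
  obtain C N0 where C: "1 \<le> N0" "1 \<le> C" "\<And>N T B. N0 \<le> N \<Longrightarrow> T \<subseteq> edges N \<Longrightarrow> (\<And>\<sigma> \<tau>. 0 \<le> B \<sigma> \<tau>) \<Longrightarrow>
      (\<integral>J. replica_avg N J B \<partial>hybrid N T) \<le> C * (\<integral>J. replica_avg N J B \<partial>disorder \<gamma> N)"
    using moment_transfer by metis
  define s' where "s' = max s 0"
  define K where "K = 1632 * exp_moments * power_bound k L"
  define b where "b N = K * (2 * (real N powr (-1/3) + L\<^sup>2 * (C * (real N powr (-2/3) * s')) / real N powr (-1/3))
      + 48 * L * exp_moments / sqrt (real N)) * (1 + ln (real (N\<^sup>2)))" for N
  have lim: "b \<longlonglongrightarrow> 0" unfolding b_def by real_asymp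
  show ?thesis
  proof (rule Lim_null_comparison[OF _ lim])
    show "\<forall>\<^sub>F N in sequentially. norm ((\<integral>J. (replica_avg N J (A N)) ^ k \<partial>disorder \<nu> N)
        - (\<integral>J. (replica_avg N J (A N)) ^ k \<partial>disorder \<gamma> N)) \<le> b N"
      using s eventually_ge_at_top[of N0]
    proof eventually_elim
      case (elim N)
      have N: "1 \<le> N" using elim C by simp
      let ?r = "\<integral>J. replica_avg N J (\<lambda>\<sigma> \<tau>. (overlap N (\<sigma>, \<tau>))\<^sup>2) \<partial>disorder \<gamma> N"
      have p: "(real N powr (1/3))\<^sup>2 = real N powr (2/3)"
        using N by (simp add: power2_eq_square powr_add[symmetric])
      have "real N powr (2/3) * ?r \<le> s'"
        using elim(1) unfolding power_mult_distrib replica_avg_cmult p by (simp add: s'_def)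
      then have "real N powr (-2/3) * (real N powr (2/3) * ?r) \<le> real N powr (-2/3) * s'"
        by (intro mult_left_mono) auto
      then have r: "?r \<le> real N powr (-2/3) * s'"
        using N by (simp add: mult.assoc[symmetric] powr_add[symmetric])
      have "(\<integral>J. replica_avg N J (\<lambda>\<sigma> \<tau>. (overlap N (\<sigma>, \<tau>))\<^sup>2) \<partial>hybrid N T) \<le> C * (real N powr (-2/3) * s')"
        if "T \<subseteq> edges N" for T
        by (rule order_trans[OF C(3)[OF elim(2) that] mult_left_mono[OF r]]) (use C(2) in auto)
      then show ?case
        unfolding b_def K_def real_norm_def
        by (intro power_universality_bound[OF N _ _ A L]) (use C(2) N in \<open>auto simp: s'_def\<close>)
    qed
  qed
qed

lemma continuous_universality:
  fixes A :: "nat \<Rightarrow> (nat \<Rightarrow> real) \<Rightarrow> (nat \<Rightarrow> real) \<Rightarrow> real"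
    and f :: "real \<Rightarrow> real"
  assumes A: "\<And>N \<sigma> \<tau>. 0 \<le> A N \<sigma> \<tau>" "\<And>N \<sigma> \<tau>. A N \<sigma> \<tau> \<le> L" and L: "1 \<le> L"
    and s: "eventually (\<lambda>N. (\<integral>J. replica_avg N J (\<lambda>\<sigma> \<tau>. (real N powr (1/3) * overlap N (\<sigma>, \<tau>))\<^sup>2) \<partial>disorder \<gamma> N) \<le> s) sequentially"
    and f: "continuous_on UNIV f"
  shows "(\<lambda>N. (\<integral>J. f (replica_avg N J (A N)) \<partial>disorder \<nu> N) - (\<integral>J. f (replica_avg N J (A N)) \<partial>disorder \<gamma> N)) \<longlonglongrightarrow> 0"
proof (rule LIMSEQ_I)
  fix \<epsilon> :: real assume "0 < \<epsilon>"
  have avg: "0 \<le> replica_avg N J (A N)" "replica_avg N J (A N) \<le> L" for N J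
    using replica_avg_mono[of N "A N" "\<lambda>_ _. L" J] A
    by (auto simp: replica_avg_const intro: replica_avg_nonneg)
  obtain p where p: "real_polynomial_function p" "\<And>x. x \<in> {0..L} \<Longrightarrow> \<bar>f x - p x\<bar> < \<epsilon> / 4"
    using Stone_Weierstrass_real_polynomial_function[of "{0..L}" f "\<epsilon> / 4"]
      continuous_on_subset[OF f] \<open>0 < \<epsilon>\<close> by auto
  obtain a n where pe: "p = (\<lambda>x. \<Sum>i\<le>n. a i * x ^ i)"
    using p(1) unfolding real_polynomial_function_iff_sum by blast
  have pw: "integrable (hybrid N T) (\<lambda>J. (replica_avg N J (A N)) ^ i)" for N T i
    by (rule hybrid_integrable[of _ _ _ "L ^ i"]) (use avg in \<open>auto intro: power_mono\<close>)
  have pwd: "integrable (disorder \<nu> N) (\<lambda>J. (replica_avg N J (A N)) ^ i)"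
    "integrable (disorder \<gamma> N) (\<lambda>J. (replica_avg N J (A N)) ^ i)" for N i
    using pw[of N "edges N"] pw[of N "{}"] by (simp_all add: hybrid_edges hybrid_empty)
  obtain F where F: "\<And>x. x \<in> {0..L} \<Longrightarrow> \<bar>f x\<bar> \<le> F"
  proof -
    have "compact (f ` {0..L})"
      by (intro compact_continuous_image continuous_on_subset[OF f]) auto
    then obtain a where "\<forall>y\<in>f ` {0..L}. norm y \<le> a"
      using compact_imp_bounded bounded_iff by blast
    then show thesis by (intro that[of a]) auto
  qed
  have [measurable]: "f \<in> borel_measurable borel" by (rule borel_measurable_continuous_onI[OF f])
  have fi: "integrable (hybrid N T) (\<lambda>J. f (replica_avg N J (A N)))" for N T
    by (rule hybrid_integrable[of _ _ _ F]) (use F avg in auto)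
  have close: "\<bar>(\<integral>J. f (replica_avg N J (A N)) \<partial>hybrid N T) - (\<integral>J. p (replica_avg N J (A N)) \<partial>hybrid N T)\<bar> \<le> \<epsilon> / 4" for N T
  proof -
    interpret H: prob_space "hybrid N T" by (rule prob_space_hybrid)
    have ip: "integrable (hybrid N T) (\<lambda>J. p (replica_avg N J (A N)))"
      unfolding pe using pw by (intro Bochner_Integration.integrable_sum integrable_mult_right)
    have "\<bar>(\<integral>J. f (replica_avg N J (A N)) \<partial>hybrid N T) - (\<integral>J. p (replica_avg N J (A N)) \<partial>hybrid N T)\<bar>
        = \<bar>\<integral>J. f (replica_avg N J (A N)) - p (replica_avg N J (A N)) \<partial>hybrid N T\<bar>"
      using fi ip by simp
    also have "\<dots> \<le> (\<integral>J. \<epsilon> / 4 \<partial>hybrid N T)"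
    proof (rule order_trans[OF integral_abs_bound integral_mono])
      show "\<bar>f (replica_avg N J (A N)) - p (replica_avg N J (A N))\<bar> \<le> \<epsilon> / 4" for J
        using p(2)[of "replica_avg N J (A N)"] avg[of N J] by auto
    qed (use fi ip in auto)
    finally show ?thesis by (simp add: H.prob_space)
  qed
  have "(\<lambda>N. \<Sum>i\<le>n. a i * ((\<integral>J. (replica_avg N J (A N)) ^ i \<partial>disorder \<nu> N)
      - (\<integral>J. (replica_avg N J (A N)) ^ i \<partial>disorder \<gamma> N))) \<longlonglongrightarrow> (\<Sum>i\<le>n. a i * 0)"
    by (intro tendsto_intros power_universality[OF A L s])
  moreover have "(\<Sum>i\<le>n. a i * ((\<integral>J. (replica_avg N J (A N)) ^ i \<partial>disorder \<nu> N)
      - (\<integral>J. (replica_avg N J (A N)) ^ i \<partial>disorder \<gamma> N)))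
      = (\<integral>J. p (replica_avg N J (A N)) \<partial>disorder \<nu> N) - (\<integral>J. p (replica_avg N J (A N)) \<partial>disorder \<gamma> N)" for N
    unfolding pe using pwd
    by (simp add: right_diff_distrib sum_subtractf)
  ultimately have "(\<lambda>N. (\<integral>J. p (replica_avg N J (A N)) \<partial>disorder \<nu> N)
      - (\<integral>J. p (replica_avg N J (A N)) \<partial>disorder \<gamma> N)) \<longlonglongrightarrow> 0" by simp
  from LIMSEQ_D[OF this, of "\<epsilon> / 2"] \<open>0 < \<epsilon>\<close> obtain n0 where n0: "\<And>N. n0 \<le> N \<Longrightarrow>
     \<bar>(\<integral>J. p (replica_avg N J (A N)) \<partial>disorder \<nu> N) - (\<integral>J. p (replica_avg N J (A N)) \<partial>disorder \<gamma> N)\<bar> < \<epsilon> / 2"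
    by auto
  show "\<exists>no. \<forall>N\<ge>no. norm ((\<integral>J. f (replica_avg N J (A N)) \<partial>disorder \<nu> N)
      - (\<integral>J. f (replica_avg N J (A N)) \<partial>disorder \<gamma> N) - 0) < \<epsilon>"
  proof (intro exI allI impI)
    fix N assume "n0 \<le> N"
    then show "norm ((\<integral>J. f (replica_avg N J (A N)) \<partial>disorder \<nu> N)
      - (\<integral>J. f (replica_avg N J (A N)) \<partial>disorder \<gamma> N) - 0) < \<epsilon>"
      using n0[of N] close[of N "edges N"] close[of N "{}"]
      unfolding hybrid_edges hybrid_empty real_norm_def by linarith
  qed
qed

end

section \<open>The Gaussian model in the Wasserstein space\<close>

lemma prob_space_two_replicas: "prob_space (two_replicas N J)"
proof -
  interpret G: prob_space "gibbs N J" by (rule prob_space_gibbs)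
  interpret GG: pair_prob_space "gibbs N J" "gibbs N J" ..
  show ?thesis unfolding two_replicas_def by (rule GG.P.prob_space_axioms)
qed

lemma overlap_measure_P2: "overlap_measure N J \<in> P2"
proof -
  note [measurable] = overlap_measurable[of N J]
  have "prob_space (overlap_measure N J)"
    unfolding overlap_measure_def by (rule prob_space.prob_space_distr[OF prob_space_two_replicas]) measurable
  moreover have "(\<integral>\<^sup>+ x. ennreal (x\<^sup>2) \<partial>overlap_measure N J)
      = ennreal (replica_avg N J (\<lambda>\<sigma> \<tau>. (real N powr (1/3) * overlap N (\<sigma>, \<tau>))\<^sup>2))"
    unfolding overlap_measure_def by (subst nn_integral_distr) (auto simp: nn_integral_two_replicas)
  ultimately show ?thesis by (simp add: P2_def overlap_measure_def)
qed

lemma emeasure_overlap_measure: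
  assumes [measurable]: "A \<in> sets borel"
  shows "emeasure (overlap_measure N J) A
    = ennreal (replica_avg N J (\<lambda>\<sigma> \<tau>. indicator A (real N powr (1/3) * overlap N (\<sigma>, \<tau>))))"
proof -
  note [measurable] = overlap_measurable[of N J]
  have "emeasure (overlap_measure N J) A = (\<integral>\<^sup>+ x. ennreal (indicator A x) \<partial>overlap_measure N J)"
    by (subst nn_integral_indicator[symmetric]) (auto simp: overlap_measure_def ennreal_indicator)
  also have "\<dots> = (\<integral>\<^sup>+ r. ennreal (indicator A (real N powr (1/3) * overlap N r)) \<partial>two_replicas N J)"
    unfolding overlap_measure_def by (subst nn_integral_distr) auto
  also have "\<dots> = ennreal (replica_avg N J (\<lambda>\<sigma> \<tau>. indicator A (real N powr (1/3) * overlap N (\<sigma>, \<tau>))))"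
    by (rule nn_integral_two_replicas) auto
  finally show ?thesis .
qed

text \<open>The coupling keeps the fraction \<open>1 - \<epsilon>\<close> of the first law on the diagonal and completes it, independently of
  the first coordinate, with what is missing from the second law. At most mass \<open>\<epsilon>\<close> leaves the diagonal, and it moves
  by at most \<open>2 N\<^sup>1\<^sup>/\<^sup>3\<close>.\<close>

lemma W2_overlap_measure_le:
  assumes \<epsilon>: "0 \<le> \<epsilon>" "\<epsilon> \<le> 1"
    and le: "\<And>\<sigma> \<tau>. \<sigma> \<in> spins N \<Longrightarrow> \<tau> \<in> spins N \<Longrightarrow>
      (1 - \<epsilon>) * (gibbs_weight N J \<sigma> * gibbs_weight N J \<tau>) \<le> gibbs_weight N J' \<sigma> * gibbs_weight N J' \<tau>"
  shows "W2 (overlap_measure N J) (overlap_measure N J') \<le> sqrt \<epsilon> * (2 * real N powr (1/3))"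
proof -
  define C where "C = spins N \<times> spins N"
  define f where "f = (\<lambda>z. real N powr (1/3) * overlap N z)"
  define w where "w z = gibbs_weight N J (fst z) * gibbs_weight N J (snd z)" for z
  define w' where "w' z = gibbs_weight N J' (fst z) * gibbs_weight N J' (snd z)" for z
  define c where "c v = (if fst v = snd v then (1 - \<epsilon>) * w (fst v) else 0)
    + w (fst v) * (w' (snd v) - (1 - \<epsilon>) * w (snd v))" for v
  have fin: "finite C" unfolding C_def using finite_spins by simp
  have avg: "replica_avg N J (\<lambda>\<sigma> \<tau>. B (\<sigma>, \<tau>)) = (\<Sum>z\<in>C. w z * B z)"
    "replica_avg N J' (\<lambda>\<sigma> \<tau>. B (\<sigma>, \<tau>)) = (\<Sum>z\<in>C. w' z * B z)" for B :: "_ \<Rightarrow> real"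
    by (simp_all add: replica_avg_def C_def w_def w'_def sum.cartesian_product case_prod_beta')
  have tot: "(\<Sum>z\<in>C. w z) = 1" "(\<Sum>z\<in>C. w' z) = 1"
    using avg(1)[of "\<lambda>_. 1"] avg(2)[of "\<lambda>_. 1"] by (simp_all add: replica_avg_const)
  have w: "0 \<le> w z" for z by (simp add: w_def gibbs_weight_nonneg)
  have off: "0 \<le> w' z - (1 - \<epsilon>) * w z" if "z \<in> C" for z
    using le[of "fst z" "snd z"] that by (auto simp: w_def w'_def C_def)
  have c0: "0 \<le> c v" if "v \<in> C \<times> C" for v
    using off[of "snd v"] w \<epsilon> that unfolding c_def by (intro add_nonneg_nonneg mult_nonneg_nonneg) auto
  have row: "(\<Sum>\<beta>\<in>C. c (\<alpha>, \<beta>)) = w \<alpha>" if "\<alpha> \<in> C" for \<alpha>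
    unfolding c_def fst_conv snd_conv sum.distrib sum_distrib_left[symmetric] sum_subtractf tot
    using that fin by (simp add: algebra_simps)
  have col: "(\<Sum>\<alpha>\<in>C. c (\<alpha>, \<beta>)) = w' \<beta>" if "\<beta> \<in> C" for \<beta>
    unfolding c_def fst_conv snd_conv sum.distrib sum_distrib_right[symmetric] tot
    using that fin by (simp add: algebra_simps)
  define P where "P = point_measure (C \<times> C) (\<lambda>v. ennreal (c v))"
  have P: "(\<integral>\<^sup>+ v. ennreal (g v) \<partial>P) = ennreal (\<Sum>v\<in>C \<times> C. c v * g v)" if "\<And>v. 0 \<le> g v" for g
    unfolding P_def using fin c0 that
    by (subst nn_integral_point_measure_finite) (auto simp: ennreal_mult[symmetric] sum_ennreal)
  have mP: "g \<in> measurable P M" if "\<And>v. g v \<in> space M" for g :: "_ \<Rightarrow> 'b" and M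
    unfolding P_def using that by (simp add: measurable_point_measure_eq1)
  define T where "T v = (f (fst v), f (snd v))" for v
  have T: "T \<in> measurable P (borel \<Otimes>\<^sub>M borel)" by (rule mP) (simp add: space_pair_measure)
  have em: "emeasure (distr P borel (\<lambda>v. f (s v))) A = ennreal (\<Sum>v\<in>C \<times> C. c v * indicator A (f (s v)))"
    if "A \<in> sets borel" for A s
  proof -
    have m: "(\<lambda>v. f (s v)) \<in> measurable P borel" by (rule mP) simp
    have "emeasure (distr P borel (\<lambda>v. f (s v))) A = (\<integral>\<^sup>+ x. indicator A x \<partial>distr P borel (\<lambda>v. f (s v)))"
      using that by simp
    also have "\<dots> = (\<integral>\<^sup>+ v. ennreal (indicator A (f (s v))) \<partial>P)"
      using that m by (subst nn_integral_distr) (auto simp: ennreal_indicator)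
    finally show ?thesis by (simp add: P)
  qed
  \<comment> \<open>The row and column sums of \<open>c\<close> are the two marginals.\<close>
  have fst: "distr P borel (\<lambda>v. f (fst v)) = overlap_measure N J"
  proof (rule measure_eqI)
    fix A assume "A \<in> sets (distr P borel (\<lambda>v. f (fst v)))"
    then have A: "A \<in> sets borel" by simp
    have "(\<Sum>v\<in>C \<times> C. c v * indicator A (f (fst v))) = (\<Sum>\<alpha>\<in>C. (\<Sum>\<beta>\<in>C. c (\<alpha>, \<beta>)) * indicator A (f \<alpha>))"
      by (simp add: sum.cartesian_product' sum_distrib_right)
    also have "\<dots> = replica_avg N J (\<lambda>\<sigma> \<tau>. indicator A (f (\<sigma>, \<tau>)))"
      using avg(1)[of "\<lambda>z. indicator A (f z)"] by (simp add: row)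
    finally show "emeasure (distr P borel (\<lambda>v. f (fst v))) A = emeasure (overlap_measure N J) A"
      unfolding em[OF A] emeasure_overlap_measure[OF A] by (simp add: f_def)
  qed (simp add: overlap_measure_def)
  have snd: "distr P borel (\<lambda>v. f (snd v)) = overlap_measure N J'"
  proof (rule measure_eqI)
    fix A assume "A \<in> sets (distr P borel (\<lambda>v. f (snd v)))"
    then have A: "A \<in> sets borel" by simp
    have "(\<Sum>v\<in>C \<times> C. c v * indicator A (f (snd v))) = (\<Sum>\<alpha>\<in>C. \<Sum>\<beta>\<in>C. c (\<alpha>, \<beta>) * indicator A (f \<beta>))"
      by (simp add: sum.cartesian_product')
    also have "\<dots> = (\<Sum>\<beta>\<in>C. (\<Sum>\<alpha>\<in>C. c (\<alpha>, \<beta>)) * indicator A (f \<beta>))"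
      by (subst sum.swap) (simp add: sum_distrib_right)
    also have "\<dots> = replica_avg N J' (\<lambda>\<sigma> \<tau>. indicator A (f (\<sigma>, \<tau>)))"
      using avg(2)[of "\<lambda>z. indicator A (f z)"] by (simp add: col)
    finally show "emeasure (distr P borel (\<lambda>v. f (snd v))) A = emeasure (overlap_measure N J') A"
      unfolding em[OF A] emeasure_overlap_measure[OF A] by (simp add: f_def)
  qed (simp add: overlap_measure_def)
  have "distr P (borel \<Otimes>\<^sub>M borel) T \<in> couplings (overlap_measure N J) (overlap_measure N J')"
  proof (rule couplings_borel_I)
    have "prob_space P"
      by (rule prob_spaceI) (use P[of "\<lambda>_. 1"] fin tot in \<open>simp add: sum.cartesian_product' row\<close>)
    then show "prob_space (distr P (borel \<Otimes>\<^sub>M borel) T)" using T by (rule prob_space.prob_space_distr)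
    show "distr (distr P (borel \<Otimes>\<^sub>M borel) T) borel fst = overlap_measure N J"
      using T by (subst distr_distr) (auto simp: comp_def T_def fst)
    show "distr (distr P (borel \<Otimes>\<^sub>M borel) T) borel snd = overlap_measure N J'"
      using T by (subst distr_distr) (auto simp: comp_def T_def snd)
  qed (auto simp: overlap_measure_def)
  moreover have "(\<integral>\<^sup>+ z. ennreal ((fst z - snd z)\<^sup>2) \<partial>distr P (borel \<Otimes>\<^sub>M borel) T)
      \<le> ennreal ((sqrt \<epsilon> * (2 * real N powr (1/3)))\<^sup>2)"
  proof -
    define b where "b = (2 * real N powr (1/3))\<^sup>2"
    have fb: "(f \<alpha> - f \<beta>)\<^sup>2 \<le> b" if "\<alpha> \<in> C" "\<beta> \<in> C" for \<alpha> \<beta>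
    proof -
      have "\<bar>f z\<bar> \<le> real N powr (1/3) * 1" if "z \<in> C" for z
        unfolding f_def abs_mult using overlap_abs_le_1[of "fst z" N "snd z"] that
        by (intro mult_mono) (auto simp: C_def)
      from this[OF that(1)] this[OF that(2)] have "\<bar>f \<alpha> - f \<beta>\<bar> \<le> 2 * real N powr (1/3)" by simp
      from power_mono[OF this abs_ge_zero, of 2] show ?thesis unfolding b_def by simp
    qed
    have "(\<integral>\<^sup>+ z. ennreal ((fst z - snd z)\<^sup>2) \<partial>distr P (borel \<Otimes>\<^sub>M borel) T)
        = (\<integral>\<^sup>+ v. ennreal ((f (fst v) - f (snd v))\<^sup>2) \<partial>P)"
      using T by (subst nn_integral_distr) (auto simp: T_def)
    also have "\<dots> = ennreal (\<Sum>v\<in>C \<times> C. c v * (f (fst v) - f (snd v))\<^sup>2)" by (rule P) simp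
    also have "\<dots> \<le> ennreal (\<Sum>v\<in>C \<times> C. w (fst v) * (w' (snd v) - (1 - \<epsilon>) * w (snd v)) * b)"
    proof (intro ennreal_leI sum_mono)
      fix v assume v: "v \<in> C \<times> C"
      have "c v * (f (fst v) - f (snd v))\<^sup>2
          = w (fst v) * (w' (snd v) - (1 - \<epsilon>) * w (snd v)) * (f (fst v) - f (snd v))\<^sup>2"
        by (simp add: c_def)
      also have "\<dots> \<le> w (fst v) * (w' (snd v) - (1 - \<epsilon>) * w (snd v)) * b"
        using v w off[of "snd v"] fb[of "fst v" "snd v"] by (intro mult_left_mono) auto
      finally show "c v * (f (fst v) - f (snd v))\<^sup>2 \<le> w (fst v) * (w' (snd v) - (1 - \<epsilon>) * w (snd v)) * b" .
    qed
    also have "(\<Sum>v\<in>C \<times> C. w (fst v) * (w' (snd v) - (1 - \<epsilon>) * w (snd v)) * b) = \<epsilon> * b"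
    proof -
      have "(\<Sum>v\<in>C \<times> C. w (fst v) * (w' (snd v) - (1 - \<epsilon>) * w (snd v)) * b)
          = (\<Sum>\<alpha>\<in>C. w \<alpha>) * (\<Sum>\<beta>\<in>C. w' \<beta> - (1 - \<epsilon>) * w \<beta>) * b"
        unfolding sum_product by (simp add: sum.cartesian_product' sum_distrib_right)
      also have "(\<Sum>\<beta>\<in>C. w' \<beta> - (1 - \<epsilon>) * w \<beta>) = \<epsilon>"
        using tot by (simp add: sum_subtractf sum_distrib_left[symmetric])
      finally show ?thesis using tot by simp
    qed
    also have "\<epsilon> * b = (sqrt \<epsilon> * (2 * real N powr (1/3)))\<^sup>2"
      using \<epsilon> by (simp add: b_def power_mult_distrib)
    finally show ?thesis .
  qed
  ultimately show ?thesis using \<epsilon> by (intro W2_le) auto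
qed

lemma gibbs_weight_pos: "0 < gibbs_weight N J \<sigma>"
  unfolding gibbs_weight_def by (intro divide_pos_pos sum_pos finite_spins spins_nonempty) auto

lemma continuous_gibbs_weight: "continuous_on UNIV (\<lambda>J. gibbs_weight N J \<sigma>)"
proof -
  have "(\<Sum>\<tau>\<in>spins N. exp (hamiltonian N J \<tau>)) \<noteq> 0" for J
    by (intro less_imp_neq[symmetric] sum_pos finite_spins spins_nonempty) auto
  moreover have "continuous_on UNIV (\<lambda>J. hamiltonian N J \<tau>)" for \<tau>
    unfolding hamiltonian_def case_prod_beta by (intro continuous_intros continuous_on_product_coordinates) 
  ultimately show ?thesis unfolding gibbs_weight_def by (intro continuous_intros) auto
qed

text \<open>The overlap measure depends continuously on the disorder, as nearby Gibbs weights have ratio close to \<open>1\<close>.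
  Continuity is stated on the full function space, where finitely many coordinates matter, because its product
  topology generates the product sigma-algebra.\<close>

lemma open_overlap_measure_vimage:
  assumes U: "openin (Metric_space.mtopology P2 W2) U"
  shows "open {J. overlap_measure N J \<in> U}"
proof (subst open_subopen, intro ballI)
  fix J0 assume "J0 \<in> {J. overlap_measure N J \<in> U}"
  then obtain r where r: "0 < r" "\<And>\<mu>. \<mu> \<in> P2 \<Longrightarrow> W2 (overlap_measure N J0) \<mu> < r \<Longrightarrow> \<mu> \<in> U"
    using U unfolding openin_P2 by blast
  define a where "a = 2 * real N powr (1/3) + 1"
  have a: "0 < a" by (simp add: a_def add_nonneg_pos)
  define \<epsilon> where "\<epsilon> = min 1 ((r / (2 * a))\<^sup>2)"
  have \<epsilon>: "0 < \<epsilon>" "\<epsilon> \<le> 1" using r a by (auto simp: \<epsilon>_def)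
  have "sqrt \<epsilon> \<le> sqrt ((r / (2 * a))\<^sup>2)" by (intro real_sqrt_le_mono) (simp add: \<epsilon>_def)
  then have "sqrt \<epsilon> \<le> r / (2 * a)" using r a by simp
  then have "sqrt \<epsilon> * (2 * real N powr (1/3)) \<le> r / (2 * a) * a"
    using \<epsilon> r a by (intro mult_mono) (auto simp: a_def)
  also have "\<dots> < r" using r a by simp
  finally have small: "sqrt \<epsilon> * (2 * real N powr (1/3)) < r" .
  \<comment> \<open>A neighbourhood of \<open>J0\<close> on which all Gibbs weights keep the fraction \<open>1 - \<epsilon>\<close>.\<close>
  define V where "V = (\<Inter>p\<in>spins N \<times> spins N. {J. (1 - \<epsilon>) * (gibbs_weight N J0 (fst p) * gibbs_weight N J0 (snd p))
    < gibbs_weight N J (fst p) * gibbs_weight N J (snd p)})"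
  have "open V"
    unfolding V_def using finite_spins
    by (intro open_INT ballI open_Collect_less continuous_intros continuous_gibbs_weight) auto
  moreover have "J0 \<in> V"
    using \<epsilon> by (auto simp: V_def gibbs_weight_pos)
  moreover have "V \<subseteq> {J. overlap_measure N J \<in> U}"
  proof
    fix J assume J: "J \<in> V"
    have "W2 (overlap_measure N J0) (overlap_measure N J) \<le> sqrt \<epsilon> * (2 * real N powr (1/3))"
      using \<epsilon> J by (intro W2_overlap_measure_le) (auto simp: V_def intro: less_imp_le)
    then show "J \<in> {J. overlap_measure N J \<in> U}"
      using r(2)[OF overlap_measure_P2] small by auto
  qed
  ultimately show "\<exists>T. open T \<and> J0 \<in> T \<and> T \<subseteq> {J. overlap_measure N J \<in> U}" by blast
qed

lemma measurable_PiM_to_borel: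
  assumes M: "\<And>e. sets (M e) = sets (borel :: real measure)"
  shows "(\<lambda>J. J) \<in> measurable (PiM (I :: (nat \<times> nat) set) M) borel"
proof -
  have "(\<lambda>J e. J e) \<in> measurable (PiM I M) (PiM UNIV (\<lambda>_. borel))"
  proof (rule measurable_PiM_single')
    fix e :: "nat \<times> nat"
    show "(\<lambda>J. J e) \<in> borel_measurable (PiM I M)"
    proof (cases "e \<in> I")
      case True
      then show ?thesis
        using measurable_component_singleton[OF True, of M] by (simp add: measurable_cong_sets[OF refl M])
    next
      case False
      have "J e = undefined" if "J \<in> space (PiM I M)" for J
        using PiE_arb[OF that[unfolded space_PiM] False] .
      then show ?thesis by (subst measurable_cong[of _ _ "\<lambda>_. undefined"]) auto
    qed
  qed auto
  then show ?thesis
    by (simp add: measurable_cong_sets[OF refl sets_PiM_equal_borel])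
qed

lemma measurable_overlap_measure:
  assumes M: "\<And>e. sets (M e) = sets (borel :: real measure)"
  shows "overlap_measure N \<in> measurable (PiM (edges N) M) borel_P2"
  unfolding borel_P2_def
proof (rule measurable_measure_of)
  fix U assume "U \<in> {U. openin (Metric_space.mtopology P2 W2) U}"
  then have "{J. overlap_measure N J \<in> U} \<in> sets borel"
    by (intro borel_open open_overlap_measure_vimage) simp
  from measurable_sets[OF measurable_PiM_to_borel[OF M] this, of "edges N"]
  show "overlap_measure N -` U \<inter> space (PiM (edges N) M) \<in> sets (PiM (edges N) M)"
    by (simp add: vimage_def)
qed (auto simp: openin_P2 overlap_measure_P2)

lemma L2_size_overlap_measure:
  assumes "contraction \<phi>"
  shows "(L2_size \<phi> (overlap_measure N J))\<^sup>2
    = replica_avg N J (\<lambda>\<sigma> \<tau>. (\<phi> (real N powr (1/3) * overlap N (\<sigma>, \<tau>)))\<^sup>2)"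
proof -
  note [measurable] = contraction_measurable[OF assms]
  show ?thesis unfolding L2_size_power2 by (rule integral_overlap_measure) auto
qed

text \<open>The bound rests on \<open>\<bar>x\<^sup>2 - y\<^sup>2\<bar> \<le> (1 + 1 / r) (x - y)\<^sup>2 + r y\<^sup>2\<close>, which requires integrability of only one of the two
  squares.\<close>

lemma integral_diff_power2_coupling:
  fixes \<rho> :: "(real \<times> real) measure" and g :: "real \<Rightarrow> real"
  assumes \<rho>: "prob_space \<rho>" and s: "sets \<rho> = sets (borel \<Otimes>\<^sub>M borel)"
    and y: "integrable \<rho> (\<lambda>z. (snd z)\<^sup>2)"
    and cost: "(\<integral>\<^sup>+ z. ennreal ((fst z - snd z)\<^sup>2) \<partial>\<rho>) < ennreal (r\<^sup>2)" and r: "0 < r"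
    and g: "\<And>x y. \<bar>g x - g y\<bar> \<le> \<Lambda> * \<bar>x - y\<bar>" "g \<in> borel_measurable borel" "0 \<le> \<Lambda>"
  shows "\<bar>(\<integral>z. g ((fst z)\<^sup>2) \<partial>\<rho>) - (\<integral>z. g ((snd z)\<^sup>2) \<partial>\<rho>)\<bar>
    \<le> \<Lambda> * (r\<^sup>2 + r * (1 + (\<integral>z. (snd z)\<^sup>2 \<partial>\<rho>)))"
proof -
  interpret prob_space \<rho> by fact
  have [measurable]: "fst \<in> borel_measurable \<rho>" "snd \<in> borel_measurable \<rho>"
    by (auto simp: measurable_cong_sets[OF s refl])
  note [measurable] = g(2)
  have i2: "integrable \<rho> (\<lambda>z. (fst z - snd z)\<^sup>2)"
    using cost by (intro integrableI_nonneg) (auto intro: order_less_trans)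
  have le: "(\<integral>z. (fst z - snd z)\<^sup>2 \<partial>\<rho>) \<le> r\<^sup>2"
    using cost nn_integral_eq_integral[OF i2] by (simp add: ennreal_less_iff)
  have pt: "\<bar>(fst z)\<^sup>2 - (snd z)\<^sup>2\<bar> \<le> (1 + 1 / r) * (fst z - snd z)\<^sup>2 + r * (snd z)\<^sup>2" for z :: "real \<times> real"
  proof -
    define d where "d = fst z - snd z"
    have "0 \<le> (\<bar>d\<bar> - r * \<bar>snd z\<bar>)\<^sup>2 / r" using r by simp
    also have "\<dots> = d\<^sup>2 / r + r * (snd z)\<^sup>2 - 2 * (\<bar>d\<bar> * \<bar>snd z\<bar>)"
      using r by (simp add: power2_diff power_mult_distrib diff_divide_distrib add_divide_distrib)
        (simp add: power2_eq_square)
    finally have 1: "2 * (\<bar>d\<bar> * \<bar>snd z\<bar>) \<le> d\<^sup>2 / r + r * (snd z)\<^sup>2" by simp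
    have "(fst z)\<^sup>2 - (snd z)\<^sup>2 = d\<^sup>2 + 2 * (d * snd z)"
      by (simp add: d_def power2_eq_square algebra_simps)
    also have "\<bar>\<dots>\<bar> \<le> d\<^sup>2 + 2 * (\<bar>d\<bar> * \<bar>snd z\<bar>)"
      by (rule order_trans[OF abs_triangle_ineq]) (simp add: abs_mult)
    finally show ?thesis using 1 by (simp add: d_def[symmetric] distrib_right)
  qed
  have ig: "integrable \<rho> (\<lambda>z. g (x z))" if [measurable]: "x \<in> borel_measurable \<rho>" and i: "integrable \<rho> x" for x
  proof (rule Bochner_Integration.integrable_bound[of _ "\<lambda>z. \<bar>g 0\<bar> + \<Lambda> * \<bar>x z\<bar>"])
    show "AE z in \<rho>. norm (g (x z)) \<le> norm (\<bar>g 0\<bar> + \<Lambda> * \<bar>x z\<bar>)"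
    proof (rule AE_I2)
      fix z show "norm (g (x z)) \<le> norm (\<bar>g 0\<bar> + \<Lambda> * \<bar>x z\<bar>)"
        using g(1)[of "x z" 0] g(3) by simp
    qed
  qed (use i in auto)
  have ix: "integrable \<rho> (\<lambda>z. (fst z)\<^sup>2)"
  proof (rule Bochner_Integration.integrable_bound[of _ "\<lambda>z. (1 + 1 / r) * (fst z - snd z)\<^sup>2 + (1 + r) * (snd z)\<^sup>2"])
    have nn: "0 \<le> (1 + 1 / r) * (fst z - snd z)\<^sup>2 + (1 + r) * (snd z)\<^sup>2" for z :: "real \<times> real"
      using r by (intro add_nonneg_nonneg mult_nonneg_nonneg) auto
    have "(fst z)\<^sup>2 \<le> (1 + 1 / r) * (fst z - snd z)\<^sup>2 + (1 + r) * (snd z)\<^sup>2" for z :: "real \<times> real"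
      using pt[of z] by (simp add: distrib_right)
    then show "AE z in \<rho>. norm ((fst z)\<^sup>2) \<le> norm ((1 + 1 / r) * (fst z - snd z)\<^sup>2 + (1 + r) * (snd z)\<^sup>2)"
      using nn by simp
  qed (use i2 y in auto)
  have ig1: "integrable \<rho> (\<lambda>z. g ((fst z)\<^sup>2))" by (rule ig[OF _ ix]) measurable
  have ig2: "integrable \<rho> (\<lambda>z. g ((snd z)\<^sup>2))" by (rule ig[OF _ y]) measurable
  have "\<bar>(\<integral>z. g ((fst z)\<^sup>2) \<partial>\<rho>) - (\<integral>z. g ((snd z)\<^sup>2) \<partial>\<rho>)\<bar> = \<bar>\<integral>z. g ((fst z)\<^sup>2) - g ((snd z)\<^sup>2) \<partial>\<rho>\<bar>"
    using ig1 ig2 by simp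
  also have "\<dots> \<le> (\<integral>z. \<Lambda> * ((1 + 1 / r) * (fst z - snd z)\<^sup>2 + r * (snd z)\<^sup>2) \<partial>\<rho>)"
  proof (rule order_trans[OF integral_abs_bound integral_mono])
    show "integrable \<rho> (\<lambda>z. \<bar>g ((fst z)\<^sup>2) - g ((snd z)\<^sup>2)\<bar>)" using ig1 ig2 by simp
    show "\<bar>g ((fst z)\<^sup>2) - g ((snd z)\<^sup>2)\<bar> \<le> \<Lambda> * ((1 + 1 / r) * (fst z - snd z)\<^sup>2 + r * (snd z)\<^sup>2)" for z
      by (rule order_trans[OF g(1) mult_left_mono[OF pt g(3)]])
  qed (use i2 y in auto)
  also have "\<dots> = \<Lambda> * ((1 + 1 / r) * (\<integral>z. (fst z - snd z)\<^sup>2 \<partial>\<rho>) + r * (\<integral>z. (snd z)\<^sup>2 \<partial>\<rho>))"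
    using i2 y by simp
  also have "\<dots> \<le> \<Lambda> * ((1 + 1 / r) * r\<^sup>2 + r * (\<integral>z. (snd z)\<^sup>2 \<partial>\<rho>))"
    using le r g(3) by (intro mult_left_mono add_right_mono) auto
  also have "\<dots> = \<Lambda> * (r\<^sup>2 + r * (1 + (\<integral>z. (snd z)\<^sup>2 \<partial>\<rho>)))"
    using r by (simp add: power2_eq_square algebra_simps)
  finally show ?thesis .
qed

lemma return_0_P2: "return borel 0 \<in> P2"
proof -
  have "prob_space (return borel (0::real))" by (rule prob_space_return) simp
  then show ?thesis by (simp add: P2_def nn_integral_return)
qed

locale gaussian_limit = prob_space \<Omega> for \<Omega> :: "'w measure" +
  fixes \<zeta>_star :: "real measure measure" and \<mu>_star :: "'w \<Rightarrow> real measure"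
  assumes \<zeta>_star: "\<zeta>_star \<in> P2P2"
    and limit: "(\<lambda>N. WW2 (zetaG N) \<zeta>_star) \<longlonglongrightarrow> 0"
    and \<mu>_star: "\<mu>_star \<in> measurable \<Omega> borel_P2"
    and law_\<mu>_star: "distr \<Omega> borel_P2 \<mu>_star = \<zeta>_star"
begin

lemma sets_std_gaussian: "sets std_gaussian = sets borel"
  by (simp add: std_gaussian_def)

lemma measurable_L2_size_star[measurable]:
  "contraction \<phi> \<Longrightarrow> (\<lambda>\<omega>. L2_size \<phi> (\<mu>_star \<omega>)) \<in> borel_measurable \<Omega>"
  by (rule measurable_compose[OF \<mu>_star measurable_L2_size])

lemma \<mu>_star_P2: "\<omega> \<in> space \<Omega> \<Longrightarrow> \<mu>_star \<omega> \<in> P2"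
  using measurable_space[OF \<mu>_star] by (simp add: space_borel_P2)

text \<open>The size of \<open>\<mu>\<close> is at most its distance to the point mass at \<open>0\<close>, whose square is integrable under \<open>\<zeta>_star\<close>.\<close>

lemma integrable_L2_size_star:
  assumes c: "contraction \<phi>"
  shows "integrable \<Omega> (\<lambda>\<omega>. (L2_size \<phi> (\<mu>_star \<omega>))\<^sup>2)"
proof (rule integrableI_nonneg)
  note [measurable] = measurable_L2_size_star[OF c]
  show "(\<lambda>\<omega>. (L2_size \<phi> (\<mu>_star \<omega>))\<^sup>2) \<in> borel_measurable \<Omega>" by measurable
  have le: "L2_size \<phi> \<mu> \<le> W2 \<mu> (return borel 0)" if "\<mu> \<in> P2" for \<mu>
  proof -
    note [measurable] = contraction_measurable[OF c]
    have "L2_size \<phi> (return borel 0) = 0"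
      using c by (simp add: L2_size_def integral_return contraction_def)
    then show ?thesis using L2_size_Lipschitz[OF c that return_0_P2] by simp
  qed
  have sp: "space \<zeta>_star = P2"
    using sets_eq_imp_space_eq[of \<zeta>_star borel_P2] \<zeta>_star by (simp add: P2P2_def space_borel_P2)
  have [measurable]: "L2_size \<phi> \<in> borel_measurable borel_P2" by (rule measurable_L2_size[OF c])
  have "(\<integral>\<^sup>+ \<omega>. ennreal ((L2_size \<phi> (\<mu>_star \<omega>))\<^sup>2) \<partial>\<Omega>) = (\<integral>\<^sup>+ \<mu>. ennreal ((L2_size \<phi> \<mu>)\<^sup>2) \<partial>\<zeta>_star)"
    unfolding law_\<mu>_star[symmetric] by (subst nn_integral_distr[OF \<mu>_star]) auto
  also have "\<dots> \<le> (\<integral>\<^sup>+ \<mu>. ennreal ((W2 \<mu> (return borel 0))\<^sup>2) \<partial>\<zeta>_star)"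
    using le L2_size_nonneg by (intro nn_integral_mono ennreal_leI power_mono) (auto simp: sp)
  also have "\<dots> < \<infinity>" using \<zeta>_star by (simp add: P2P2_def)
  finally show "(\<integral>\<^sup>+ \<omega>. ennreal ((L2_size \<phi> (\<mu>_star \<omega>))\<^sup>2) \<partial>\<Omega>) < \<infinity>" .
qed auto

text \<open>With \<open>\<phi> = abs\<close> this is the convergence of the Gaussian susceptibility, and other contractions give its
  truncations and tails. The function \<open>g\<close> may be unbounded, so that convergence of means is included.\<close>

lemma gaussian_convergence:
  assumes c: "contraction \<phi>"
    and g: "\<And>x y. \<bar>g x - g y\<bar> \<le> \<Lambda> * \<bar>x - y\<bar>" "g \<in> borel_measurable borel" "0 \<le> \<Lambda>"
  shows "(\<lambda>N. \<integral>J. g (replica_avg N J (\<lambda>\<sigma> \<tau>. (\<phi> (real N powr (1/3) * overlap N (\<sigma>, \<tau>)))\<^sup>2)) \<partial>disorder std_gaussian N)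
    \<longlonglongrightarrow> (\<integral>\<omega>. g ((L2_size \<phi> (\<mu>_star \<omega>))\<^sup>2) \<partial>\<Omega>)"
proof (rule LIMSEQ_I)
  fix e :: real assume e: "0 < e"
  define I where "I = (\<integral>\<omega>. (L2_size \<phi> (\<mu>_star \<omega>))\<^sup>2 \<partial>\<Omega>)"
  have I: "0 \<le> I" unfolding I_def by simp
  define P where "P = (\<Lambda> + 1) * (2 + I)"
  define r where "r = min 1 (e / (2 * P))"
  have p: "0 < P" unfolding P_def using g(3) I by (intro mult_pos_pos) auto
  have r: "0 < r" "r \<le> 1" using e p by (auto simp: r_def)
  have small: "\<Lambda> * (r\<^sup>2 + r * (1 + I)) < e"
  proof -
    have "r\<^sup>2 \<le> r * 1" unfolding power2_eq_square using r by (intro mult_left_mono) auto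
    then have "\<Lambda> * (r\<^sup>2 + r * (1 + I)) \<le> (\<Lambda> + 1) * (r * (2 + I))"
      using g(3) r I by (intro mult_mono) (auto simp: algebra_simps)
    also have "\<dots> = r * P" by (simp add: P_def)
    also have "\<dots> \<le> e / (2 * P) * P"
      using p by (intro mult_right_mono) (auto simp: r_def)
    also have "\<dots> = e / 2" using p by simp
    finally show ?thesis using e by simp
  qed
  have "eventually (\<lambda>N. WW2 (zetaG N) \<zeta>_star < ennreal r) sequentially"
    using limit r(1) by (intro order_tendstoD) auto
  then obtain n0 where n0: "\<And>N. n0 \<le> N \<Longrightarrow> WW2 (zetaG N) \<zeta>_star < ennreal r"
    by (auto simp: eventually_sequentially)
  note [measurable] = g(2) measurable_L2_size_star[OF c]
  show "\<exists>no. \<forall>N\<ge>no. norm ((\<integral>J. g (replica_avg N J (\<lambda>\<sigma> \<tau>. (\<phi> (real N powr (1/3) * overlap N (\<sigma>, \<tau>)))\<^sup>2)) \<partial>disorder std_gaussian N)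
      - (\<integral>\<omega>. g ((L2_size \<phi> (\<mu>_star \<omega>))\<^sup>2) \<partial>\<Omega>)) < e"
  proof (intro exI allI impI)
    fix N assume N: "n0 \<le> N"
    have sz: "sets (zetaG N) = sets borel_P2" "sets \<zeta>_star = sets borel_P2"
      using \<zeta>_star by (auto simp: zetaG_def P2P2_def)
    obtain \<rho> where \<rho>: "prob_space \<rho>" "sets \<rho> = sets (borel \<Otimes>\<^sub>M borel)"
      "distr \<rho> borel fst = distr (zetaG N) borel (L2_size \<phi>)"
      "distr \<rho> borel snd = distr \<zeta>_star borel (L2_size \<phi>)"
      "(\<integral>\<^sup>+ z. ennreal ((fst z - snd z)\<^sup>2) \<partial>\<rho>) < ennreal (r\<^sup>2)"
      by (rule L2_size_coupling[OF c sz n0[OF N]])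
    have om: "overlap_measure N \<in> measurable (disorder std_gaussian N) borel_P2"
      unfolding disorder_def by (rule measurable_overlap_measure) (rule sets_std_gaussian)
    note Lm[measurable] = measurable_L2_size[OF c]
    have Lo[measurable]: "(\<lambda>J. L2_size \<phi> (overlap_measure N J)) \<in> borel_measurable (disorder std_gaussian N)"
      by (rule measurable_compose[OF om Lm])
    have m[measurable]: "fst \<in> borel_measurable \<rho>" "snd \<in> borel_measurable \<rho>"
      by (auto simp: measurable_cong_sets[OF \<rho>(2) refl])
    have 1: "distr \<rho> borel fst = distr (disorder std_gaussian N) borel (\<lambda>J. L2_size \<phi> (overlap_measure N J))"
      unfolding \<rho>(3) zetaG_def by (subst distr_distr[OF Lm om]) (simp add: comp_def)
    have 2: "distr \<rho> borel snd = distr \<Omega> borel (\<lambda>\<omega>. L2_size \<phi> (\<mu>_star \<omega>))"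
      unfolding \<rho>(4) law_\<mu>_star[symmetric] by (subst distr_distr[OF Lm \<mu>_star]) (simp add: comp_def)
    have q: "(\<integral>z. h ((fst z)\<^sup>2) \<partial>\<rho>) = (\<integral>x. h (x\<^sup>2) \<partial>distr \<rho> borel fst)"
      "(\<integral>z. h ((snd z)\<^sup>2) \<partial>\<rho>) = (\<integral>x. h (x\<^sup>2) \<partial>distr \<rho> borel snd)"
      if [measurable]: "h \<in> borel_measurable borel" for h :: "real \<Rightarrow> real"
      by (subst integral_distr; simp)+
    have t: "(\<integral>z. h ((fst z)\<^sup>2) \<partial>\<rho>)
        = (\<integral>J. h (replica_avg N J (\<lambda>\<sigma> \<tau>. (\<phi> (real N powr (1/3) * overlap N (\<sigma>, \<tau>)))\<^sup>2)) \<partial>disorder std_gaussian N)"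
      "(\<integral>z. h ((snd z)\<^sup>2) \<partial>\<rho>) = (\<integral>\<omega>. h ((L2_size \<phi> (\<mu>_star \<omega>))\<^sup>2) \<partial>\<Omega>)"
      if [measurable]: "h \<in> borel_measurable borel" for h :: "real \<Rightarrow> real"
      unfolding q[OF that] 1 2 L2_size_overlap_measure[OF c, symmetric] by (subst integral_distr; simp)+
    have "integrable (distr \<Omega> borel (\<lambda>\<omega>. L2_size \<phi> (\<mu>_star \<omega>))) (\<lambda>x. x\<^sup>2)"
      using integrable_L2_size_star[OF c] by (subst integrable_distr_eq) auto
    then have y: "integrable \<rho> (\<lambda>z. (snd z)\<^sup>2)"
      unfolding 2[symmetric] by (subst (asm) integrable_distr_eq) auto
    have "(\<integral>z. (snd z)\<^sup>2 \<partial>\<rho>) = I" unfolding I_def using t(2)[of "\<lambda>x. x"] by simp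
    then show "norm ((\<integral>J. g (replica_avg N J (\<lambda>\<sigma> \<tau>. (\<phi> (real N powr (1/3) * overlap N (\<sigma>, \<tau>)))\<^sup>2)) \<partial>disorder std_gaussian N)
        - (\<integral>\<omega>. g ((L2_size \<phi> (\<mu>_star \<omega>))\<^sup>2) \<partial>\<Omega>)) < e"
      using integral_diff_power2_coupling[OF \<rho>(1,2) y \<rho>(5) r(1) g] small t[OF g(2)] by simp
  qed
qed

end

section \<open>From weak convergence to Wasserstein convergence\<close>

lemma fatou_bound:
  fixes u :: "nat \<Rightarrow> 'a \<Rightarrow> ennreal"
  assumes [measurable]: "\<And>n. u n \<in> borel_measurable M"
    and lim: "\<And>x. x \<in> space M \<Longrightarrow> (\<lambda>n. u n x) \<longlonglongrightarrow> v x"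
    and bd: "eventually (\<lambda>n. (\<integral>\<^sup>+ x. u n x \<partial>M) \<le> B) sequentially"
  shows "(\<integral>\<^sup>+ x. v x \<partial>M) \<le> B"
proof -
  have "(\<integral>\<^sup>+ x. v x \<partial>M) = (\<integral>\<^sup>+ x. liminf (\<lambda>n. u n x) \<partial>M)"
    by (intro nn_integral_cong lim_imp_Liminf[symmetric] lim) auto
  also have "\<dots> \<le> liminf (\<lambda>n. \<integral>\<^sup>+ x. u n x \<partial>M)" by (rule nn_integral_liminf) simp
  also have "\<dots> \<le> limsup (\<lambda>n. \<integral>\<^sup>+ x. u n x \<partial>M)" by (rule Liminf_le_Limsup) simp
  also have "\<dots> \<le> B" by (rule Limsup_bounded[OF bd])
  finally show ?thesis .
qed

lemma uniformly_integrable_tendsto_0: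
  fixes Z :: "nat \<Rightarrow> 'a \<Rightarrow> real"
  assumes "prob_space M" and [measurable]: "\<And>n. Z n \<in> borel_measurable M"
    and nn: "\<And>n x. 0 \<le> Z n x"
    and lim: "\<And>x. x \<in> space M \<Longrightarrow> (\<lambda>n. Z n x) \<longlonglongrightarrow> 0"
    and ui: "\<And>\<epsilon>. 0 < \<epsilon> \<Longrightarrow> \<exists>L\<ge>0. eventually (\<lambda>n. (\<integral>\<^sup>+ x. ennreal (Z n x - L) \<partial>M) \<le> ennreal \<epsilon>) sequentially"
  shows "(\<lambda>n. \<integral>\<^sup>+ x. ennreal (Z n x) \<partial>M) \<longlonglongrightarrow> 0"
proof (rule tendsto_zero_ennreal)
  fix \<epsilon> :: real assume \<epsilon>: "0 < \<epsilon>"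
  interpret prob_space M by fact
  obtain L where L: "0 \<le> L" "eventually (\<lambda>n. (\<integral>\<^sup>+ x. ennreal (Z n x - L) \<partial>M) \<le> ennreal (\<epsilon> / 4)) sequentially"
    using ui[of "\<epsilon> / 4"] \<epsilon> by auto
  have i: "integrable M (\<lambda>x. min (Z n x) L)" for n
    by (rule integrable_const_bound[of _ L]) (use nn L in auto)
  have "(\<lambda>n. \<integral>x. min (Z n x) L \<partial>M) \<longlonglongrightarrow> (\<integral>x. min 0 L \<partial>M)"
  proof (rule integral_dominated_convergence[where w = "\<lambda>_. L"])
    show "AE x in M. (\<lambda>n. min (Z n x) L) \<longlonglongrightarrow> min 0 L"
      by (intro AE_I2 tendsto_min lim tendsto_const)
  qed (use nn L in auto)
  then have "(\<lambda>n. \<integral>x. min (Z n x) L \<partial>M) \<longlonglongrightarrow> 0" using L by simp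
  then have "eventually (\<lambda>n. (\<integral>x. min (Z n x) L \<partial>M) < \<epsilon> / 2) sequentially"
    using \<epsilon> by (intro order_tendstoD) auto
  with L(2) show "eventually (\<lambda>n. (\<integral>\<^sup>+ x. ennreal (Z n x) \<partial>M) < ennreal \<epsilon>) sequentially"
  proof eventually_elim
    case (elim n)
    have "(\<integral>\<^sup>+ x. ennreal (Z n x) \<partial>M) \<le> (\<integral>\<^sup>+ x. ennreal (min (Z n x) L) + ennreal (Z n x - L) \<partial>M)"
    proof (intro nn_integral_mono)
      fix x show "ennreal (Z n x) \<le> ennreal (min (Z n x) L) + ennreal (Z n x - L)"
        using nn[of n x] L(1) by (cases "Z n x \<le> L") (auto simp: ennreal_neg ennreal_plus[symmetric] simp del: ennreal_plus)
    qed
    also have "\<dots> = ennreal (\<integral>x. min (Z n x) L \<partial>M) + (\<integral>\<^sup>+ x. ennreal (Z n x - L) \<partial>M)"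
      using nn L(1) by (subst nn_integral_add) (auto simp: nn_integral_eq_integral[OF i])
    also have "\<dots> \<le> ennreal (\<epsilon> / 2) + ennreal (\<epsilon> / 4)"
      using elim by (intro add_mono ennreal_leI) auto
    also have "\<dots> < ennreal \<epsilon>"
      using \<epsilon> by (simp add: ennreal_plus[symmetric] ennreal_less_iff del: ennreal_plus)
    finally show ?case .
  qed
qed

lemma wasserstein_tendsto_0:
  fixes P :: "nat \<Rightarrow> real measure"
  assumes \<Omega>: "prob_space \<Omega>" and Y: "\<And>n. Y n \<in> borel_measurable \<Omega>" "X \<in> borel_measurable \<Omega>"
    and law: "\<And>n. distr \<Omega> borel (Y n) = P n" "distr \<Omega> borel X = M" and p: "0 < p"
    and lim: "(\<lambda>n. \<integral>\<^sup>+ x. ennreal (\<bar>Y n x - X x\<bar> powr p) \<partial>\<Omega>) \<longlonglongrightarrow> 0"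
  shows "(\<lambda>n. wasserstein_real p (P n) M) \<longlonglongrightarrow> 0"
proof (rule tendsto_zero_ennreal)
  fix \<epsilon> :: real assume \<epsilon>: "0 < \<epsilon>"
  note [measurable] = Y
  have "eventually (\<lambda>n. (\<integral>\<^sup>+ x. ennreal (\<bar>Y n x - X x\<bar> powr p) \<partial>\<Omega>) < ennreal ((\<epsilon> / 2) powr p)) sequentially"
    using lim \<epsilon> by (intro order_tendstoD) auto
  then show "eventually (\<lambda>n. wasserstein_real p (P n) M < ennreal \<epsilon>) sequentially"
  proof eventually_elim
    case (elim n)
    define \<pi> where "\<pi> = distr \<Omega> (borel \<Otimes>\<^sub>M borel) (\<lambda>x. (Y n x, X x))"
    have "\<pi> \<in> couplings (P n) M"
    proof (rule couplings_borel_I)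
      show "prob_space \<pi>" unfolding \<pi>_def by (rule prob_space.prob_space_distr[OF \<Omega>]) measurable
      show "distr \<pi> borel fst = P n" "distr \<pi> borel snd = M"
        unfolding \<pi>_def using law by (simp_all add: distr_distr comp_def)
    qed (auto simp: \<pi>_def law[symmetric])
    moreover have "(\<integral>\<^sup>+ z. ennreal (dist (fst z) (snd z) powr p) \<partial>\<pi>) = (\<integral>\<^sup>+ x. ennreal (\<bar>Y n x - X x\<bar> powr p) \<partial>\<Omega>)"
      unfolding \<pi>_def by (subst nn_integral_distr) (auto simp: dist_real_def)
    ultimately have "wasserstein_real p (P n) M \<le> ennreal (\<epsilon> / 2)"
      using elim \<epsilon> p by (intro wasserstein_le[where \<pi> = \<pi>]) auto
    also have "\<dots> < ennreal \<epsilon>" using \<epsilon> by (simp add: ennreal_lessI)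
    finally show ?case .
  qed
qed

lemma skorohod_representation:
  assumes "\<And>n. real_distribution (P n)" "real_distribution M" "weak_conv_m P M"
  obtains \<Omega> :: "real measure" and Y X where "prob_space \<Omega>"
    "\<And>n. Y n \<in> borel_measurable \<Omega>" "X \<in> borel_measurable \<Omega>"
    "\<And>n. distr \<Omega> borel (Y n) = P n" "distr \<Omega> borel X = M"
    "\<And>x. x \<in> space \<Omega> \<Longrightarrow> (\<lambda>n. Y n x) \<longlonglongrightarrow> X x"
proof -
  obtain \<Omega> :: "real measure" and Y X where h: "prob_space \<Omega>"
    "\<forall>n. Y n \<in> borel_measurable \<Omega>" "\<forall>n. distr \<Omega> borel (Y n) = P n" "X \<in> measurable \<Omega> lborel"
    "distr \<Omega> borel X = M" "\<forall>x\<in>space \<Omega>. (\<lambda>n. Y n x) \<longlonglongrightarrow> X x"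
    using Skorohod[OF assms] by blast
  show thesis by (rule that[of \<Omega> Y X]) (use h in auto)
qed

lemma powr_squared_le:
  fixes x p :: real
  assumes "0 \<le> x" "0 < p" "2 * p \<le> real k"
  shows "(x powr p)\<^sup>2 \<le> 1 + x ^ k"
proof (cases "x \<le> 1")
  case True
  have "x powr p \<le> 1" using True assms by (simp add: powr_le1)
  then have "(x powr p)\<^sup>2 \<le> 1" by (simp add: abs_square_le_1)
  then show ?thesis using assms(1) by (simp add: add_increasing2)
next
  case False
  have "(x powr p)\<^sup>2 = x powr (2 * p)" using False by (simp add: power2_eq_square powr_add[symmetric])
  also have "\<dots> \<le> x powr real k" using False assms by (intro powr_mono) auto
  also have "\<dots> = x ^ k" using False by (simp add: powr_realpow)
  finally show ?thesis by simp
qed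

text \<open>Pointwise, \<open>z - L \<le> z\<^sup>2 / L\<close> with \<open>z = \<bar>x\<bar>\<^sup>p\<close>.\<close>

lemma bounded_moment_imp_uniformly_integrable:
  assumes P: "\<And>n. real_distribution (P n)" and p: "0 < p" "2 * p \<le> real k"
    and bd: "eventually (\<lambda>n. (\<integral>\<^sup>+ x. ennreal (\<bar>x\<bar> ^ k) \<partial>P n) \<le> ennreal B) sequentially"
    and B: "0 \<le> B" and \<epsilon>: "0 < \<epsilon>"
  shows "\<exists>L\<ge>0. eventually (\<lambda>n. (\<integral>\<^sup>+ x. ennreal (\<bar>x\<bar> powr p - L) \<partial>P n) \<le> ennreal \<epsilon>) sequentially"
proof -
  define L where "L = (1 + B) / \<epsilon>"
  have L: "0 < L" using B \<epsilon> by (simp add: L_def add_pos_nonneg)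
  have pt: "\<bar>x\<bar> powr p - L \<le> 1 / L * (1 + \<bar>x\<bar> ^ k)" for x
  proof -
    define z where "z = \<bar>x\<bar> powr p"
    have "0 \<le> (z - L)\<^sup>2 / L + z" using L by (simp add: z_def)
    then have "z - L \<le> 1 / L * z\<^sup>2" using L by (simp add: power2_eq_square field_simps)
    also have "\<dots> \<le> 1 / L * (1 + \<bar>x\<bar> ^ k)"
      unfolding z_def using L by (intro mult_left_mono powr_squared_le p) auto
    finally show ?thesis by (simp add: z_def)
  qed
  have "eventually (\<lambda>n. (\<integral>\<^sup>+ x. ennreal (\<bar>x\<bar> powr p - L) \<partial>P n) \<le> ennreal \<epsilon>) sequentially"
    using bd
  proof eventually_elim
    case (elim n)
    interpret real_distribution "P n" by (rule P)
    have "(\<integral>\<^sup>+ x. ennreal (\<bar>x\<bar> powr p - L) \<partial>P n)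
        \<le> (\<integral>\<^sup>+ x. ennreal (1 / L) * (1 + ennreal (\<bar>x\<bar> ^ k)) \<partial>P n)"
    proof (intro nn_integral_mono)
      fix x
      have "ennreal (1 / L * (1 + \<bar>x\<bar> ^ k)) = ennreal (1 / L) * ennreal (1 + \<bar>x\<bar> ^ k)"
        using L by (intro ennreal_mult) auto
      then show "ennreal (\<bar>x\<bar> powr p - L) \<le> ennreal (1 / L) * (1 + ennreal (\<bar>x\<bar> ^ k))"
        using ennreal_leI[OF pt[of x]] by simp
    qed
    also have "\<dots> = ennreal (1 / L) * (1 + (\<integral>\<^sup>+ x. ennreal (\<bar>x\<bar> ^ k) \<partial>P n))"
      by (simp add: nn_integral_cmult nn_integral_add emeasure_space_1[simplified])
    also have "\<dots> \<le> ennreal (1 / L) * (1 + ennreal B)" by (intro mult_left_mono add_left_mono elim) simp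
    also have "\<dots> = ennreal (1 / L * (1 + B))" using L B by (subst ennreal_mult) auto
    also have "1 / L * (1 + B) = \<epsilon>" using B \<epsilon> by (simp add: L_def add_nonneg_eq_0_iff)
    finally show ?case .
  qed
  then show ?thesis using L by (intro exI[of _ L]) auto
qed

lemma abs_diff_powr_le:
  fixes x y p :: real
  assumes "0 < p"
  shows "\<bar>x - y\<bar> powr p \<le> 2 powr p * (\<bar>x\<bar> powr p + \<bar>y\<bar> powr p)"
proof -
  have "\<bar>x - y\<bar> powr p \<le> (2 * max \<bar>x\<bar> \<bar>y\<bar>) powr p" using assms by (intro powr_mono2) auto
  also have "\<dots> = 2 powr p * max \<bar>x\<bar> \<bar>y\<bar> powr p" by (rule powr_mult)
  also have "\<dots> \<le> 2 powr p * (\<bar>x\<bar> powr p + \<bar>y\<bar> powr p)" by (intro mult_left_mono) (auto simp: max_def)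
  finally show ?thesis .
qed

text \<open>Skorohod's theorem represents the laws by random variables that converge pointwise. This is a coupling,
  and uniform integrability passes to the limit by Fatou's lemma and then to \<open>\<bar>Y\<^sub>n - X\<bar>\<^sup>p\<close>.\<close>

lemma weak_conv_imp_wasserstein:
  assumes P: "\<And>n. real_distribution (P n)" "real_distribution M" "weak_conv_m P M" and p: "0 < p"
    and ui: "\<And>\<epsilon>. 0 < \<epsilon> \<Longrightarrow>
      \<exists>L\<ge>0. eventually (\<lambda>n. (\<integral>\<^sup>+ x. ennreal (\<bar>x\<bar> powr p - L) \<partial>P n) \<le> ennreal \<epsilon>) sequentially"
  shows "(\<lambda>n. wasserstein_real p (P n) M) \<longlonglongrightarrow> 0"
    and "(\<lambda>n. \<integral>\<^sup>+ x. ennreal (\<bar>x\<bar> powr p) \<partial>P n) \<longlonglongrightarrow> (\<integral>\<^sup>+ x. ennreal (\<bar>x\<bar> powr p) \<partial>M)"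
    and "(\<integral>\<^sup>+ x. ennreal (\<bar>x\<bar> powr p) \<partial>M) < \<infinity>"
proof -
  obtain \<Omega> :: "real measure" and Y X where \<Omega>: "prob_space \<Omega>"
    and Y[measurable]: "\<And>n. Y n \<in> borel_measurable \<Omega>" "X \<in> borel_measurable \<Omega>"
    and law: "\<And>n. distr \<Omega> borel (Y n) = P n" "distr \<Omega> borel X = M"
    and conv: "\<And>x. x \<in> space \<Omega> \<Longrightarrow> (\<lambda>n. Y n x) \<longlonglongrightarrow> X x"
    by (rule skorohod_representation[OF P]) (rule that)
  interpret prob_space \<Omega> by (rule \<Omega>)
  have trY: "(\<integral>\<^sup>+ x. ennreal (\<bar>x\<bar> powr p - L) \<partial>P n) = (\<integral>\<^sup>+ x. ennreal (\<bar>Y n x\<bar> powr p - L) \<partial>\<Omega>)" for n L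
    unfolding law[symmetric] by (subst nn_integral_distr) auto
  have trX: "(\<integral>\<^sup>+ x. ennreal (\<bar>x\<bar> powr p) \<partial>M) = (\<integral>\<^sup>+ x. ennreal (\<bar>X x\<bar> powr p) \<partial>\<Omega>)"
    unfolding law[symmetric] by (subst nn_integral_distr) auto
  have pconv: "(\<lambda>n. \<bar>Y n x\<bar> powr p) \<longlonglongrightarrow> \<bar>X x\<bar> powr p" if "x \<in> space \<Omega>" for x
    using p by (intro tendsto_powr2 tendsto_intros conv that) auto
  have uiY: "\<exists>L\<ge>0. eventually (\<lambda>n. (\<integral>\<^sup>+ x. ennreal (\<bar>Y n x\<bar> powr p - L) \<partial>\<Omega>) \<le> ennreal \<epsilon>) sequentially
      \<and> (\<integral>\<^sup>+ x. ennreal (\<bar>X x\<bar> powr p - L) \<partial>\<Omega>) \<le> ennreal \<epsilon>" if \<epsilon>: "0 < \<epsilon>" for \<epsilon>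
  proof -
    obtain L where L: "0 \<le> L"
      "eventually (\<lambda>n. (\<integral>\<^sup>+ x. ennreal (\<bar>Y n x\<bar> powr p - L) \<partial>\<Omega>) \<le> ennreal \<epsilon>) sequentially"
      using ui[OF \<epsilon>] unfolding trY by blast
    have "(\<integral>\<^sup>+ x. ennreal (\<bar>X x\<bar> powr p - L) \<partial>\<Omega>) \<le> ennreal \<epsilon>"
      by (rule fatou_bound[OF _ _ L(2)]) (auto intro!: tendsto_ennrealI tendsto_diff pconv)
    with L show ?thesis by blast
  qed
  have dom: "(\<lambda>n. \<integral>\<^sup>+ x. ennreal (Z n x) \<partial>\<Omega>) \<longlonglongrightarrow> 0"
    if [measurable]: "\<And>n. Z n \<in> borel_measurable \<Omega>" and nn: "\<And>n x. 0 \<le> Z n x"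
      and Z0: "\<And>x. x \<in> space \<Omega> \<Longrightarrow> (\<lambda>n. Z n x) \<longlonglongrightarrow> 0"
      and le: "\<And>n x. Z n x \<le> c * (\<bar>Y n x\<bar> powr p + \<bar>X x\<bar> powr p)" and c: "0 < c"
    for Z :: "nat \<Rightarrow> real \<Rightarrow> real" and c
  proof (rule uniformly_integrable_tendsto_0[OF \<Omega> that(1) nn Z0])
    fix \<epsilon> :: real assume \<epsilon>: "0 < \<epsilon>"
    define \<delta> where "\<delta> = \<epsilon> / (2 * c)"
    have \<delta>: "0 < \<delta>" "c * (\<delta> + \<delta>) = \<epsilon>" using \<epsilon> c by (auto simp: \<delta>_def)
    obtain L where L: "0 \<le> L"
      "eventually (\<lambda>n. (\<integral>\<^sup>+ x. ennreal (\<bar>Y n x\<bar> powr p - L) \<partial>\<Omega>) \<le> ennreal \<delta>) sequentially"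
      "(\<integral>\<^sup>+ x. ennreal (\<bar>X x\<bar> powr p - L) \<partial>\<Omega>) \<le> ennreal \<delta>" using uiY[OF \<delta>(1)] by blast
    have "eventually (\<lambda>n. (\<integral>\<^sup>+ x. ennreal (Z n x - c * (2 * L)) \<partial>\<Omega>) \<le> ennreal \<epsilon>) sequentially"
      using L(2)
    proof eventually_elim
      case (elim n)
      have "(\<integral>\<^sup>+ x. ennreal (Z n x - c * (2 * L)) \<partial>\<Omega>)
          \<le> (\<integral>\<^sup>+ x. ennreal c * (ennreal (\<bar>Y n x\<bar> powr p - L) + ennreal (\<bar>X x\<bar> powr p - L)) \<partial>\<Omega>)"
      proof (intro nn_integral_mono)
        fix x
        define s where "s = max 0 (\<bar>Y n x\<bar> powr p - L)"
        define t where "t = max 0 (\<bar>X x\<bar> powr p - L)"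
        have "Z n x - c * (2 * L) \<le> c * (\<bar>Y n x\<bar> powr p + \<bar>X x\<bar> powr p) - c * (2 * L)" using le[of n x] by simp
        also have "\<dots> = c * ((\<bar>Y n x\<bar> powr p - L) + (\<bar>X x\<bar> powr p - L))" by (simp add: algebra_simps)
        also have "\<dots> \<le> c * (s + t)" using c by (intro mult_left_mono) (auto simp: s_def t_def)
        finally have "ennreal (Z n x - c * (2 * L)) \<le> ennreal (c * (s + t))" by (rule ennreal_leI)
        also have "\<dots> = ennreal c * (ennreal s + ennreal t)"
          using c by (simp add: ennreal_mult s_def t_def)
        finally show "ennreal (Z n x - c * (2 * L))
            \<le> ennreal c * (ennreal (\<bar>Y n x\<bar> powr p - L) + ennreal (\<bar>X x\<bar> powr p - L))"
          by (simp add: s_def t_def)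
      qed
      also have "\<dots> = ennreal c * ((\<integral>\<^sup>+ x. ennreal (\<bar>Y n x\<bar> powr p - L) \<partial>\<Omega>)
          + (\<integral>\<^sup>+ x. ennreal (\<bar>X x\<bar> powr p - L) \<partial>\<Omega>))" by (simp add: nn_integral_cmult nn_integral_add)
      also have "\<dots> \<le> ennreal c * (ennreal \<delta> + ennreal \<delta>)" by (intro mult_left_mono add_mono elim L(3)) simp
      also have "ennreal \<delta> + ennreal \<delta> = ennreal (\<delta> + \<delta>)" using \<delta>(1) by (intro ennreal_plus[symmetric]) auto
      also have "ennreal c * \<dots> = ennreal (c * (\<delta> + \<delta>))" using c \<delta>(1) by (intro ennreal_mult[symmetric]) auto
      finally show ?case unfolding \<delta>(2) .
    qed
    then show "\<exists>L\<ge>0. eventually (\<lambda>n. (\<integral>\<^sup>+ x. ennreal (Z n x - L) \<partial>\<Omega>) \<le> ennreal \<epsilon>) sequentially"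
      using L(1) c by (intro exI[of _ "c * (2 * L)"]) auto
  qed
  have "(\<lambda>n. \<integral>\<^sup>+ x. ennreal (\<bar>Y n x - X x\<bar> powr p) \<partial>\<Omega>) \<longlonglongrightarrow> 0"
  proof (rule dom[OF _ _ _ abs_diff_powr_le[OF p]])
    fix x assume x: "x \<in> space \<Omega>"
    have "(\<lambda>n. \<bar>Y n x - X x\<bar>) \<longlonglongrightarrow> \<bar>X x - X x\<bar>" by (intro tendsto_intros conv x)
    then have "(\<lambda>n. \<bar>Y n x - X x\<bar> powr p) \<longlonglongrightarrow> 0 powr p"
      using p by (intro tendsto_powr2) auto
    then show "(\<lambda>n. \<bar>Y n x - X x\<bar> powr p) \<longlonglongrightarrow> 0" by simp
  qed auto
  then show "(\<lambda>n. wasserstein_real p (P n) M) \<longlonglongrightarrow> 0"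
    by (rule wasserstein_tendsto_0[OF \<Omega> Y law p])
  define D where "D n = (\<integral>\<^sup>+ x. ennreal \<bar>\<bar>Y n x\<bar> powr p - \<bar>X x\<bar> powr p\<bar> \<partial>\<Omega>)" for n
  define I where "I = (\<integral>\<^sup>+ x. ennreal (\<bar>X x\<bar> powr p) \<partial>\<Omega>)"
  have D: "D \<longlonglongrightarrow> 0"
    unfolding D_def
  proof (rule dom[OF _ _ _ _ zero_less_one])
    fix x assume x: "x \<in> space \<Omega>"
    have "(\<lambda>n. \<bar>\<bar>Y n x\<bar> powr p - \<bar>X x\<bar> powr p\<bar>) \<longlonglongrightarrow> \<bar>\<bar>X x\<bar> powr p - \<bar>X x\<bar> powr p\<bar>"
      by (rule tendsto_rabs[OF tendsto_diff[OF pconv[OF x] tendsto_const]])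
    then show "(\<lambda>n. \<bar>\<bar>Y n x\<bar> powr p - \<bar>X x\<bar> powr p\<bar>) \<longlonglongrightarrow> 0" by simp
  next
    fix n x
    show "\<bar>\<bar>Y n x\<bar> powr p - \<bar>X x\<bar> powr p\<bar> \<le> 1 * (\<bar>Y n x\<bar> powr p + \<bar>X x\<bar> powr p)"
      using abs_triangle_ineq4[of "\<bar>Y n x\<bar> powr p" "\<bar>X x\<bar> powr p"] by simp
  qed auto
  obtain L where L: "0 \<le> L" "(\<integral>\<^sup>+ x. ennreal (\<bar>X x\<bar> powr p - L) \<partial>\<Omega>) \<le> ennreal 1"
    using uiY[of 1] by auto
  have "I \<le> (\<integral>\<^sup>+ x. ennreal L + ennreal (\<bar>X x\<bar> powr p - L) \<partial>\<Omega>)"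
    unfolding I_def
  proof (intro nn_integral_mono)
    fix x
    have "ennreal (\<bar>X x\<bar> powr p) \<le> ennreal (L + max 0 (\<bar>X x\<bar> powr p - L))" by (intro ennreal_leI) auto
    then show "ennreal (\<bar>X x\<bar> powr p) \<le> ennreal L + ennreal (\<bar>X x\<bar> powr p - L)" using L(1) by simp
  qed
  also have "\<dots> = ennreal L + (\<integral>\<^sup>+ x. ennreal (\<bar>X x\<bar> powr p - L) \<partial>\<Omega>)"
    by (simp add: nn_integral_add emeasure_space_1)
  also have "\<dots> < \<top>" using L(2) by (auto simp: ennreal_add_less_top intro: le_less_trans)
  finally have fin: "I < \<top>" .
  then show "(\<integral>\<^sup>+ x. ennreal (\<bar>x\<bar> powr p) \<partial>M) < \<infinity>" by (simp add: trX I_def)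
  have up: "(\<integral>\<^sup>+ x. ennreal (\<bar>Y n x\<bar> powr p) \<partial>\<Omega>) \<le> I + D n" for n
  proof -
    have "(\<integral>\<^sup>+ x. ennreal (\<bar>Y n x\<bar> powr p) \<partial>\<Omega>)
        \<le> (\<integral>\<^sup>+ x. ennreal (\<bar>X x\<bar> powr p) + ennreal \<bar>\<bar>Y n x\<bar> powr p - \<bar>X x\<bar> powr p\<bar> \<partial>\<Omega>)"
      by (intro nn_integral_mono) (auto simp: ennreal_plus[symmetric] simp del: ennreal_plus intro!: ennreal_leI)
    then show ?thesis unfolding I_def D_def by (simp add: nn_integral_add)
  qed
  have lo: "I \<le> (\<integral>\<^sup>+ x. ennreal (\<bar>Y n x\<bar> powr p) \<partial>\<Omega>) + D n" for n
  proof -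
    have "I \<le> (\<integral>\<^sup>+ x. ennreal (\<bar>Y n x\<bar> powr p) + ennreal \<bar>\<bar>Y n x\<bar> powr p - \<bar>X x\<bar> powr p\<bar> \<partial>\<Omega>)"
      unfolding I_def
      by (intro nn_integral_mono) (auto simp: ennreal_plus[symmetric] simp del: ennreal_plus intro!: ennreal_leI)
    then show ?thesis unfolding D_def by (simp add: nn_integral_add)
  qed
  have limY: "(\<lambda>n. \<integral>\<^sup>+ x. ennreal (\<bar>Y n x\<bar> powr p) \<partial>\<Omega>) \<longlonglongrightarrow> I"
  proof (rule tendsto_sandwich)
    show "eventually (\<lambda>n. I - D n \<le> (\<integral>\<^sup>+ x. ennreal (\<bar>Y n x\<bar> powr p) \<partial>\<Omega>)) sequentially"
      using lo less_imp_neq[OF fin] by (intro always_eventually allI) (simp add: ennreal_minus_le_iff add.commute)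
    show "eventually (\<lambda>n. (\<integral>\<^sup>+ x. ennreal (\<bar>Y n x\<bar> powr p) \<partial>\<Omega>) \<le> I + D n) sequentially"
      using up by (intro always_eventually allI)
    have "(\<lambda>n. I - D n) \<longlonglongrightarrow> I - 0"
      using fin by (intro tendsto_diff_ennreal tendsto_const D) auto
    then show "(\<lambda>n. I - D n) \<longlonglongrightarrow> I" by simp
    have "(\<lambda>n. I + D n) \<longlonglongrightarrow> I + 0" by (intro tendsto_add tendsto_const D)
    then show "(\<lambda>n. I + D n) \<longlonglongrightarrow> I" by simp
  qed
  show "(\<lambda>n. \<integral>\<^sup>+ x. ennreal (\<bar>x\<bar> powr p) \<partial>P n) \<longlonglongrightarrow> (\<integral>\<^sup>+ x. ennreal (\<bar>x\<bar> powr p) \<partial>M)"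
    using limY trY[of _ 0] unfolding trX I_def by simp
qed

section \<open>The two bond laws\<close>

lemma bond_law_std_gaussian: "bond_law std_gaussian"
proof -
  interpret prob_space std_gaussian
    unfolding std_gaussian_def by (rule prob_space_normal_density) simp
  have pos: "0 \<le> std_normal_density x" for x by (simp add: normal_density_def)
  show ?thesis
  proof
    show "sets std_gaussian = sets borel" by (simp add: std_gaussian_def)
    show "distr std_gaussian borel uminus = std_gaussian"
    proof (rule measure_eqI)
      fix A assume "A \<in> sets (distr std_gaussian borel uminus)"
      then have [measurable]: "A \<in> sets borel" by simp
      have [measurable]: "uminus -` A \<in> sets borel"
        using measurable_sets[of uminus borel borel A] by simp
      have "emeasure (distr std_gaussian borel uminus) A
          = (\<integral>\<^sup>+ x. ennreal (std_normal_density x) * indicator A (- x) \<partial>lborel)"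
        unfolding std_gaussian_def
        by (subst emeasure_distr, simp, simp, subst emeasure_density)
           (auto intro!: nn_integral_cong simp: indicator_def)
      also have "\<dots> = (\<integral>\<^sup>+ x. ennreal (std_normal_density (- x)) * indicator A x \<partial>lborel)"
        by (subst (2) lborel_distr_uminus[symmetric], subst nn_integral_distr) auto
      also have "\<dots> = emeasure std_gaussian A"
        unfolding std_gaussian_def by (subst emeasure_density) (auto simp: normal_density_def)
      finally show "emeasure (distr std_gaussian borel uminus) A = emeasure std_gaussian A" .
    qed (simp add: std_gaussian_def)
    have "(\<integral>x. x\<^sup>2 \<partial>std_gaussian) = (\<integral>x. std_normal_density x * x ^ (2 * 1) \<partial>lborel)"
      unfolding std_gaussian_def by (subst integral_density) (auto simp: pos)
    also have "\<dots> = 1"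
      using has_bochner_integral_integral_eq[OF std_normal_moment_even[of 1]] by (simp add: fact_numeral)
    finally show "(\<integral>x. x\<^sup>2 \<partial>std_gaussian) = 1" .
    have sh: "integrable lborel (\<lambda>x. std_normal_density x * exp (s * x))" for s :: real
    proof -
      have "std_normal_density x * exp (s * x) = exp (s\<^sup>2 / 2) * normal_density s 1 x" for x
        by (simp add: normal_density_def exp_add[symmetric] power2_eq_square field_simps)
      then show ?thesis using integrable_normal_density[of 1 s] by simp
    qed
    have "integrable lborel (\<lambda>x. std_normal_density x * exp (5 * \<bar>x\<bar>))"
    proof (rule Bochner_Integration.integrable_bound)
      show "integrable lborel (\<lambda>x. std_normal_density x * exp (5 * x) + std_normal_density x * exp ((- 5) * x))"
        by (intro Bochner_Integration.integrable_add sh)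
      have "std_normal_density x * exp (5 * \<bar>x\<bar>)
          \<le> std_normal_density x * exp (5 * x) + std_normal_density x * exp ((- 5) * x)" for x
        using pos[of x] by (cases "0 \<le> x") auto
      then show "AE x in lborel. norm (std_normal_density x * exp (5 * \<bar>x\<bar>))
          \<le> norm (std_normal_density x * exp (5 * x) + std_normal_density x * exp ((- 5) * x))"
        using pos by (intro AE_I2) (simp add: abs_mult)
    qed simp
    then show "integrable std_gaussian (\<lambda>x. exp (5 * \<bar>x\<bar>))"
      unfolding std_gaussian_def by (subst integrable_density) (auto simp: pos)
  qed
qed

lemma bond_law_bounded:
  assumes "prob_space \<nu>" and s: "sets \<nu> = sets borel" and "distr \<nu> borel uminus = \<nu>"
    and b: "AE x in \<nu>. x \<in> {-b..b}" and "(\<integral>x. x\<^sup>2 \<partial>\<nu>) = 1"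
  shows "bond_law \<nu>"
proof -
  interpret prob_space \<nu> by fact
  have [measurable]: "(\<lambda>x. exp (5 * \<bar>x\<bar>)) \<in> borel_measurable \<nu>"
    unfolding measurable_cong_sets[OF s refl] by measurable
  have "integrable \<nu> (\<lambda>x. exp (5 * \<bar>x\<bar>))"
  proof (rule integrable_const_bound[of _ "exp (5 * b)"])
    show "AE x in \<nu>. norm (exp (5 * \<bar>x\<bar>)) \<le> exp (5 * b)" using b by eventually_elim auto
  qed simp
  then show ?thesis using assms by unfold_locales auto
qed

section \<open>Convergence of the susceptibility\<close>

text \<open>The rescaled susceptibility is the case \<open>\<phi> = abs\<close>.\<close>

definition scaled_avg :: "(real \<Rightarrow> real) \<Rightarrow> nat \<Rightarrow> (nat \<times> nat \<Rightarrow> real) \<Rightarrow> real" where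
  "scaled_avg \<phi> N J = replica_avg N J (\<lambda>\<sigma> \<tau>. (\<phi> (real N powr (1/3) * overlap N (\<sigma>, \<tau>)))\<^sup>2)"

definition excess :: "real \<Rightarrow> real \<Rightarrow> real" where
  "excess K x = max 0 (\<bar>x\<bar> - K)"

definition cutoff :: "real \<Rightarrow> real \<Rightarrow> real" where
  "cutoff K x = min \<bar>x\<bar> K"

lemma contraction_abs: "contraction abs"
  by (simp add: contraction_def abs_triangle_ineq3)

lemma contraction_excess: "0 \<le> K \<Longrightarrow> contraction (excess K)"
  unfolding contraction_def excess_def by (auto simp: max_def)

lemma scaled_avg_nonneg: "0 \<le> scaled_avg \<phi> N J"
  unfolding scaled_avg_def by (rule replica_avg_nonneg) simp

lemma rescaled_susceptibility_scaled_avg: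
  assumes "1 \<le> N"
  shows "rescaled_susceptibility N J = scaled_avg abs N J"
  unfolding rescaled_susceptibility_eq[OF assms] scaled_avg_def
  by (subst integral_overlap_measure) auto

lemma scaled_avg_cutoff_le: "scaled_avg (cutoff K) N J \<le> scaled_avg abs N J" if "0 \<le> K"
  unfolding scaled_avg_def
  by (intro replica_avg_mono power_mono) (use that in \<open>auto simp: cutoff_def\<close>)

text \<open>Where \<open>\<bar>x\<bar> > 2 K\<close> one has \<open>\<bar>x\<bar> \<le> 2 (\<bar>x\<bar> - K)\<close>.\<close>

lemma scaled_avg_abs_le:
  assumes "0 \<le> K"
  shows "scaled_avg abs N J \<le> scaled_avg (cutoff (2 * K)) N J + 4 * scaled_avg (excess K) N J"
proof -
  have "\<bar>x\<bar>\<^sup>2 \<le> (cutoff (2 * K) x)\<^sup>2 + 4 * (excess K x)\<^sup>2" for x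
  proof (cases "\<bar>x\<bar> \<le> 2 * K")
    case False
    then have "\<bar>x\<bar>\<^sup>2 \<le> (2 * excess K x)\<^sup>2"
      using assms by (intro power_mono) (auto simp: excess_def)
    then show ?thesis by (simp add: power_mult_distrib add_increasing)
  qed (simp add: cutoff_def)
  then show ?thesis
    unfolding scaled_avg_def replica_avg_cmult[symmetric] replica_avg_add[symmetric]
    by (intro replica_avg_mono)
qed

lemma scaled_avg_cutoff_bound: "0 \<le> K \<Longrightarrow> scaled_avg (cutoff K) N J \<le> K\<^sup>2"
  using replica_avg_mono[of N "\<lambda>\<sigma> \<tau>. (cutoff K (real N powr (1/3) * overlap N (\<sigma>, \<tau>)))\<^sup>2" "\<lambda>_ _. K\<^sup>2" J]
  by (auto simp: scaled_avg_def replica_avg_const cutoff_def intro!: power_mono)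

lemma cts_step_Lipschitz:
  assumes "a < b"
  shows "\<bar>cts_step a b x - cts_step a b y\<bar> \<le> 1 / (b - a) * \<bar>x - y\<bar>"
proof -
  have e: "cts_step a b x = max 0 (min 1 ((b - x) / (b - a)))" for x
    using assms by (auto simp: cts_step_def max_def min_def field_simps)
  have "\<bar>max 0 (min 1 s) - max 0 (min 1 t)\<bar> \<le> \<bar>s - t\<bar>" for s t :: real by linarith
  from this[of "(b - x) / (b - a)" "(b - y) / (b - a)"]
  show ?thesis using assms unfolding e by (simp add: diff_divide_distrib[symmetric] abs_divide abs_minus_commute)
qed

lemma cts_step_bounded: "a < b \<Longrightarrow> \<bar>cts_step a b x\<bar> \<le> 1"
  by (auto simp: cts_step_def field_simps)

locale universality = two_bond_laws std_gaussian \<nu> + L: gaussian_limit \<Omega> \<zeta>_star \<mu>_star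
  for \<nu> :: "real measure" and \<Omega> :: "'w measure" and \<zeta>_star :: "real measure measure"
    and \<mu>_star :: "'w \<Rightarrow> real measure"
begin

definition S_star :: "'w \<Rightarrow> real" where
  "S_star \<omega> = (\<integral>x. x\<^sup>2 \<partial>\<mu>_star \<omega>)"

lemma S_star_eq: "S_star \<omega> = (L2_size abs (\<mu>_star \<omega>))\<^sup>2"
  by (simp add: S_star_def L2_size_power2)

lemma measurable_S_star[measurable]: "S_star \<in> borel_measurable \<Omega>"
proof -
  note [measurable] = L.measurable_L2_size_star[OF contraction_abs]
  show ?thesis unfolding S_star_eq[abs_def] by measurable
qed

lemma integrable_S_star: "integrable \<Omega> S_star"
  unfolding S_star_eq[abs_def] by (rule L.integrable_L2_size_star[OF contraction_abs])

lemma measurable_scaled_avg[measurable]: "scaled_avg \<phi> N \<in> borel_measurable (hybrid N T)"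
  unfolding scaled_avg_def[abs_def] by measurable

lemma integrable_scaled_avg: "integrable (hybrid N T) (scaled_avg \<phi> N)"
  unfolding scaled_avg_def[abs_def] by (rule hybrid_integrable_replica_avg)

lemma measurable_disorder: "f \<in> borel_measurable (hybrid N T) \<Longrightarrow> f \<in> borel_measurable (disorder \<nu> N)"
  using hybrid_measurable_cong[of f N "edges N" T] by (simp add: hybrid_edges)

lemma expected_scaled_avg:
  assumes "contraction \<phi>"
  shows "(\<lambda>N. \<integral>J. scaled_avg \<phi> N J \<partial>disorder std_gaussian N) \<longlonglongrightarrow> (\<integral>\<omega>. (L2_size \<phi> (\<mu>_star \<omega>))\<^sup>2 \<partial>\<Omega>)"
  unfolding scaled_avg_def using L.gaussian_convergence[OF assms, of "\<lambda>x. x" 1] by simp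

lemma excess_star_small:
  assumes "0 < \<delta>"
  shows "\<exists>K\<ge>1. (\<integral>\<omega>. (L2_size (excess K) (\<mu>_star \<omega>))\<^sup>2 \<partial>\<Omega>) < \<delta>"
proof -
  have sq: "(excess (real n) x)\<^sup>2 \<le> x\<^sup>2" for n x
    unfolding power2_abs[of x, symmetric] by (rule power_mono) (auto simp: excess_def)
  have c: "contraction (excess (real n))" for n by (rule contraction_excess) simp
  have inner: "(\<lambda>n. (L2_size (excess (real n)) \<mu>)\<^sup>2) \<longlonglongrightarrow> 0" if \<mu>: "\<mu> \<in> P2" for \<mu>
  proof -
    have "(\<lambda>n. \<integral>x. (excess (real n) x)\<^sup>2 \<partial>\<mu>) \<longlonglongrightarrow> (\<integral>x. 0 \<partial>\<mu>)"
    proof (rule integral_dominated_convergence[where w = "\<lambda>x. x\<^sup>2"])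
      show "(\<lambda>x. (excess (real n) x)\<^sup>2) \<in> borel_measurable \<mu>" for n
        using borel_measurable_integrable[OF contraction_integrable[OF c \<mu>]] .
      show "AE x in \<mu>. (\<lambda>n. (excess (real n) x)\<^sup>2) \<longlonglongrightarrow> 0"
      proof (rule AE_I2, rule tendsto_eventually)
        fix x :: real
        obtain n0 where "\<bar>x\<bar> \<le> real n0" using real_arch_simple by blast
        then show "\<forall>\<^sub>F n in sequentially. (excess (real n) x)\<^sup>2 = 0"
          by (intro eventually_sequentiallyI[of n0]) (auto simp: excess_def)
      qed
    qed (use P2_D(4)[OF \<mu>] sq in auto)
    then show ?thesis by (simp add: L2_size_power2)
  qed
  have "(\<lambda>n. \<integral>\<omega>. (L2_size (excess (real n)) (\<mu>_star \<omega>))\<^sup>2 \<partial>\<Omega>) \<longlonglongrightarrow> (\<integral>\<omega>. 0 \<partial>\<Omega>)"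
  proof (rule integral_dominated_convergence[where w = S_star])
    show "AE \<omega> in \<Omega>. (\<lambda>n. (L2_size (excess (real n)) (\<mu>_star \<omega>))\<^sup>2) \<longlonglongrightarrow> 0"
      by (intro AE_I2 inner L.\<mu>_star_P2)
    show "AE \<omega> in \<Omega>. norm ((L2_size (excess (real n)) (\<mu>_star \<omega>))\<^sup>2) \<le> S_star \<omega>" for n
    proof (rule AE_I2)
      fix \<omega> assume "\<omega> \<in> space \<Omega>"
      then have "(\<integral>x. (excess (real n) x)\<^sup>2 \<partial>\<mu>_star \<omega>) \<le> (\<integral>x. x\<^sup>2 \<partial>\<mu>_star \<omega>)"
        by (intro integral_mono contraction_integrable[OF c] P2_D(4) sq L.\<mu>_star_P2)
      then show "norm ((L2_size (excess (real n)) (\<mu>_star \<omega>))\<^sup>2) \<le> S_star \<omega>"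
        by (simp add: L2_size_power2 S_star_def)
    qed
    show "(\<lambda>\<omega>. (L2_size (excess (real n)) (\<mu>_star \<omega>))\<^sup>2) \<in> borel_measurable \<Omega>" for n
      using borel_measurable_integrable[OF L.integrable_L2_size_star[OF c]] .
  qed (use integrable_S_star in auto)
  then have "eventually (\<lambda>n. (\<integral>\<omega>. (L2_size (excess (real n)) (\<mu>_star \<omega>))\<^sup>2 \<partial>\<Omega>) < \<delta>) sequentially"
    using assms by (intro order_tendstoD) auto
  then obtain n0 where "\<And>n. n0 \<le> n \<Longrightarrow> (\<integral>\<omega>. (L2_size (excess (real n)) (\<mu>_star \<omega>))\<^sup>2 \<partial>\<Omega>) < \<delta>"
    by (auto simp: eventually_sequentially)
  from this[of "max n0 1"] show ?thesis by (intro exI[of _ "real (max n0 1)"]) auto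
qed

lemma moment_transfer_disorder:
  "\<exists>C N0. 1 \<le> N0 \<and> 1 \<le> C \<and> (\<forall>N\<ge>N0. \<forall>B. (\<forall>\<sigma> \<tau>. 0 \<le> B \<sigma> \<tau>) \<longrightarrow>
    (\<integral>J. replica_avg N J B \<partial>disorder \<nu> N) \<le> C * (\<integral>J. replica_avg N J B \<partial>disorder std_gaussian N))"
proof -
  obtain C N0 where C: "1 \<le> N0" "1 \<le> C" "\<forall>N\<ge>N0. \<forall>T\<subseteq>edges N. \<forall>B. (\<forall>\<sigma> \<tau>. 0 \<le> B \<sigma> \<tau>) \<longrightarrow>
      (\<integral>J. replica_avg N J B \<partial>hybrid N T) \<le> C * (\<integral>J. replica_avg N J B \<partial>disorder std_gaussian N)"
    using moment_transfer by blast
  have "(\<integral>J. replica_avg N J B \<partial>disorder \<nu> N) \<le> C * (\<integral>J. replica_avg N J B \<partial>disorder std_gaussian N)"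
    if "N0 \<le> N" "\<forall>\<sigma> \<tau>. 0 \<le> B \<sigma> \<tau>" for N B
    using C(3)[rule_format, of N "edges N" B] that by (simp add: hybrid_edges)
  then show ?thesis using C(1,2) by blast
qed

text \<open>Under Gaussian disorder the tails converge to those of \<open>\<mu>_star\<close>; moment transfer carries the bound to
  \<open>\<nu>\<close>-disorder.\<close>

lemma excess_small:
  assumes "0 < \<delta>"
  obtains K where "1 \<le> K"
    "eventually (\<lambda>N. (\<integral>J. scaled_avg (excess K) N J \<partial>disorder std_gaussian N) \<le> \<delta>) sequentially"
    "eventually (\<lambda>N. (\<integral>J. scaled_avg (excess K) N J \<partial>disorder \<nu> N) \<le> \<delta>) sequentially"
proof -
  obtain C N0 where C: "1 \<le> N0" "1 \<le> C" "\<forall>N\<ge>N0. \<forall>B. (\<forall>\<sigma> \<tau>. 0 \<le> B \<sigma> \<tau>) \<longrightarrow>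
    (\<integral>J. replica_avg N J B \<partial>disorder \<nu> N) \<le> C * (\<integral>J. replica_avg N J B \<partial>disorder std_gaussian N)"
    using moment_transfer_disorder by blast
  obtain K where K: "1 \<le> K" "(\<integral>\<omega>. (L2_size (excess K) (\<mu>_star \<omega>))\<^sup>2 \<partial>\<Omega>) < \<delta> / C"
    using excess_star_small[of "\<delta> / C"] assms C(2) by auto
  have ev: "eventually (\<lambda>N. (\<integral>J. scaled_avg (excess K) N J \<partial>disorder std_gaussian N) < \<delta> / C) sequentially"
    using expected_scaled_avg[OF contraction_excess[of K]] K by (intro order_tendstoD) auto
  have dC: "\<delta> / C \<le> \<delta>" using assms C(2) by (simp add: divide_le_eq mult_le_cancel_left1)
  show thesis
  proof (rule that[OF K(1)])
    show "eventually (\<lambda>N. (\<integral>J. scaled_avg (excess K) N J \<partial>disorder std_gaussian N) \<le> \<delta>) sequentially"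
      using ev by eventually_elim (use dC in linarith)
    show "eventually (\<lambda>N. (\<integral>J. scaled_avg (excess K) N J \<partial>disorder \<nu> N) \<le> \<delta>) sequentially"
      using ev eventually_ge_at_top[of N0]
    proof eventually_elim
      case (elim N)
      have "(\<integral>J. scaled_avg (excess K) N J \<partial>disorder \<nu> N) \<le> C * (\<integral>J. scaled_avg (excess K) N J \<partial>disorder std_gaussian N)"
        unfolding scaled_avg_def by (rule C(3)[rule_format, OF elim(2)]) simp
      also have "\<dots> \<le> C * (\<delta> / C)" using elim(1) C(2) by (intro mult_left_mono) auto
      also have "\<dots> = \<delta>" using C(2) by simp
      finally show ?case .
    qed
  qed
qed

lemma cutoff_error:
  assumes K: "0 \<le> K" and f: "\<And>x y. \<bar>f x - f y\<bar> \<le> \<Lambda> * \<bar>x - y\<bar>" "\<And>x. \<bar>f x\<bar> \<le> (1::real)" "f \<in> borel_measurable borel" "0 \<le> \<Lambda>"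
  shows "\<bar>(\<integral>J. f (scaled_avg abs N J) \<partial>hybrid N T) - (\<integral>J. f (scaled_avg (cutoff (2 * K)) N J) \<partial>hybrid N T)\<bar>
    \<le> 4 * \<Lambda> * (\<integral>J. scaled_avg (excess K) N J \<partial>hybrid N T)"
proof -
  note [measurable] = f(3)
  have i: "integrable (hybrid N T) (\<lambda>J. f (scaled_avg \<phi> N J))" for \<phi>
    by (rule hybrid_integrable[of _ _ _ 1]) (use f in auto)
  have "\<bar>(\<integral>J. f (scaled_avg abs N J) \<partial>hybrid N T) - (\<integral>J. f (scaled_avg (cutoff (2 * K)) N J) \<partial>hybrid N T)\<bar>
      = \<bar>\<integral>J. f (scaled_avg abs N J) - f (scaled_avg (cutoff (2 * K)) N J) \<partial>hybrid N T\<bar>"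
    using i by simp
  also have "\<dots> \<le> (\<integral>J. \<Lambda> * (4 * scaled_avg (excess K) N J) \<partial>hybrid N T)"
  proof (rule order_trans[OF integral_abs_bound integral_mono])
    fix J
    have "\<bar>scaled_avg abs N J - scaled_avg (cutoff (2 * K)) N J\<bar> \<le> 4 * scaled_avg (excess K) N J"
      using scaled_avg_abs_le[OF K, of N J] scaled_avg_cutoff_le[of "2 * K" N J] K by simp
    then show "\<bar>f (scaled_avg abs N J) - f (scaled_avg (cutoff (2 * K)) N J)\<bar> \<le> \<Lambda> * (4 * scaled_avg (excess K) N J)"
      by (rule order_trans[OF f(1) mult_left_mono[OF _ f(4)]])
  qed (use i integrable_scaled_avg in auto)
  finally show ?thesis by simp
qed

text \<open>Truncation, universality of the truncated average, and removal of the truncation under Gaussian disorder lead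
  from \<open>\<nu>\<close>-disorder to the Gaussian susceptibility, whose limit is known.\<close>

lemma Lipschitz_convergence:
  fixes f :: "real \<Rightarrow> real"
  assumes f: "\<And>x y. \<bar>f x - f y\<bar> \<le> \<Lambda> * \<bar>x - y\<bar>" "\<And>x. \<bar>f x\<bar> \<le> 1" and \<Lambda>: "0 < \<Lambda>"
  shows "(\<lambda>N. \<integral>J. f (scaled_avg abs N J) \<partial>disorder \<nu> N) \<longlonglongrightarrow> (\<integral>\<omega>. f (S_star \<omega>) \<partial>\<Omega>)"
proof (rule LIMSEQ_I)
  have cf: "continuous_on UNIV f"
    using \<Lambda> f(1) by (intro lipschitz_on_continuous_on[of \<Lambda>]) (auto simp: lipschitz_on_def dist_real_def)
  have fm: "f \<in> borel_measurable borel" by (rule borel_measurable_continuous_onI[OF cf])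
  fix e :: real assume e: "0 < e"
  define \<delta> where "\<delta> = e / (16 * \<Lambda>)"
  have \<delta>: "0 < \<delta>" "4 * \<Lambda> * \<delta> = e / 4" using e \<Lambda> by (auto simp: \<delta>_def)
  obtain K where K: "1 \<le> K"
    "eventually (\<lambda>N. (\<integral>J. scaled_avg (excess K) N J \<partial>disorder std_gaussian N) \<le> \<delta>) sequentially"
    "eventually (\<lambda>N. (\<integral>J. scaled_avg (excess K) N J \<partial>disorder \<nu> N) \<le> \<delta>) sequentially"
    using excess_small[OF \<delta>(1)] by blast
  \<comment> \<open>The limit of the Gaussian means plus \<open>1\<close> bounds them eventually.\<close>
  define s where "s = (\<integral>\<omega>. (L2_size abs (\<mu>_star \<omega>))\<^sup>2 \<partial>\<Omega>) + 1"
  have "eventually (\<lambda>N. (\<integral>J. scaled_avg abs N J \<partial>disorder std_gaussian N) < s) sequentially"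
    using expected_scaled_avg[OF contraction_abs] by (rule order_tendstoD) (simp add: s_def)
  then have s: "eventually (\<lambda>N. (\<integral>J. replica_avg N J (\<lambda>\<sigma> \<tau>. (real N powr (1/3) * overlap N (\<sigma>, \<tau>))\<^sup>2) \<partial>disorder std_gaussian N) \<le> s) sequentially"
    by eventually_elim (simp add: scaled_avg_def)
  have "(\<lambda>N. (\<integral>J. f (scaled_avg (cutoff (2 * K)) N J) \<partial>disorder \<nu> N)
      - (\<integral>J. f (scaled_avg (cutoff (2 * K)) N J) \<partial>disorder std_gaussian N)) \<longlonglongrightarrow> 0"
    unfolding scaled_avg_def
  proof (rule continuous_universality[OF _ _ _ s cf])
    show "1 \<le> (2 * K)\<^sup>2" using K(1) by (intro one_le_power) auto
    show "(cutoff (2 * K) (real N powr (1/3) * overlap N (\<sigma>, \<tau>)))\<^sup>2 \<le> (2 * K)\<^sup>2" for N \<sigma> \<tau>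
      using K(1) by (intro power_mono) (auto simp: cutoff_def)
  qed simp
  then have u: "eventually (\<lambda>N. \<bar>(\<integral>J. f (scaled_avg (cutoff (2 * K)) N J) \<partial>disorder \<nu> N)
      - (\<integral>J. f (scaled_avg (cutoff (2 * K)) N J) \<partial>disorder std_gaussian N)\<bar> < e / 4) sequentially"
    using e by (auto dest!: tendstoD[of _ _ _ "e / 4"] simp: dist_real_def)
  have "(\<lambda>N. \<integral>J. f (scaled_avg abs N J) \<partial>disorder std_gaussian N) \<longlonglongrightarrow> (\<integral>\<omega>. f (S_star \<omega>) \<partial>\<Omega>)"
    unfolding S_star_eq scaled_avg_def
    by (rule L.gaussian_convergence[OF contraction_abs f(1) fm]) (use \<Lambda> in auto)
  then have g: "eventually (\<lambda>N. \<bar>(\<integral>J. f (scaled_avg abs N J) \<partial>disorder std_gaussian N) - (\<integral>\<omega>. f (S_star \<omega>) \<partial>\<Omega>)\<bar> < e / 4) sequentially"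
    using e by (auto dest!: tendstoD[of _ _ _ "e / 4"] simp: dist_real_def)
  have "eventually (\<lambda>N. norm ((\<integral>J. f (scaled_avg abs N J) \<partial>disorder \<nu> N) - (\<integral>\<omega>. f (S_star \<omega>) \<partial>\<Omega>)) < e) sequentially"
    using u g K(2,3)
  proof eventually_elim
    case (elim N)
    have K0: "0 \<le> K" and \<Lambda>0: "0 \<le> \<Lambda>" using K(1) \<Lambda> by auto
    have l: "4 * \<Lambda> * x \<le> e / 4" if "x \<le> \<delta>" for x
      using mult_left_mono[OF that, of "4 * \<Lambda>"] \<delta>(2) \<Lambda> by simp
    show ?case
      using elim(1,2) l[OF elim(3)] l[OF elim(4)]
        cutoff_error[OF K0 f fm \<Lambda>0, of N "edges N"] cutoff_error[OF K0 f fm \<Lambda>0, of N "{}"]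
      unfolding hybrid_edges hybrid_empty real_norm_def by linarith
  qed
  then show "\<exists>no. \<forall>N\<ge>no. norm ((\<integral>J. f (scaled_avg abs N J) \<partial>disorder \<nu> N) - (\<integral>\<omega>. f (S_star \<omega>) \<partial>\<Omega>)) < e"
    by (simp add: eventually_sequentially)
qed

lemma measurable_susceptibility: "rescaled_susceptibility N \<in> borel_measurable (disorder \<nu> N)"
proof (cases "1 \<le> N")
  case True
  then have "rescaled_susceptibility N = scaled_avg abs N"
    by (intro ext rescaled_susceptibility_scaled_avg)
  then show ?thesis using measurable_disorder[OF measurable_scaled_avg] by simp
next
  case False
  then have "rescaled_susceptibility N = (\<lambda>_. 0)" by (auto simp: rescaled_susceptibility_def)
  then show ?thesis by simp
qed

lemma prob_space_disorder: "prob_space (disorder \<nu> N)"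
  using prob_space_hybrid[of N "edges N"] by (simp add: hybrid_edges)

lemma real_distribution_law_S: "real_distribution (law_S \<nu> N)"
proof -
  interpret D: prob_space "disorder \<nu> N" by (rule prob_space_disorder)
  show ?thesis unfolding law_S_def by (rule D.real_distribution_distr) (rule measurable_susceptibility)
qed

lemma weak_convergence: "weak_conv_m (law_S \<nu>) (distr \<Omega> borel S_star)"
proof (rule integral_cts_step_conv_imp_weak_conv[OF real_distribution_law_S])
  show "real_distribution (distr \<Omega> borel S_star)" by (rule L.real_distribution_distr) measurable
  fix a b :: real assume ab: "a < b"
  have cf: "continuous_on UNIV (cts_step a b)"
    using ab cts_step_Lipschitz[OF ab]
    by (intro lipschitz_on_continuous_on[of "1 / (b - a)"]) (auto simp: lipschitz_on_def dist_real_def)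
  have [measurable]: "cts_step a b \<in> borel_measurable borel" by (rule borel_measurable_continuous_onI[OF cf])
  note [measurable] = measurable_susceptibility
  have "(\<lambda>N. \<integral>J. cts_step a b (scaled_avg abs N J) \<partial>disorder \<nu> N) \<longlonglongrightarrow> (\<integral>\<omega>. cts_step a b (S_star \<omega>) \<partial>\<Omega>)"
    using ab by (intro Lipschitz_convergence[of _ "1 / (b - a)"] cts_step_Lipschitz cts_step_bounded) auto
  moreover have "eventually (\<lambda>N. (\<integral>J. cts_step a b (scaled_avg abs N J) \<partial>disorder \<nu> N)
      = integral\<^sup>L (law_S \<nu> N) (cts_step a b)) sequentially"
    using eventually_ge_at_top[of 1]
  proof eventually_elim
    case (elim N)
    show ?case
      unfolding law_S_def by (subst integral_distr) (simp_all add: rescaled_susceptibility_scaled_avg[OF elim])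
  qed
  moreover have "integral\<^sup>L (distr \<Omega> borel S_star) (cts_step a b) = (\<integral>\<omega>. cts_step a b (S_star \<omega>) \<partial>\<Omega>)"
    by (subst integral_distr) auto
  ultimately show "(\<lambda>N. integral\<^sup>L (law_S \<nu> N) (cts_step a b)) \<longlonglongrightarrow> integral\<^sup>L (distr \<Omega> borel S_star) (cts_step a b)"
    by (auto elim: Lim_transform_eventually)
qed

lemma nn_integral_law_S:
  assumes "1 \<le> N" "g \<in> borel_measurable borel"
  shows "(\<integral>\<^sup>+ x. g x \<partial>law_S \<nu> N) = (\<integral>\<^sup>+ J. g (scaled_avg abs N J) \<partial>disorder \<nu> N)"
  unfolding law_S_def
  by (subst nn_integral_distr[OF measurable_susceptibility])
     (simp_all add: assms(2) rescaled_susceptibility_scaled_avg[OF assms(1)])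

lemma W1_convergence:
  "(\<lambda>N. wasserstein_real 1 (law_S \<nu> N) (distr \<Omega> borel S_star)) \<longlonglongrightarrow> 0"
proof (rule weak_conv_imp_wasserstein(1)[OF real_distribution_law_S _ weak_convergence])
  show "real_distribution (distr \<Omega> borel S_star)" by (rule L.real_distribution_distr) measurable
  fix \<epsilon> :: real assume "0 < \<epsilon>"
  then have e4: "0 < \<epsilon> / 4" by simp
  obtain K where K: "1 \<le> K"
    "eventually (\<lambda>N. (\<integral>J. scaled_avg (excess K) N J \<partial>disorder std_gaussian N) \<le> \<epsilon> / 4) sequentially"
    "eventually (\<lambda>N. (\<integral>J. scaled_avg (excess K) N J \<partial>disorder \<nu> N) \<le> \<epsilon> / 4) sequentially"
    by (rule excess_small[OF e4]) (rule that)
  have "eventually (\<lambda>N. (\<integral>\<^sup>+ x. ennreal (\<bar>x\<bar> - (2 * K)\<^sup>2) \<partial>law_S \<nu> N) \<le> ennreal \<epsilon>) sequentially"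
    using K(3) eventually_ge_at_top[of 1]
  proof eventually_elim
    case (elim N)
    have i: "integrable (disorder \<nu> N) (scaled_avg (excess K) N)"
      using integrable_scaled_avg[of N "edges N"] by (simp add: hybrid_edges)
    have "(\<integral>\<^sup>+ x. ennreal (\<bar>x\<bar> - (2 * K)\<^sup>2) \<partial>law_S \<nu> N) = (\<integral>\<^sup>+ J. ennreal (\<bar>scaled_avg abs N J\<bar> - (2 * K)\<^sup>2) \<partial>disorder \<nu> N)"
      by (rule nn_integral_law_S[OF elim(2)]) measurable
    also have "\<dots> \<le> (\<integral>\<^sup>+ J. ennreal (4 * scaled_avg (excess K) N J) \<partial>disorder \<nu> N)"
    proof (intro nn_integral_mono ennreal_leI)
      fix J
      show "\<bar>scaled_avg abs N J\<bar> - (2 * K)\<^sup>2 \<le> 4 * scaled_avg (excess K) N J"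
        using scaled_avg_abs_le[of K N J] scaled_avg_cutoff_bound[of "2 * K" N J] scaled_avg_nonneg[of abs N J] K(1)
        by simp
    qed
    also have "\<dots> = ennreal (4 * (\<integral>J. scaled_avg (excess K) N J \<partial>disorder \<nu> N))"
      using i by (subst nn_integral_eq_integral) (auto simp: scaled_avg_nonneg)
    also have "\<dots> \<le> ennreal \<epsilon>" using elim(1) by (intro ennreal_leI) simp
    finally show ?case .
  qed
  then show "\<exists>L\<ge>0. eventually (\<lambda>N. (\<integral>\<^sup>+ x. ennreal (\<bar>x\<bar> powr 1 - L) \<partial>law_S \<nu> N) \<le> ennreal \<epsilon>) sequentially"
    by (intro exI[of _ "(2 * K)\<^sup>2"]) auto
qed simp

end

text \<open>Jensen's inequality, from Bernoulli's inequality at \<open>B / \<langle>B\<rangle>\<close>.\<close>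

lemma replica_avg_power_le:
  assumes B: "\<And>\<sigma> \<tau>. 0 \<le> B \<sigma> \<tau>"
  shows "replica_avg N J B ^ k \<le> replica_avg N J (\<lambda>\<sigma> \<tau>. B \<sigma> \<tau> ^ k)"
proof (cases "replica_avg N J B = 0")
  case True
  then show ?thesis
    by (cases k) (auto simp: replica_avg_const intro!: replica_avg_nonneg mult_nonneg_nonneg zero_le_power B)
next
  case False
  define a where "a = replica_avg N J B"
  have a: "0 < a" unfolding a_def using False replica_avg_nonneg[of N B J] B by fastforce
  have "1 + real k * (1 / a * B \<sigma> \<tau> - 1) \<le> (1 / a) ^ k * B \<sigma> \<tau> ^ k" for \<sigma> \<tau>
    using Bernoulli_inequality[of "1 / a * B \<sigma> \<tau> - 1" k] B[of \<sigma> \<tau>] a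
    by (simp add: power_mult_distrib[symmetric])
  then have "replica_avg N J (\<lambda>\<sigma> \<tau>. 1 + real k * (1 / a * B \<sigma> \<tau> - 1))
      \<le> replica_avg N J (\<lambda>\<sigma> \<tau>. (1 / a) ^ k * B \<sigma> \<tau> ^ k)" by (intro replica_avg_mono)
  also have "replica_avg N J (\<lambda>\<sigma> \<tau>. 1 + real k * (1 / a * B \<sigma> \<tau> - 1)) = 1"
    unfolding replica_avg_add replica_avg_cmult replica_avg_diff replica_avg_const
    using a by (simp add: a_def[symmetric])
  finally have "1 \<le> (1 / a) ^ k * replica_avg N J (\<lambda>\<sigma> \<tau>. B \<sigma> \<tau> ^ k)"
    unfolding replica_avg_cmult .
  then show ?thesis using a by (simp add: a_def[symmetric] power_one_over field_simps)
qed

lemma power_div_fact_le_exp: "0 \<le> x \<Longrightarrow> x ^ k / fact k \<le> exp x" for x :: real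
proof -
  assume x: "0 \<le> x"
  have "(\<lambda>n. x ^ n /\<^sub>R fact n) sums exp x" by (rule exp_converges)
  then have "sum (\<lambda>n. x ^ n /\<^sub>R fact n) {k} \<le> exp x"
    using x by (intro sum_le_suminf[THEN order_trans]) (auto simp: sums_iff)
  then show ?thesis by (simp add: divide_inverse mult.commute)
qed

context universality
begin

text \<open>The exponential moment bounds the Gaussian moments of the overlap, moment transfer carries them to
  \<open>\<nu>\<close>-disorder, and Jensen's inequality turns them into moments of the susceptibility.\<close>

lemma Wp_convergence:
  assumes c: "0 < c" and exp_bd: "(SUP N\<in>{2..}. \<integral>\<^sup>+ J. (\<integral>\<^sup>+ r. ennreal (exp (c * real N powr (1/3) * \<bar>overlap N r\<bar>))
            \<partial>two_replicas N J) \<partial>disorder std_gaussian N) \<le> ennreal M"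
    and p: "1 \<le> p"
  shows "(\<lambda>N. wasserstein_real p (law_S \<nu> N) (distr \<Omega> borel S_star)) \<longlonglongrightarrow> 0"
    and "(\<lambda>N. \<integral>\<^sup>+ J. ennreal (rescaled_susceptibility N J powr p) \<partial>disorder \<nu> N)
           \<longlonglongrightarrow> (\<integral>\<^sup>+ \<omega>. ennreal (S_star \<omega> powr p) \<partial>\<Omega>)"
    and "(\<integral>\<^sup>+ \<omega>. ennreal (S_star \<omega> powr p) \<partial>\<Omega>) < \<infinity>"
proof -
  obtain k :: nat where k: "2 * p \<le> real k" using real_arch_simple by blast
  obtain C N0 where C: "1 \<le> N0" "1 \<le> C" "\<forall>N\<ge>N0. \<forall>B. (\<forall>\<sigma> \<tau>. 0 \<le> B \<sigma> \<tau>) \<longrightarrow>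
    (\<integral>J. replica_avg N J B \<partial>disorder \<nu> N) \<le> C * (\<integral>J. replica_avg N J B \<partial>disorder std_gaussian N)"
    using moment_transfer_disorder by blast
  define M' where "M' = max 0 M"
  define F where "F = fact (2 * k) / c ^ (2 * k)"
  have F: "0 \<le> F" using c by (simp add: F_def)
  have gauss: "(\<integral>J. replica_avg N J (\<lambda>\<sigma> \<tau>. exp (c * real N powr (1/3) * \<bar>overlap N (\<sigma>, \<tau>)\<bar>)) \<partial>disorder std_gaussian N) \<le> M'"
    if N: "2 \<le> N" for N
  proof -
    let ?E = "\<lambda>r. exp (c * real N powr (1/3) * \<bar>overlap N r\<bar>)"
    have i: "integrable (disorder std_gaussian N) (\<lambda>J. replica_avg N J (\<lambda>\<sigma> \<tau>. ?E (\<sigma>, \<tau>)))"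
      using hybrid_integrable_replica_avg[of N "{}" "\<lambda>\<sigma> \<tau>. ?E (\<sigma>, \<tau>)"] by (simp add: hybrid_empty)
    have "(\<integral>\<^sup>+ r. ennreal (?E r) \<partial>two_replicas N J) = ennreal (replica_avg N J (\<lambda>\<sigma> \<tau>. ?E (\<sigma>, \<tau>)))" for J
    proof -
      note [measurable] = overlap_measurable[of N J]
      show ?thesis by (rule nn_integral_two_replicas) auto
    qed
    then have "(\<integral>\<^sup>+ J. (\<integral>\<^sup>+ r. ennreal (?E r) \<partial>two_replicas N J) \<partial>disorder std_gaussian N)
        = (\<integral>\<^sup>+ J. ennreal (replica_avg N J (\<lambda>\<sigma> \<tau>. ?E (\<sigma>, \<tau>))) \<partial>disorder std_gaussian N)" by simp
    also have "\<dots> = ennreal (\<integral>J. replica_avg N J (\<lambda>\<sigma> \<tau>. ?E (\<sigma>, \<tau>)) \<partial>disorder std_gaussian N)"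
      by (rule nn_integral_eq_integral[OF i]) (auto intro!: AE_I2 replica_avg_nonneg)
    finally have eq: "(\<integral>\<^sup>+ J. (\<integral>\<^sup>+ r. ennreal (?E r) \<partial>two_replicas N J) \<partial>disorder std_gaussian N)
        = ennreal (\<integral>J. replica_avg N J (\<lambda>\<sigma> \<tau>. ?E (\<sigma>, \<tau>)) \<partial>disorder std_gaussian N)" .
    have "ennreal (\<integral>J. replica_avg N J (\<lambda>\<sigma> \<tau>. ?E (\<sigma>, \<tau>)) \<partial>disorder std_gaussian N) \<le> ennreal M"
      unfolding eq[symmetric] by (rule order_trans[OF SUP_upper exp_bd]) (use N in simp)
    also have "\<dots> \<le> ennreal M'" by (intro ennreal_leI) (simp add: M'_def)
    finally show ?thesis by (subst (asm) ennreal_le_iff) (simp_all add: M'_def)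
  qed
  have mom: "eventually (\<lambda>N. (\<integral>\<^sup>+ x. ennreal (\<bar>x\<bar> ^ k) \<partial>law_S \<nu> N) \<le> ennreal (C * (F * M'))) sequentially"
    using eventually_ge_at_top[of "max N0 2"]
  proof eventually_elim
    case (elim N)
    then have N: "N0 \<le> N" "2 \<le> N" "1 \<le> N" by auto
    let ?x = "\<lambda>\<sigma> \<tau>. real N powr (1/3) * overlap N (\<sigma>, \<tau>)"
    define B where "B \<sigma> \<tau> = \<bar>?x \<sigma> \<tau>\<bar> ^ (2 * k)" for \<sigma> \<tau>
    define E where "E \<sigma> \<tau> = exp (c * real N powr (1/3) * \<bar>overlap N (\<sigma>, \<tau>)\<bar>)" for \<sigma> \<tau>
    have BE: "B \<sigma> \<tau> \<le> F * E \<sigma> \<tau>" for \<sigma> \<tau>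
    proof -
      have "(c * \<bar>?x \<sigma> \<tau>\<bar>) ^ (2 * k) / fact (2 * k) \<le> exp (c * \<bar>?x \<sigma> \<tau>\<bar>)"
        using c by (intro power_div_fact_le_exp) simp
      then have "c ^ (2 * k) * B \<sigma> \<tau> \<le> fact (2 * k) * E \<sigma> \<tau>"
        by (simp add: B_def E_def power_mult_distrib abs_mult mult.assoc divide_le_eq mult.commute[of "fact _"])
      then show ?thesis using c by (simp add: F_def field_simps)
    qed
    have ib: "integrable (disorder \<kappa> N) (\<lambda>J. replica_avg N J A)" if "\<kappa> = \<nu> \<or> \<kappa> = std_gaussian" for \<kappa> A
      using hybrid_integrable_replica_avg[of N "{}" A] hybrid_integrable_replica_avg[of N "edges N" A] that
      by (auto simp: hybrid_empty hybrid_edges)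
    have "(\<integral>\<^sup>+ x. ennreal (\<bar>x\<bar> ^ k) \<partial>law_S \<nu> N) = (\<integral>\<^sup>+ J. ennreal (\<bar>scaled_avg abs N J\<bar> ^ k) \<partial>disorder \<nu> N)"
      by (rule nn_integral_law_S[OF N(3)]) measurable
    also have "\<dots> \<le> (\<integral>\<^sup>+ J. ennreal (replica_avg N J B) \<partial>disorder \<nu> N)"
    proof (intro nn_integral_mono ennreal_leI)
      fix J
      have "scaled_avg abs N J ^ k \<le> replica_avg N J (\<lambda>\<sigma> \<tau>. (\<bar>?x \<sigma> \<tau>\<bar>\<^sup>2) ^ k)"
        unfolding scaled_avg_def by (rule replica_avg_power_le) simp
      then show "\<bar>scaled_avg abs N J\<bar> ^ k \<le> replica_avg N J B"
        by (simp only: B_def[abs_def] power_mult abs_of_nonneg[OF scaled_avg_nonneg])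
    qed
    also have "\<dots> = ennreal (\<integral>J. replica_avg N J B \<partial>disorder \<nu> N)"
      by (rule nn_integral_eq_integral[OF ib]) (auto intro!: AE_I2 replica_avg_nonneg simp: B_def)
    also have "\<dots> \<le> ennreal (C * (F * M'))"
    proof (rule ennreal_leI)
      have "(\<integral>J. replica_avg N J B \<partial>disorder \<nu> N) \<le> C * (\<integral>J. replica_avg N J B \<partial>disorder std_gaussian N)"
        by (rule C(3)[rule_format, OF N(1)]) (simp add: B_def)
      also have "(\<integral>J. replica_avg N J B \<partial>disorder std_gaussian N) \<le> (\<integral>J. replica_avg N J (\<lambda>\<sigma> \<tau>. F * E \<sigma> \<tau>) \<partial>disorder std_gaussian N)"
        by (intro integral_mono ib replica_avg_mono BE) auto
      also have "\<dots> = F * (\<integral>J. replica_avg N J E \<partial>disorder std_gaussian N)"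
        unfolding replica_avg_cmult by simp
      also have "\<dots> \<le> F * M'" using gauss[OF N(2)] F unfolding E_def[abs_def] by (intro mult_left_mono)
      finally show "(\<integral>J. replica_avg N J B \<partial>disorder \<nu> N) \<le> C * (F * M')"
        using C(2) by (simp add: mult_left_mono)
    qed
    finally show ?case .
  qed
  have B0: "0 \<le> C * (F * M')" using C(2) F by (simp add: M'_def)
  have p0: "0 < p" using p by simp
  have rd: "real_distribution (distr \<Omega> borel S_star)" by (rule L.real_distribution_distr) measurable
  note W = weak_conv_imp_wasserstein[OF real_distribution_law_S rd weak_convergence p0
      bounded_moment_imp_uniformly_integrable[OF real_distribution_law_S p0 k mom B0]]
  show "(\<lambda>N. wasserstein_real p (law_S \<nu> N) (distr \<Omega> borel S_star)) \<longlonglongrightarrow> 0" by (rule W(1))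
  have S0: "0 \<le> S_star \<omega>" for \<omega> by (simp add: S_star_def)
  have star: "(\<integral>\<^sup>+ x. ennreal (\<bar>x\<bar> powr p) \<partial>distr \<Omega> borel S_star) = (\<integral>\<^sup>+ \<omega>. ennreal (S_star \<omega> powr p) \<partial>\<Omega>)"
    by (subst nn_integral_distr) (auto simp: S0)
  show "(\<integral>\<^sup>+ \<omega>. ennreal (S_star \<omega> powr p) \<partial>\<Omega>) < \<infinity>" using W(3) unfolding star .
  have "eventually (\<lambda>N. (\<integral>\<^sup>+ x. ennreal (\<bar>x\<bar> powr p) \<partial>law_S \<nu> N)
      = (\<integral>\<^sup>+ J. ennreal (rescaled_susceptibility N J powr p) \<partial>disorder \<nu> N)) sequentially"
    using eventually_ge_at_top[of 1]
  proof eventually_elim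
    case (elim N)
    have "(\<integral>\<^sup>+ x. ennreal (\<bar>x\<bar> powr p) \<partial>law_S \<nu> N) = (\<integral>\<^sup>+ J. ennreal (\<bar>scaled_avg abs N J\<bar> powr p) \<partial>disorder \<nu> N)"
      by (rule nn_integral_law_S[OF elim]) measurable
    then show ?case by (simp add: rescaled_susceptibility_scaled_avg[OF elim] scaled_avg_nonneg)
  qed
  from Lim_transform_eventually[OF W(2)[unfolded star] this]
  show "(\<lambda>N. \<integral>\<^sup>+ J. ennreal (rescaled_susceptibility N J powr p) \<partial>disorder \<nu> N)
           \<longlonglongrightarrow> (\<integral>\<^sup>+ \<omega>. ennreal (S_star \<omega> powr p) \<partial>\<Omega>)" .
qed

end

theorem corollary5p1:
  fixes b :: real
    and \<nu> :: "real measure"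
    and \<zeta>_star :: "real measure measure"
    and \<Omega> :: "'w measure"
    and \<mu>_star :: "'w \<Rightarrow> real measure"
    and S_star :: "'w \<Rightarrow> real"
  assumes "b \<ge> 1"
    and "prob_space \<nu>" and "sets \<nu> = sets borel"
    and "distr \<nu> borel uminus = \<nu>"
    and "AE x in \<nu>. x \<in> {-b..b}"
    and "(\<integral>x. x\<^sup>2 \<partial>\<nu>) = 1"
    and "\<zeta>_star \<in> P2P2"
    and "(\<lambda>N. WW2 (zetaG N) \<zeta>_star) \<longlonglongrightarrow> 0"
    and "prob_space \<Omega>"
    and "\<mu>_star \<in> measurable \<Omega> borel_P2"
    and "distr \<Omega> borel_P2 \<mu>_star = \<zeta>_star"
    and "S_star = (\<lambda>\<omega>. \<integral>x. x\<^sup>2 \<partial>\<mu>_star \<omega>)"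
  shows "((\<lambda>N. wasserstein_real 1 (law_S \<nu> N) (distr \<Omega> borel S_star)) \<longlonglongrightarrow> 0) \<and>
    ((\<exists>c>0. \<exists>M::real.
        (SUP N\<in>{2..}. \<integral>\<^sup>+ J. (\<integral>\<^sup>+ r. ennreal (exp (c * real N powr (1/3) * \<bar>overlap N r\<bar>))
            \<partial>two_replicas N J) \<partial>disorder std_gaussian N) \<le> ennreal M) \<longrightarrow>
     (\<forall>p\<ge>1::real.
        ((\<lambda>N. wasserstein_real p (law_S \<nu> N) (distr \<Omega> borel S_star)) \<longlonglongrightarrow> 0) \<and>
        ((\<lambda>N. \<integral>\<^sup>+ J. ennreal (rescaled_susceptibility N J powr p) \<partial>disorder \<nu> N)
           \<longlonglongrightarrow> (\<integral>\<^sup>+ \<omega>. ennreal (S_star \<omega> powr p) \<partial>\<Omega>)) \<and>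
        (\<integral>\<^sup>+ \<omega>. ennreal (S_star \<omega> powr p) \<partial>\<Omega>) < \<infinity>))"
proof -
  interpret U: universality \<nu> \<Omega> \<zeta>_star \<mu>_star
    using bond_law_std_gaussian bond_law_bounded[OF assms(2-6)] assms(7-11)
    by (simp add: universality_def two_bond_laws_def gaussian_limit_def gaussian_limit_axioms_def)
  have S: "S_star = U.S_star" by (simp add: assms(12) U.S_star_def[abs_def])
  show ?thesis
    unfolding S using U.W1_convergence U.Wp_convergence by blast
qed

end
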